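(* Let $\Bbbk$ be a unital commutative ring not of characteristic two, let $\mathsf{L}$ be the (linearized) species of linear orders and $\mathsf{C}$ the (linearized) species of compositions, both with their cosymmetric $\mathsf{E}$-bicomodule structures. The morphism $\mathsf{L}\to\mathsf{C}$ induces an isomorphism $H^*(\mathsf{C})\to H^*(\mathsf{L})$ and, in fact, an isomorphism of commutative algebras $K^*(\mathsf{C})\to K^*(\mathsf{L})$.
   Context: A (linear) species is a functor from finite sets and bijections to $\Bbbk$-modules; $\mathsf{X}[n]$ is its value on $[n]=\{1,\ldots,n\}$. A decomposition of $I$ is a tuple of disjoint, possibly empty, subsets with union $I$; a composition is a decomposition with all blocks nonempty. The Cauchy product is $(\mathsf{X}\cdot\mathsf{Y})[I]=\bigoplus_{(S,T)}\mathsf{X}[S]\otimes\mathsf{Y}[T]$ over decompositions. $\mathsf{E}[I]=\Bbbk e_I$ is the exponential species, with coproduct $e_I\mapsto e_S\otimes e_T$. A cosymmetric $\mathsf{E}$-bicomodule is a species $\mathsf{X}$ with functorial natural restriction maps $z\mapsto z|_S$, $\mathsf{X}[I]\to\mathsf{X}[S]$ for $S\subseteq I$, with coactions $\lambda(z)=\sum e_S\otimes z|_T$, $\rho(z)=\sum z|_S\otimes e_T$. $\mathsf{L}[I]$ is free on the linear orders of $I$, with the usual restriction. $\mathsf{C}[I]$ is free on the compositions of $I$; the restriction of $(F_1,\ldots,F_t)$ to $S$ is $(F_1\cap S,\ldots,F_t\cap S)$ with empty blocks deleted. The morphism $\mathsf{L}\to\mathsf{C}$ sends a linear order to the corresponding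 composition into singletons. $H^*(\mathsf{X})$ is the cohomology of $C^n(\mathsf{X})=\operatorname{Hom}(\mathsf{X},\mathsf{E}^{\cdot n})$; cochains are given by coefficients $\alpha(F_1,\ldots,F_n)(z)\in\Bbbk$, and $\delta=\sum_{i=0}^{n+1}(-1)^id^i$ with $(d^0\alpha)(F_0,\ldots,F_n)(z)=\alpha(F_1,\ldots,F_n)(z|_{F_0^c})$, $(d^i\alpha)(F_0,\ldots,F_n)(z)=\alpha(F_0,\ldots,F_{i-1}\cup F_i,\ldots,F_n)(z)$ for $0<i<n+1$, $(d^{n+1}\alpha)(F_0,\ldots,F_n)(z)=\alpha(F_0,\ldots,F_{n-1})(z|_{F_n^c})$. The Koszul complex $K^p(\mathsf{X})=\operatorname{Hom}_{S_p}(\mathsf{X}[p],\operatorname{sgn}_p)$ (sign representation), with zero differential in the cosymmetric case, has product $(f\smile g)(z)=\sum_{(S,T)}(-1)^{\operatorname{sch}(S,T)}f(\lambda_S(z|_S))g(\lambda_T(z|_T))$ for basis elements $z\in\mathsf{X}[p+q]$, over decompositions of $[p+q]$ with $\#S=p$, $\#T=q$; $\lambda_S:S\to[p]$, $\lambda_T:T\to[q]$ are the order-preserving bijections and $\operatorname{sch}(S,T)=\#\{(s,t)\in S\times T:s>t\}$.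
   Formalization: For the isomorphism of commutative algebras K*(C)→K*(L), "not of characteristic two" is strengthened to "2 is not a zero divisor in k"; with characteristic ≠ 2 alone it fails, e.g. for k = Z/4 in degree 2, where the kernel is {x : 2x = 0}. *)

theory Defs
  imports
    "HOL-Algebra.Module"
    "HOL-Algebra.QuotRing"
    "HOL-Combinatorics.Permutations"
    "HOL-Combinatorics.Multiset_Permutations"
    "HOL-Library.Function_Algebras"
    "HOL-Library.Set_Algebras"
begin

section \<open>Linear maps on submodules\<close>

text \<open>
  Modules are submodules of a type, so linearity is relative to a carrier \<open>V\<close>; \<open>s\<close> and \<open>t\<close> are
  the scalar multiplications of source and target.
\<close>

definition linear_on ::
  "'v::plus set \<Rightarrow> ('k \<Rightarrow> 'v \<Rightarrow> 'v) \<Rightarrow> ('k \<Rightarrow> 'w::plus \<Rightarrow> 'w) \<Rightarrow> ('v \<Rightarrow> 'w) \<Rightarrow> bool" where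
  "linear_on V s t f \<longleftrightarrow>
     (\<forall>x\<in>V. \<forall>y\<in>V. f (x + y) = f x + f y) \<and> (\<forall>c. \<forall>x\<in>V. f (s c x) = t c (f x))"

definition linear_iso ::
  "'v::plus set \<Rightarrow> ('k \<Rightarrow> 'v \<Rightarrow> 'v) \<Rightarrow> 'w::plus set \<Rightarrow> ('k \<Rightarrow> 'w \<Rightarrow> 'w) \<Rightarrow> ('v \<Rightarrow> 'w) \<Rightarrow> bool" where
  "linear_iso V s W t f \<longleftrightarrow> linear_on V s t f \<and> bij_betw f V W"


section \<open>Linear species and cosymmetric bicomodules\<close>

text \<open>
  Finite sets are finite subsets of \<open>nat\<close>; these form a small category equivalent to that of all
  finite sets and bijections. A bijection out of \<open>I\<close> is a map \<open>\<sigma>\<close> with \<open>inj_on \<sigma> I\<close>,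
  its target being \<open>\<sigma> ` I\<close>, and \<open>act X I \<sigma>\<close> is the induced map from
  \<open>obj X I\<close> to \<open>obj X (\<sigma> ` I)\<close>. The coactions of a cosymmetric bicomodule over the
  exponential species are encoded by \<open>restr X I S z\<close>, the restriction to \<open>S\<close> of \<open>z\<close> in
  \<open>obj X I\<close>. Only the values at finite sets matter.
\<close>

record ('k, 'v) species =
  obj :: "nat set \<Rightarrow> 'v set"
  scal :: "'k \<Rightarrow> 'v \<Rightarrow> 'v"
  act :: "nat set \<Rightarrow> (nat \<Rightarrow> nat) \<Rightarrow> 'v \<Rightarrow> 'v"

record ('k, 'v) bicomodule = "('k, 'v) species" +
  restr :: "nat set \<Rightarrow> nat set \<Rightarrow> 'v \<Rightarrow> 'v"

locale linear_species =
  fixes X :: "('k::comm_ring_1, 'v::ab_group_add, 'm) species_scheme"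
  assumes module_scal: "Modules.module (scal X)"
    and subspace_obj: "finite I \<Longrightarrow> Modules.module.subspace (scal X) (obj X I)"
    and act_closed: "\<lbrakk>finite I; inj_on \<sigma> I; z \<in> obj X I\<rbrakk> \<Longrightarrow> act X I \<sigma> z \<in> obj X (\<sigma> ` I)"
    and act_linear: "\<lbrakk>finite I; inj_on \<sigma> I\<rbrakk> \<Longrightarrow> linear_on (obj X I) (scal X) (scal X) (act X I \<sigma>)"
    and act_id: "\<lbrakk>finite I; z \<in> obj X I; \<And>i. i \<in> I \<Longrightarrow> \<sigma> i = i\<rbrakk> \<Longrightarrow> act X I \<sigma> z = z"
    and act_comp: "\<lbrakk>finite I; inj_on \<sigma> I; inj_on \<tau> (\<sigma> ` I); z \<in> obj X I\<rbrakk>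
      \<Longrightarrow> act X (\<sigma> ` I) \<tau> (act X I \<sigma> z) = act X I (\<tau> \<circ> \<sigma>) z"

locale cosymmetric_bicomodule = linear_species X
  for X :: "('k::comm_ring_1, 'v::ab_group_add, 'm) bicomodule_scheme" +
  assumes restr_closed: "\<lbrakk>finite I; S \<subseteq> I; z \<in> obj X I\<rbrakk> \<Longrightarrow> restr X I S z \<in> obj X S"
    and restr_linear: "\<lbrakk>finite I; S \<subseteq> I\<rbrakk>
      \<Longrightarrow> linear_on (obj X I) (scal X) (scal X) (restr X I S)"
    and restr_id: "\<lbrakk>finite I; z \<in> obj X I\<rbrakk> \<Longrightarrow> restr X I I z = z"
    and restr_restr: "\<lbrakk>finite I; S \<subseteq> I; T \<subseteq> S; z \<in> obj X I\<rbrakk>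
      \<Longrightarrow> restr X S T (restr X I S z) = restr X I T z"
    and restr_act: "\<lbrakk>finite I; S \<subseteq> I; inj_on \<sigma> I; z \<in> obj X I\<rbrakk>
      \<Longrightarrow> restr X (\<sigma> ` I) (\<sigma> ` S) (act X I \<sigma> z) = act X S \<sigma> (restr X I S z)"

text \<open>
  A morphism of species is normalised to be \<open>0\<close> off the finite sets and off \<open>obj X I\<close>, so that
  equality of functions is equality of morphisms.
\<close>

definition species_hom ::
  "('k, 'v::plus, 'm) species_scheme \<Rightarrow> ('k, 'w::{plus,zero}, 'n) species_scheme
     \<Rightarrow> (nat set \<Rightarrow> 'v \<Rightarrow> 'w) set" where
  "species_hom X Y = {\<alpha>.
     (\<forall>I z. \<not> (finite I \<and> z \<in> obj X I) \<longrightarrow> \<alpha> I z = 0) \<and>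
     (\<forall>I. finite I \<longrightarrow> \<alpha> I ` obj X I \<subseteq> obj Y I \<and> linear_on (obj X I) (scal X) (scal Y) (\<alpha> I)) \<and>
     (\<forall>I \<sigma> z. finite I \<longrightarrow> inj_on \<sigma> I \<longrightarrow> z \<in> obj X I \<longrightarrow>
        \<alpha> (\<sigma> ` I) (act X I \<sigma> z) = act Y I \<sigma> (\<alpha> I z))}"


section \<open>Free modules and linearisation\<close>

text \<open>
  The free module on a finite set \<open>B\<close> consists of the functions vanishing off \<open>B\<close>;
  \<open>lin_ext B \<phi>\<close> sends the basis vector of \<open>x\<close> in \<open>B\<close> to that of \<open>\<phi> x\<close>.
\<close>

definition free_module :: "'b set \<Rightarrow> ('b \<Rightarrow> 'k::comm_ring_1) set" where
  "free_module B = {v. \<forall>x. x \<notin> B \<longrightarrow> v x = 0}"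

definition fscale :: "'k::comm_ring_1 \<Rightarrow> ('b \<Rightarrow> 'k) \<Rightarrow> 'b \<Rightarrow> 'k" where
  "fscale c v = (\<lambda>x. c * v x)"

definition basis_vec :: "'b \<Rightarrow> 'b \<Rightarrow> 'k::comm_ring_1" where
  "basis_vec b = (\<lambda>x. if x = b then 1 else 0)"

definition lin_ext :: "'b set \<Rightarrow> ('b \<Rightarrow> 'c) \<Rightarrow> ('b \<Rightarrow> 'k::comm_ring_1) \<Rightarrow> 'c \<Rightarrow> 'k" where
  "lin_ext B \<phi> v = (\<lambda>y. \<Sum>x\<in>{x\<in>B. \<phi> x = y}. v x)"

text \<open>
  Set-theoretic species with restrictions, and their linearisations. For the species below,
  relabelling and restricting a structure are given by a formula that does not mention the
  underlying set of the structure.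
\<close>

record 'b set_species =
  str :: "nat set \<Rightarrow> 'b set"
  relabel :: "(nat \<Rightarrow> nat) \<Rightarrow> 'b \<Rightarrow> 'b"
  restrict_str :: "nat set \<Rightarrow> 'b \<Rightarrow> 'b"

definition linearize :: "'b set_species \<Rightarrow> ('k::comm_ring_1, 'b \<Rightarrow> 'k) bicomodule" where
  "linearize P = \<lparr>
     obj = (\<lambda>I. free_module (str P I)),
     scal = fscale,
     act = (\<lambda>I \<sigma>. lin_ext (str P I) (relabel P \<sigma>)),
     restr = (\<lambda>I S. lin_ext (str P I) (restrict_str P S))\<rparr>"


section \<open>Decompositions, compositions, linear orders\<close>

definition decompositions :: "nat \<Rightarrow> nat set \<Rightarrow> nat set list set" where
  "decompositions n I = {F. length F = n \<and> \<Union>(set F) = I \<and>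
     (\<forall>i j. i < j \<and> j < n \<longrightarrow> F ! i \<inter> F ! j = {})}"

definition compositions :: "nat set \<Rightarrow> nat set list set" where
  "compositions I = {F. F \<in> decompositions (length F) I \<and> {} \<notin> set F}"

text \<open>A linear order on a finite set is the duplicate-free list of its elements in that order.\<close>

definition Lin :: "nat list set_species" where
  "Lin = \<lparr>str = permutations_of_set, relabel = map, restrict_str = (\<lambda>S. filter (\<lambda>i. i \<in> S))\<rparr>"

definition Comp :: "nat set list set_species" where
  "Comp = \<lparr>str = compositions,
     relabel = (\<lambda>\<sigma>. map ((`) \<sigma>)),
     restrict_str = (\<lambda>S F. filter (\<lambda>B. B \<noteq> {}) (map (\<lambda>B. B \<inter> S) F))\<rparr>"

abbreviation LL :: "('k::comm_ring_1, nat list \<Rightarrow> 'k) bicomodule" where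
  "LL \<equiv> linearize Lin"

abbreviation CC :: "('k::comm_ring_1, nat set list \<Rightarrow> 'k) bicomodule" where
  "CC \<equiv> linearize Comp"

definition L_to_C :: "nat set \<Rightarrow> (nat list \<Rightarrow> 'k::comm_ring_1) \<Rightarrow> nat set list \<Rightarrow> 'k" where
  "L_to_C I v = (if finite I \<and> v \<in> obj LL I
     then lin_ext (str Lin I) (map (\<lambda>i. {i})) v else 0)"


section \<open>Cohomology\<close>

text \<open>
  The \<open>n\<close>-th Cauchy power of the exponential species: expanding the iterated Cauchy product, its
  value at \<open>I\<close> is free on the tensors \<open>e_F1 \<otimes> \<dots> \<otimes> e_Fn\<close> over the decompositions of
  \<open>I\<close> into \<open>n\<close> blocks.
\<close>

definition E_power :: "nat \<Rightarrow> ('k::comm_ring_1, nat set list \<Rightarrow> 'k) species" where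
  "E_power n = \<lparr>
     obj = (\<lambda>I. free_module (decompositions n I)),
     scal = fscale,
     act = (\<lambda>I \<sigma>. lin_ext (decompositions n I) (map ((`) \<sigma>)))\<rparr>"

type_synonym ('k, 'v) cochain = "nat set \<Rightarrow> 'v \<Rightarrow> nat set list \<Rightarrow> 'k"

definition cochains ::
  "nat \<Rightarrow> ('k::comm_ring_1, 'v::ab_group_add) bicomodule \<Rightarrow> ('k, 'v) cochain set" where
  "cochains n X = species_hom X (E_power n)"

text \<open>The coefficient \<open>\<alpha>(F\<^sub>1,\<dots>,F\<^sub>n)(z)\<close>.\<close>

definition cf :: "('k, 'v) cochain \<Rightarrow> nat set list \<Rightarrow> 'v \<Rightarrow> 'k" where
  "cf \<alpha> F z = \<alpha> (\<Union>(set F)) z F"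

definition merge_at :: "nat \<Rightarrow> nat set list \<Rightarrow> nat set list" where
  "merge_at i F = take (i - 1) F @ [F ! (i - 1) \<union> F ! i] @ drop (i + 1) F"

text \<open>The coface \<open>d\<^sup>i\<close> of an \<open>n\<close>-cochain; \<open>F = (F\<^sub>0,\<dots>,F\<^sub>n)\<close> has \<open>n + 1\<close> blocks.\<close>

definition coface :: "nat \<Rightarrow> ('k::comm_ring_1, 'v::ab_group_add) bicomodule \<Rightarrow> nat
    \<Rightarrow> ('k, 'v) cochain \<Rightarrow> ('k, 'v) cochain" where
  "coface n X i \<alpha> = (\<lambda>I z F.
     if finite I \<and> z \<in> obj X I \<and> F \<in> decompositions (n + 1) I then
       if i = 0 then cf \<alpha> (tl F) (restr X I (I - hd F) z)
       else if i = n + 1 then cf \<alpha> (butlast F) (restr X I (I - last F) z)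
       else cf \<alpha> (merge_at i F) z
     else 0)"

definition coboundary :: "nat \<Rightarrow> ('k::comm_ring_1, 'v::ab_group_add) bicomodule
    \<Rightarrow> ('k, 'v) cochain \<Rightarrow> ('k, 'v) cochain" where
  "coboundary n X \<alpha> = (\<lambda>I z F. \<Sum>i\<le>n + 1. (- 1) ^ i * coface n X i \<alpha> I z F)"

definition cocycles ::
  "nat \<Rightarrow> ('k::comm_ring_1, 'v::ab_group_add) bicomodule \<Rightarrow> ('k, 'v) cochain set" where
  "cocycles n X = {\<alpha> \<in> cochains n X. coboundary n X \<alpha> = 0}"

definition coboundaries ::
  "nat \<Rightarrow> ('k::comm_ring_1, 'v::ab_group_add) bicomodule \<Rightarrow> ('k, 'v) cochain set" where
  "coboundaries n X = (case n of 0 \<Rightarrow> {0} | Suc m \<Rightarrow> coboundary m X ` cochains m X)"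

text \<open>
  Cohomology classes are cosets \<open>\<alpha> +o coboundaries n X\<close>. They are added as sets; a scalar
  multiple \<open>c A\<close> has to be saturated, since \<open>c\<close> times the coboundaries may be too small.
\<close>

definition cohomology ::
  "nat \<Rightarrow> ('k::comm_ring_1, 'v::ab_group_add) bicomodule \<Rightarrow> ('k, 'v) cochain set set" where
  "cohomology n X = (\<lambda>\<alpha>. \<alpha> +o coboundaries n X) ` cocycles n X"

definition class_scale :: "nat \<Rightarrow> ('k::comm_ring_1, 'v::ab_group_add) bicomodule
    \<Rightarrow> 'k \<Rightarrow> ('k, 'v) cochain set \<Rightarrow> ('k, 'v) cochain set" where
  "class_scale n X c A = (\<lambda>\<alpha> I z F. c * \<alpha> I z F) ` A + coboundaries n X"

text \<open>
  Precomposition with a morphism \<open>\<phi>\<close> with source \<open>X\<close>, on cochains and on classes: the class of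
  \<open>\<alpha>\<close> is sent to the class of its pullback.
\<close>

definition pullback :: "('k::comm_ring_1, 'v::ab_group_add) bicomodule \<Rightarrow> (nat set \<Rightarrow> 'v \<Rightarrow> 'w)
    \<Rightarrow> ('k, 'w) cochain \<Rightarrow> ('k, 'v) cochain" where
  "pullback X \<phi> \<alpha> = (\<lambda>I z. if finite I \<and> z \<in> obj X I then \<alpha> I (\<phi> I z) else 0)"

definition cohomology_map :: "nat \<Rightarrow> ('k::comm_ring_1, 'v::ab_group_add) bicomodule
    \<Rightarrow> (nat set \<Rightarrow> 'v \<Rightarrow> 'w) \<Rightarrow> ('k, 'w) cochain set \<Rightarrow> ('k, 'v) cochain set" where
  "cohomology_map n X \<phi> A = pullback X \<phi> ` A + coboundaries n X"


section \<open>The Koszul algebra\<close>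

definition koszul ::
  "nat \<Rightarrow> ('k::comm_ring_1, 'v::ab_group_add) bicomodule \<Rightarrow> ('v \<Rightarrow> 'k) set" where
  "koszul p X = {f.
     (\<forall>z. z \<notin> obj X {1..p} \<longrightarrow> f z = 0) \<and>
     linear_on (obj X {1..p}) (scal X) (*) f \<and>
     (\<forall>\<sigma> z. \<sigma> permutes {1..p} \<longrightarrow> z \<in> obj X {1..p} \<longrightarrow>
        f (act X {1..p} \<sigma> z) = of_int (sign \<sigma>) * f z)}"

definition sch :: "nat set \<Rightarrow> nat set \<Rightarrow> nat" where
  "sch S T = card {(s, t) \<in> S \<times> T. s > t}"

text \<open>The order-preserving bijection from \<open>S\<close> to \<open>{1..card S}\<close>.\<close>

definition std :: "nat set \<Rightarrow> nat \<Rightarrow> nat" where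
  "std S s = card {x \<in> S. x \<le> s}"

text \<open>
  The product is prescribed on basis elements only (the formula is quadratic in \<open>z\<close>) and is
  extended linearly; this is why it is defined for a linearised species.
\<close>

definition cup_basis :: "'b set_species \<Rightarrow> nat \<Rightarrow> nat \<Rightarrow> (('b \<Rightarrow> 'k::comm_ring_1) \<Rightarrow> 'k)
    \<Rightarrow> (('b \<Rightarrow> 'k) \<Rightarrow> 'k) \<Rightarrow> ('b \<Rightarrow> 'k) \<Rightarrow> 'k" where
  "cup_basis P p q f g z =
     (\<Sum>(S, T) \<in> {(S, T). S \<union> T = {1..p + q} \<and> S \<inter> T = {} \<and> card S = p \<and> card T = q}.
        (- 1) ^ sch S T
        * f (act (linearize P) S (std S) (restr (linearize P) {1..p + q} S z))
        * g (act (linearize P) T (std T) (restr (linearize P) {1..p + q} T z)))"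

definition cup :: "'b set_species \<Rightarrow> nat \<Rightarrow> nat \<Rightarrow> (('b \<Rightarrow> 'k::comm_ring_1) \<Rightarrow> 'k)
    \<Rightarrow> (('b \<Rightarrow> 'k) \<Rightarrow> 'k) \<Rightarrow> ('b \<Rightarrow> 'k) \<Rightarrow> 'k" where
  "cup P p q f g v =
     (if v \<in> free_module (str P {1..p + q})
      then \<Sum>b\<in>str P {1..p + q}. v b * cup_basis P p q f g (basis_vec b) else 0)"

text \<open>
  The unit lies in degree \<open>0\<close>: the linear form on \<open>X[\<emptyset>]\<close> that is \<open>1\<close> on basis elements, that
  is, the empty product.
\<close>

definition cup_unit :: "'b set_species \<Rightarrow> ('b \<Rightarrow> 'k::comm_ring_1) \<Rightarrow> 'k" where
  "cup_unit P v = (if v \<in> free_module (str P {}) then \<Sum>b\<in>str P {}. v b else 0)"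

definition scalar_ring :: "'k::comm_ring_1 ring" where
  "scalar_ring = \<lparr>carrier = UNIV, monoid.mult = (*), one = 1, ring.zero = 0, add = (+)\<rparr>"

text \<open>The graded algebra \<open>K\<^sup>*\<close>, as the direct sum of its homogeneous components.\<close>

definition koszul_algebra ::
  "'b set_species \<Rightarrow> ('k::comm_ring_1, nat \<Rightarrow> ('b \<Rightarrow> 'k) \<Rightarrow> 'k) module" where
  "koszul_algebra P = \<lparr>
     carrier = {f. (\<forall>p. f p \<in> koszul p (linearize P)) \<and> finite {p. f p \<noteq> 0}},
     monoid.mult = (\<lambda>f g n. \<Sum>p\<le>n. cup P p (n - p) (f p) (g (n - p))),
     one = (\<lambda>n. if n = 0 then cup_unit P else 0),
     ring.zero = 0,
     add = (\<lambda>f g. f + g),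
     smult = (\<lambda>c f p v. c * f p v)\<rparr>"

definition koszul_pullback :: "nat \<Rightarrow> ('k::comm_ring_1, 'v::ab_group_add) bicomodule
    \<Rightarrow> (nat set \<Rightarrow> 'v \<Rightarrow> 'w) \<Rightarrow> ('w \<Rightarrow> 'k) \<Rightarrow> 'v \<Rightarrow> 'k" where
  "koszul_pullback p X \<phi> f = (\<lambda>z. if z \<in> obj X {1..p} then f (\<phi> {1..p} z) else 0)"

definition koszul_map :: "('k::comm_ring_1, 'v::ab_group_add) bicomodule
    \<Rightarrow> (nat set \<Rightarrow> 'v \<Rightarrow> 'w) \<Rightarrow> (nat \<Rightarrow> 'w \<Rightarrow> 'k) \<Rightarrow> nat \<Rightarrow> 'v \<Rightarrow> 'k" where
  "koszul_map X \<phi> f = (\<lambda>p. koszul_pullback p X \<phi> (f p))"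

definition graded_commutative ::
  "'b set_species \<Rightarrow> 'k::comm_ring_1 itself \<Rightarrow> bool" where
  "graded_commutative P _ \<longleftrightarrow>
     (\<forall>p q. \<forall>f \<in> koszul p (linearize P :: ('k, 'b \<Rightarrow> 'k) bicomodule). \<forall>g \<in> koszul q (linearize P).
        cup P p q f g = (\<lambda>v. (- 1) ^ (p * q) * cup P q p g f v))"


section \<open>Well-formedness of the structures\<close>

lemma lin_ext_closed: "\<phi> ` B \<subseteq> B' \<Longrightarrow> lin_ext B \<phi> v \<in> free_module B'"
  by (auto simp: lin_ext_def free_module_def intro!: sum.neutral)

lemma lin_ext_linear: "linear_on V fscale fscale (lin_ext B \<phi>)"
  by (auto simp: linear_on_def lin_ext_def fscale_def fun_eq_iff sum.distrib sum_distrib_left)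

lemma lin_ext_id:
  assumes "v \<in> free_module B" "\<And>x. x \<in> B \<Longrightarrow> \<phi> x = x"
  shows "lin_ext B \<phi> v = v"
proof
  fix y
  have "{x \<in> B. \<phi> x = y} = (if y \<in> B then {y} else {})"
    using assms(2) by auto
  then show "lin_ext B \<phi> v y = v y"
    using assms(1) by (auto simp: lin_ext_def free_module_def)
qed

lemma lin_ext_comp:
  assumes "finite B" "finite B'" "\<phi> ` B \<subseteq> B'" "\<And>x. x \<in> B \<Longrightarrow> \<psi> (\<phi> x) = \<chi> x"
  shows "lin_ext B' \<psi> (lin_ext B \<phi> v) = lin_ext B \<chi> v"
proof
  fix y
  have "lin_ext B' \<psi> (lin_ext B \<phi> v) y
      = (\<Sum>x'\<in>{x'\<in>B'. \<psi> x' = y}. \<Sum>x\<in>{x\<in>{x\<in>B. \<chi> x = y}. \<phi> x = x'}. v x)"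
    unfolding lin_ext_def using assms(4) by (intro sum.cong) auto
  also have "\<dots> = (\<Sum>x\<in>{x\<in>B. \<chi> x = y}. v x)"
    using assms by (intro sum.group) auto
  finally show "lin_ext B' \<psi> (lin_ext B \<phi> v) y = lin_ext B \<chi> v y"
    by (simp add: lin_ext_def)
qed

lemma lin_ext_cong: "(\<And>x. x \<in> B \<Longrightarrow> \<phi> x = \<psi> x) \<Longrightarrow> lin_ext B \<phi> v = lin_ext B \<psi> v"
  unfolding lin_ext_def by (intro ext sum.cong) auto

lemma module_fscale: "Modules.module (fscale :: 'k::comm_ring_1 \<Rightarrow> ('b \<Rightarrow> 'k) \<Rightarrow> _)"
  by unfold_locales (auto simp: fscale_def fun_eq_iff algebra_simps)

lemma subspace_free_module: "Modules.module.subspace fscale (free_module B)"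
  unfolding Modules.module.subspace_def[OF module_fscale]
  by (auto simp: free_module_def fscale_def)

lemma finite_decompositions: "finite I \<Longrightarrow> finite (decompositions n I)"
  by (rule finite_subset[OF _ finite_lists_length_eq[of "Pow I" n]])
     (auto simp: decompositions_def)

lemma decompositions_image:
  assumes "F \<in> decompositions n I" "inj_on \<sigma> I"
  shows "map ((`) \<sigma>) F \<in> decompositions n (\<sigma> ` I)"
proof -
  have "\<sigma> ` (F ! i) \<inter> \<sigma> ` (F ! j) = {}" if "i < j" "j < n" for i j
  proof -
    have "F ! i \<subseteq> I" "F ! j \<subseteq> I" "F ! i \<inter> F ! j = {}"
      using assms(1) that by (auto simp: decompositions_def)
    then show ?thesis
      using inj_on_image_Int[OF assms(2), of "F ! i" "F ! j"] by simp
  qed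
  then show ?thesis using assms(1) by (auto simp: decompositions_def image_Union)
qed

lemma map_image_id:
  assumes "F \<in> decompositions n I" "\<And>i. i \<in> I \<Longrightarrow> \<sigma> i = i"
  shows "map ((`) \<sigma>) F = F"
proof (rule map_idI)
  fix B assume "B \<in> set F"
  then have "B \<subseteq> I" using assms(1) by (auto simp: decompositions_def)
  then show "\<sigma> ` B = B" using assms(2) by force
qed

lemma linear_species_E_power: "linear_species (E_power n)"
proof (rule linear_species.intro, goal_cases)
  case 1 show ?case using module_fscale by (simp add: E_power_def)
next
  case 2 show ?case using subspace_free_module by (simp add: E_power_def)
next
  case 3 then show ?case
    by (auto simp: E_power_def intro!: lin_ext_closed decompositions_image)
next
  case 4 show ?case by (simp add: E_power_def lin_ext_linear)
next
  case 5 then show ?case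
    by (auto simp: E_power_def intro!: lin_ext_id map_image_id)
next
  case 6 then show ?case
    by (auto simp: E_power_def finite_decompositions image_image
        intro!: lin_ext_comp decompositions_image)
qed

lemma cosymmetric_bicomodule_linearize:
  assumes fin: "\<And>I. finite I \<Longrightarrow> finite (str P I)"
    and rel: "\<And>I \<sigma> x. \<lbrakk>finite I; inj_on \<sigma> I; x \<in> str P I\<rbrakk> \<Longrightarrow> relabel P \<sigma> x \<in> str P (\<sigma> ` I)"
    and rel_id: "\<And>I \<sigma> x. \<lbrakk>finite I; x \<in> str P I; \<And>i. i \<in> I \<Longrightarrow> \<sigma> i = i\<rbrakk> \<Longrightarrow> relabel P \<sigma> x = x"
    and rel_comp: "\<And>\<sigma> \<tau> x. relabel P \<tau> (relabel P \<sigma> x) = relabel P (\<tau> \<circ> \<sigma>) x"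
    and res: "\<And>I S x. \<lbrakk>finite I; S \<subseteq> I; x \<in> str P I\<rbrakk> \<Longrightarrow> restrict_str P S x \<in> str P S"
    and res_id: "\<And>I x. \<lbrakk>finite I; x \<in> str P I\<rbrakk> \<Longrightarrow> restrict_str P I x = x"
    and res_res: "\<And>I S T x. \<lbrakk>finite I; T \<subseteq> S; S \<subseteq> I; x \<in> str P I\<rbrakk>
      \<Longrightarrow> restrict_str P T (restrict_str P S x) = restrict_str P T x"
    and res_rel: "\<And>I S \<sigma> x. \<lbrakk>finite I; S \<subseteq> I; inj_on \<sigma> I; x \<in> str P I\<rbrakk>
      \<Longrightarrow> restrict_str P (\<sigma> ` S) (relabel P \<sigma> x) = relabel P \<sigma> (restrict_str P S x)"
  shows "cosymmetric_bicomodule (linearize P)"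
proof (intro cosymmetric_bicomodule.intro linear_species.intro cosymmetric_bicomodule_axioms.intro,
    goal_cases)
  case 1 show ?case using module_fscale by (simp add: linearize_def)
next
  case 2 show ?case using subspace_free_module by (simp add: linearize_def)
next
  case 3 then show ?case
    by (auto simp: linearize_def intro!: lin_ext_closed rel)
next
  case 4 show ?case by (simp add: linearize_def lin_ext_linear)
next
  case 5 then show ?case by (auto simp: linearize_def intro!: lin_ext_id rel_id)
next
  case 6 then show ?case
    by (auto simp: linearize_def intro!: lin_ext_comp fin rel rel_comp)
next
  case 7 then show ?case by (auto simp: linearize_def intro!: lin_ext_closed res)
next
  case 8 show ?case by (simp add: linearize_def lin_ext_linear)
next
  case 9 then show ?case by (auto simp: linearize_def intro!: lin_ext_id res_id)
next
  case (10 I S T z)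
  then have "finite S" by (auto intro: finite_subset)
  with 10 have "lin_ext (str P S) (restrict_str P T) (lin_ext (str P I) (restrict_str P S) z)
      = lin_ext (str P I) (restrict_str P T) z"
    by (intro lin_ext_comp) (auto intro!: fin res res_res)
  then show ?case by (simp add: linearize_def)
next
  case (11 I S \<sigma> z)
  then have S: "finite S" "inj_on \<sigma> S" by (auto intro: finite_subset inj_on_subset)
  let ?\<chi> = "\<lambda>x. relabel P \<sigma> (restrict_str P S x)"
  have "lin_ext (str P (\<sigma> ` I)) (restrict_str P (\<sigma> ` S)) (lin_ext (str P I) (relabel P \<sigma>) z)
      = lin_ext (str P I) ?\<chi> z"
    using 11 by (intro lin_ext_comp) (auto intro!: fin rel res_rel)
  also have "\<dots> = lin_ext (str P S) (relabel P \<sigma>) (lin_ext (str P I) (restrict_str P S) z)"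
    using 11 S by (intro lin_ext_comp[symmetric]) (auto intro!: fin res)
  finally show ?case by (simp add: linearize_def)
qed

lemma cosymmetric_bicomodule_LL: "cosymmetric_bicomodule LL"
proof (rule cosymmetric_bicomodule_linearize, goal_cases)
  case 1 then show ?case by (simp add: Lin_def)
next
  case (2 I \<sigma> x) then show ?case
    by (auto simp: Lin_def permutations_of_set_def distinct_map)
next
  case (3 I \<sigma> x) then show ?case
    by (auto simp: Lin_def permutations_of_set_def intro!: map_idI)
next
  case (7 I S T x)
  then have "(i \<in> S \<and> i \<in> T) = (i \<in> T)" for i by auto
  then show ?case by (simp add: Lin_def)
next
  case (8 I S \<sigma> x)
  then have "\<sigma> i \<in> \<sigma> ` S \<longleftrightarrow> i \<in> S" if "i \<in> set x" for i
    using that by (auto simp: Lin_def permutations_of_set_def inj_on_def)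
  then show ?case by (auto simp: Lin_def filter_map o_def intro!: arg_cong[of _ _ "map \<sigma>"] filter_cong)
qed (auto simp: Lin_def permutations_of_set_def)

lemma compositions_iff:
  "F \<in> compositions I \<longleftrightarrow> \<Union>(set F) = I \<and> {} \<notin> set F \<and> pairwise disjnt (set F) \<and> distinct F"
proof -
  have "(\<forall>i j. i < j \<and> j < length F \<longrightarrow> F ! i \<inter> F ! j = {}) \<longleftrightarrow>
    pairwise disjnt (set F) \<and> distinct F" if "{} \<notin> set F"
  proof
    assume *: "\<forall>i j. i < j \<and> j < length F \<longrightarrow> F ! i \<inter> F ! j = {}"
    have d: "F ! i \<inter> F ! j = {}" if "i \<noteq> j" "i < length F" "j < length F" for i j
      using * that Int_commute[of "F ! i" "F ! j"] by (cases "i < j") auto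
    show "pairwise disjnt (set F) \<and> distinct F"
    proof
      show "pairwise disjnt (set F)"
        unfolding pairwise_def disjnt_def using d by (metis in_set_conv_nth)
      show "distinct F"
        unfolding distinct_conv_nth
      proof (intro allI impI)
        fix i j assume ij: "i < length F" "j < length F" "i \<noteq> j"
        then have "F ! i \<in> set F" "F ! i \<inter> F ! j = {}"
          using d by simp_all
        moreover from this have "F ! i \<noteq> {}"
          using \<open>{} \<notin> set F\<close> by metis
        ultimately have "F ! i \<noteq> {}" "F ! i \<inter> F ! j = {}" by simp_all
        then show "F ! i \<noteq> F ! j" by auto
      qed
    qed
  next
    assume *: "pairwise disjnt (set F) \<and> distinct F"
    show "\<forall>i j. i < j \<and> j < length F \<longrightarrow> F ! i \<inter> F ! j = {}"
    proof (intro allI impI)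
      fix i j assume ij: "i < j \<and> j < length F"
      then have "F ! i \<in> set F" "F ! j \<in> set F" by simp_all
      moreover have "F ! i \<noteq> F ! j" using * ij by (simp add: nth_eq_iff_index_eq)
      ultimately show "F ! i \<inter> F ! j = {}"
        using * unfolding pairwise_def disjnt_def by blast
    qed
  qed
  then show ?thesis unfolding compositions_def decompositions_def by blast
qed

lemma finite_compositions:
  assumes "finite I" shows "finite (compositions I)"
proof (rule finite_subset[OF _ finite_subset_distinct[of "Pow I"]])
  show "compositions I \<subseteq> {F. set F \<subseteq> Pow I \<and> distinct F}"
    by (auto simp: compositions_iff)
qed (use assms in auto)

lemma compositions_restrict:
  assumes "F \<in> compositions I" "S \<subseteq> I"
  shows "filter (\<lambda>B. B \<noteq> {}) (map (\<lambda>B. B \<inter> S) F) \<in> compositions S"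
proof -
  have d: "A = B" if "A \<in> set F" "B \<in> set F" "x \<in> A" "x \<in> B" for A B x
    using assms(1) that by (auto simp: compositions_iff pairwise_def disjnt_def)
  have "distinct (filter (\<lambda>B. B \<noteq> {}) (map (\<lambda>B. B \<inter> S) F))"
    using assms(1) d
    by (fastforce simp: compositions_iff filter_map distinct_map inj_on_def)
  moreover have "pairwise disjnt (set (filter (\<lambda>B. B \<noteq> {}) (map (\<lambda>B. B \<inter> S) F)))"
    unfolding pairwise_def disjnt_def using d by auto
  moreover have "\<Union>(set (filter (\<lambda>B. B \<noteq> {}) (map (\<lambda>B. B \<inter> S) F))) = \<Union>(set F) \<inter> S"
    by auto
  moreover have "\<Union>(set F) \<inter> S = S"
    using assms by (auto simp: compositions_iff)
  ultimately show ?thesis by (simp add: compositions_iff)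
qed

lemma cosymmetric_bicomodule_CC: "cosymmetric_bicomodule CC"
proof (rule cosymmetric_bicomodule_linearize, goal_cases)
  case 1 then show ?case by (simp add: Comp_def finite_compositions)
next
  case (2 I \<sigma> x) then show ?case
    using decompositions_image[of x "length x" I \<sigma>] by (auto simp: Comp_def compositions_def)
next
  case (3 I \<sigma> x) then show ?case
    using map_image_id[of x "length x" I \<sigma>] by (auto simp: Comp_def compositions_def)
next
  case 4 show ?case by (simp add: Comp_def image_image o_def)
next
  case 5 then show ?case by (auto simp: Comp_def compositions_restrict)
next
  case (6 I x)
  then have "map (\<lambda>B. B \<inter> I) x = x"
    by (intro map_idI) (auto simp: Comp_def compositions_iff)
  then show ?case using 6 by (auto simp: Comp_def compositions_iff filter_id_conv)
next
  case (7 I S T x)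
  then have "B \<inter> S \<inter> T = B \<inter> T" for B by auto
  then have "filter (\<lambda>B. B \<noteq> {}) (map (\<lambda>B. B \<inter> T) (filter (\<lambda>B. B \<noteq> {}) (map (\<lambda>B. B \<inter> S) F)))
    = filter (\<lambda>B. B \<noteq> {}) (map (\<lambda>B. B \<inter> T) F)" for F
    by (induction F) auto
  then show ?case by (simp add: Comp_def)
next
  case (8 I S \<sigma> x)
  then have "B \<subseteq> I" if "B \<in> set x" for B
    using that by (auto simp: Comp_def compositions_iff)
  then have "\<sigma> ` B \<inter> \<sigma> ` S = \<sigma> ` (B \<inter> S)" if "B \<in> set x" for B
    using that inj_on_image_Int[OF \<open>inj_on \<sigma> I\<close>] \<open>S \<subseteq> I\<close> by simp
  then have "filter (\<lambda>B. B \<noteq> {}) (map (\<lambda>B. B \<inter> \<sigma> ` S) (map ((`) \<sigma>) x))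
    = map ((`) \<sigma>) (filter (\<lambda>B. B \<noteq> {}) (map (\<lambda>B. B \<inter> S) x))"
    by (induction x) auto
  then show ?case by (simp add: Comp_def)
qed

lemma singletons_in_compositions:
  "xs \<in> permutations_of_set I \<Longrightarrow> map (\<lambda>i. {i}) xs \<in> compositions I"
  by (auto simp: permutations_of_set_def compositions_iff distinct_map pairwise_def disjnt_def)

lemma L_to_C_hom: "L_to_C \<in> species_hom LL CC"
proof -
  have "L_to_C (\<sigma> ` I) (act LL I \<sigma> z) = act CC I \<sigma> (L_to_C I z)"
    if "finite I" "inj_on \<sigma> I" "z \<in> obj LL I" for I \<sigma> and z :: "nat list \<Rightarrow> 'a"
  proof -
    interpret L: cosymmetric_bicomodule "LL :: ('a, nat list \<Rightarrow> 'a) bicomodule"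
      by (rule cosymmetric_bicomodule_LL)
    have fin: "finite (str Lin I)" "finite (str Lin (\<sigma> ` I))" "finite (str Comp I)"
      using that by (simp_all add: Lin_def Comp_def finite_compositions)
    have "lin_ext (str Lin (\<sigma> ` I)) (map (\<lambda>i. {i})) (lin_ext (str Lin I) (map \<sigma>) z)
        = lin_ext (str Lin I) (map (\<lambda>i. {\<sigma> i})) z"
      using that fin
      by (intro lin_ext_comp) (auto simp: Lin_def permutations_of_set_def distinct_map)
    also have "\<dots> = lin_ext (str Comp I) (map ((`) \<sigma>)) (lin_ext (str Lin I) (map (\<lambda>i. {i})) z)"
      using fin
      by (intro lin_ext_comp[symmetric]) (auto simp: Lin_def Comp_def singletons_in_compositions)
    finally show ?thesis
      using that L.act_closed[OF that]
      by (simp add: L_to_C_def) (simp add: linearize_def Lin_def Comp_def)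
  qed
  moreover have "L_to_C I z \<in> obj CC I" if "finite I" "z \<in> obj LL I"
    for I and z :: "nat list \<Rightarrow> 'a"
    using that unfolding L_to_C_def
    by (auto simp: linearize_def Lin_def Comp_def intro!: lin_ext_closed singletons_in_compositions)
  moreover have "linear_on (obj LL I) (scal LL) (scal CC) (L_to_C I)" if "finite I"
    for I :: "nat set"
    using that lin_ext_linear[of "obj LL I" "str Lin I" "map (\<lambda>i. {i})"]
    by (auto simp: linear_on_def L_to_C_def linearize_def free_module_def fscale_def)
  ultimately show ?thesis
    by (auto simp: species_hom_def L_to_C_def)
qed

lemma L_to_C_restr:
  fixes z :: "nat list \<Rightarrow> 'k::comm_ring_1"
  assumes "finite I" "S \<subseteq> I" "z \<in> obj LL I"
  shows "L_to_C S (restr LL I S z) = restr CC I S (L_to_C I z)"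
proof -
  interpret L: cosymmetric_bicomodule "LL :: ('k, nat list \<Rightarrow> 'k) bicomodule"
    by (rule cosymmetric_bicomodule_LL)
  have S: "finite S" using assms finite_subset by blast
  have fin: "finite (str Lin I)" "finite (str Lin S)" "finite (str Comp I)"
    using assms S by (auto simp: Lin_def Comp_def finite_compositions)
  have eq: "filter (\<lambda>B. B \<noteq> {}) (map (\<lambda>B. B \<inter> S) (map (\<lambda>i. {i}) xs))
    = map (\<lambda>i. {i}) (filter (\<lambda>i. i \<in> S) xs)" for xs
    by (induction xs) auto
  have "lin_ext (str Lin S) (map (\<lambda>i. {i})) (lin_ext (str Lin I) (filter (\<lambda>i. i \<in> S)) z)
      = lin_ext (str Lin I) (\<lambda>xs. map (\<lambda>i. {i}) (filter (\<lambda>i. i \<in> S) xs)) z"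
    using assms fin by (intro lin_ext_comp) (auto simp: Lin_def permutations_of_set_def)
  also have "\<dots> = lin_ext (str Comp I) (restrict_str Comp S)
      (lin_ext (str Lin I) (map (\<lambda>i. {i})) z)"
    using fin eq
    by (intro lin_ext_comp[symmetric]) (auto simp: Lin_def Comp_def singletons_in_compositions)
  finally show ?thesis
    using assms S L.restr_closed[OF assms]
    by (simp add: L_to_C_def) (simp add: linearize_def Lin_def)
qed

end

theory Submission
  imports Defs
begin

text \<open>
  Both parts rest on expressing everything in terms of basis structures.

  Cohomology. A cochain on a linearised species is a function of the pairs \<open>(F, b)\<close>, where \<open>F\<close> is a
  decomposition into \<open>n\<close> blocks and \<open>b\<close> a basis structure on the union of the blocks, that is
  invariant under relabelling. The pairs are the simplices of a semi-simplicial set: an inner face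
  merges two neighbouring blocks, an outer face drops the first or last block and restricts \<open>b\<close>. The
  coboundary is the alternating sum over the faces (\<open>coboundary_coefficients\<close>). Linear orders are the
  compositions into singletons, so the map from cochains on compositions to cochains on linear orders
  restricts invariant functions to a set of simplices that is closed under faces; extension by zero
  shows that it is surjective. The long exact sequence reduces the claim to the acyclicity of the
  kernel (\<open>relative_complex_acyclic\<close>), whose elements live on the pairs \<open>(F, G)\<close> where \<open>G\<close> has a block
  \<open>B\<close> with at least two elements. Up to relabelling, and for a fixed \<open>G\<close>, the decompositions \<open>F\<close> are
  the weakly increasing sequences from bottom to top in the product of the chains \<open>{0..card C}\<close>, for
  \<open>C\<close> in \<open>G\<close>. If \<open>e\<close> is the atom in the factor of \<open>B\<close>, then \<open>v \<le> sup v e \<ge> e\<close>, and \<open>sup v e\<close> is the top only if \<open>v\<close>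
  is, because \<open>B\<close> has two elements; so the order complex of the proper part is contractible. The
  resulting homotopy \<open>contraction\<close> splits one element of \<open>B\<close> off the first block of \<open>F\<close> that meets
  \<open>B\<close>. It contracts the complex up to terms with a smaller ground set or an earlier first meeting
  block (\<open>diff_contraction\<close>), and these errors die out after finitely many iterations at each simplex.

  The Koszul algebra. An alternating form on linear orders is determined by its value at one order.
  An alternating form vanishes at a composition with a block of two or more elements, since the
  transposition of two elements of the block fixes the composition, so that twice the value is zero,
  and the ring has no 2-torsion (\<open>koszul_Comp_vanishes\<close>). Hence restriction to linear orders is bijective. The product formula makes
  sense on every finite set after extending a form along the order-preserving bijections. The sign of
  a relabelling is a product over the two-element subsets, so on a disjoint union \<open>S \<union> T\<close> it is
  the product of the signs on \<open>S\<close> and \<open>T\<close> and the signs \<open>(- 1) ^ sch S T\<close> before and after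
  relabelling (\<open>reorder_sign_Un\<close>); from this the product of alternating forms is alternating, and
  associativity and graded commutativity become statements about the numbers \<open>sch\<close>. On linear orders,
  reversing \<open>{1..p + q}\<close> shows moreover that the product is commutative without sign
  (\<open>cup_Lin_commute\<close>), which agrees with graded commutativity because products of two elements of odd degree vanish.
\<close>

section \<open>Set species with restrictions\<close>

locale restriction_species =
  fixes P :: "'b set_species"
  assumes finite_str: "finite I \<Longrightarrow> finite (str P I)"
    and relabel_closed: "\<lbrakk>finite I; inj_on \<sigma> I; b \<in> str P I\<rbrakk> \<Longrightarrow> relabel P \<sigma> b \<in> str P (\<sigma> ` I)"
    and relabel_id: "\<lbrakk>finite I; b \<in> str P I; \<And>i. i \<in> I \<Longrightarrow> \<sigma> i = i\<rbrakk> \<Longrightarrow> relabel P \<sigma> b = b"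
    and relabel_comp: "\<lbrakk>finite I; inj_on \<sigma> I; inj_on \<tau> (\<sigma> ` I); b \<in> str P I\<rbrakk>
      \<Longrightarrow> relabel P \<tau> (relabel P \<sigma> b) = relabel P (\<tau> \<circ> \<sigma>) b"
    and restrict_closed: "\<lbrakk>finite I; S \<subseteq> I; b \<in> str P I\<rbrakk> \<Longrightarrow> restrict_str P S b \<in> str P S"
    and restrict_id: "\<lbrakk>finite I; b \<in> str P I\<rbrakk> \<Longrightarrow> restrict_str P I b = b"
    and restrict_restrict: "\<lbrakk>finite I; T \<subseteq> S; S \<subseteq> I; b \<in> str P I\<rbrakk>
      \<Longrightarrow> restrict_str P T (restrict_str P S b) = restrict_str P T b"
    and restrict_relabel: "\<lbrakk>finite I; S \<subseteq> I; inj_on \<sigma> I; b \<in> str P I\<rbrakk>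
      \<Longrightarrow> restrict_str P (\<sigma> ` S) (relabel P \<sigma> b) = relabel P \<sigma> (restrict_str P S b)"

lemma sum_fun_apply: "(\<Sum>i\<in>A. f i) x = (\<Sum>i\<in>A. f i x)"
  by (induction A rule: infinite_finite_induct) simp_all

lemma basis_vec_inject: "(basis_vec b :: 'b \<Rightarrow> 'k::comm_ring_1) = basis_vec c \<longleftrightarrow> b = c"
  by (metis basis_vec_def zero_neq_one)

lemma basis_vec_in_free_module:
  "(basis_vec b :: 'b \<Rightarrow> 'k::comm_ring_1) \<in> free_module B \<longleftrightarrow> b \<in> B"
  unfolding free_module_def basis_vec_def by auto

lemma lin_ext_basis_vec:
  assumes "finite B" "b \<in> B"
  shows "lin_ext B \<phi> (basis_vec b :: 'b \<Rightarrow> 'k::comm_ring_1) = basis_vec (\<phi> b)"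
proof
  fix y
  show "lin_ext B \<phi> (basis_vec b :: 'b \<Rightarrow> 'k) y = basis_vec (\<phi> b) y"
    using assms unfolding lin_ext_def basis_vec_def
    by (auto simp: sum.If_cases)
qed

text \<open>
  Basis vectors of distinct structures are distinct, so the axioms of a cosymmetric bicomodule,
  evaluated at basis vectors, are the axioms for the structures. Integer coefficients are an
  arbitrary choice.
\<close>
lemma restriction_species_of_linearize:
  assumes "\<And>I. finite I \<Longrightarrow> finite (str P I)"
    and "cosymmetric_bicomodule (linearize P :: (int, 'b \<Rightarrow> int) bicomodule)"
  shows "restriction_species P"
proof -
  let ?X = "linearize P :: (int, 'b \<Rightarrow> int) bicomodule"
  interpret X: cosymmetric_bicomodule ?X by fact
  have obj: "(basis_vec b :: 'b \<Rightarrow> int) \<in> obj ?X I \<longleftrightarrow> b \<in> str P I" for b I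
    by (simp add: linearize_def basis_vec_in_free_module)
  have act: "act ?X I \<sigma> (basis_vec b) = basis_vec (relabel P \<sigma> b)" if "finite I" "b \<in> str P I" for I \<sigma> b
    using that assms(1) by (simp add: linearize_def lin_ext_basis_vec)
  have res: "restr ?X I S (basis_vec b) = basis_vec (restrict_str P S b)" if "finite I" "b \<in> str P I" for I S b
    using that assms(1) by (simp add: linearize_def lin_ext_basis_vec)
  show ?thesis
  proof
    fix I :: "nat set" and \<sigma> :: "nat \<Rightarrow> nat" and b assume I: "finite I" "inj_on \<sigma> I" "b \<in> str P I"
    show c: "relabel P \<sigma> b \<in> str P (\<sigma> ` I)"
      using X.act_closed[of I \<sigma> "basis_vec b"] I by (simp add: obj act)
    fix \<tau> :: "nat \<Rightarrow> nat" assume "inj_on \<tau> (\<sigma> ` I)"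
    then show "relabel P \<tau> (relabel P \<sigma> b) = relabel P (\<tau> \<circ> \<sigma>) b"
      using X.act_comp[of I \<sigma> \<tau> "basis_vec b"] I c by (simp add: obj act basis_vec_inject)
  next
    fix I :: "nat set" and \<sigma> :: "nat \<Rightarrow> nat" and b assume "finite I" "b \<in> str P I" "\<And>i. i \<in> I \<Longrightarrow> \<sigma> i = i"
    then show "relabel P \<sigma> b = b"
      using X.act_id[of I "basis_vec b" \<sigma>] by (simp add: obj act basis_vec_inject)
  next
    fix I S b assume "finite I" "S \<subseteq> I" "b \<in> str P I"
    then show "restrict_str P S b \<in> str P S"
      using X.restr_closed[of I S "basis_vec b"] by (simp add: obj res)
  next
    fix I b assume "finite I" "b \<in> str P I"
    then show "restrict_str P I b = b"
      using X.restr_id[of I "basis_vec b"] by (simp add: obj res basis_vec_inject)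
  next
    fix I T S b assume *: "finite I" "T \<subseteq> S" "S \<subseteq> I" "b \<in> str P I"
    have "restrict_str P S b \<in> str P S" "finite S"
      using X.restr_closed[of I S "basis_vec b"] * by (auto simp: obj res intro: finite_subset)
    then show "restrict_str P T (restrict_str P S b) = restrict_str P T b"
      using X.restr_restr[of I S T "basis_vec b"] * by (simp add: obj res basis_vec_inject)
  next
    fix I S :: "nat set" and \<sigma> :: "nat \<Rightarrow> nat" and b assume *: "finite I" "S \<subseteq> I" "inj_on \<sigma> I" "b \<in> str P I"
    have "restrict_str P S b \<in> str P S" "finite S"
      using X.restr_closed[of I S "basis_vec b"] * by (auto simp: obj res intro: finite_subset)
    moreover have "relabel P \<sigma> b \<in> str P (\<sigma> ` I)"
      using X.act_closed[of I \<sigma> "basis_vec b"] * by (simp add: obj act)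
    ultimately show "restrict_str P (\<sigma> ` S) (relabel P \<sigma> b) = relabel P \<sigma> (restrict_str P S b)"
      using X.restr_act[of I S \<sigma> "basis_vec b"] * by (simp add: obj act res basis_vec_inject)
  qed (use assms(1) in auto)
qed

lemma restriction_species_Lin: "restriction_species Lin"
  by (rule restriction_species_of_linearize[OF _ cosymmetric_bicomodule_LL])
    (simp add: Lin_def)

lemma restriction_species_Comp: "restriction_species Comp"
  by (rule restriction_species_of_linearize[OF _ cosymmetric_bicomodule_CC])
    (simp add: Comp_def finite_compositions)

text \<open>
  For \<open>t = fscale\<close> and for \<open>t = (*)\<close> this covers linear maps between free modules and linear forms.
\<close>
lemma linear_on_free_module_expand:
  fixes f :: "('b \<Rightarrow> 'k::comm_ring_1) \<Rightarrow> 'w::ab_group_add"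
  assumes "finite B" "linear_on (free_module B) fscale t f" "z \<in> free_module B"
  shows "f z = (\<Sum>b\<in>B. t (z b) (f (basis_vec b)))"
proof -
  have add: "f (x + y) = f x + f y" if "x \<in> free_module B" "y \<in> free_module B" for x y
    using assms(2) that by (auto simp: linear_on_def)
  have sc: "f (fscale c x) = t c (f x)" if "x \<in> free_module B" for c x
    using assms(2) that by (auto simp: linear_on_def)
  have zero: "0 \<in> free_module B" by (simp add: free_module_def)
  have f0: "f 0 = 0" using add[OF zero zero] by simp
  have "f (\<Sum>b\<in>A. fscale (z b) (basis_vec b)) = (\<Sum>b\<in>A. t (z b) (f (basis_vec b)))
      \<and> (\<Sum>b\<in>A. fscale (z b) (basis_vec b)) \<in> free_module B" if "A \<subseteq> B" for A
    using finite_subset[OF that assms(1)] that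
  proof (induction A rule: finite_induct)
    case empty show ?case using f0 zero by (simp only: sum.empty simp_thms)
  next
    case (insert c A)
    let ?u = "fscale (z c) (basis_vec c)" and ?S = "\<Sum>b\<in>A. fscale (z b) (basis_vec b)"
    have c: "basis_vec c \<in> free_module B" using insert by (simp add: basis_vec_in_free_module)
    then have u: "?u \<in> free_module B"
      using insert.prems by (simp add: free_module_def fscale_def basis_vec_def)
    have S: "?S \<in> free_module B" using insert by blast
    have "?u + ?S \<in> free_module B" using u S by (simp add: free_module_def)
    moreover have "f (?u + ?S) = t (z c) (f (basis_vec c)) + (\<Sum>b\<in>A. t (z b) (f (basis_vec b)))"
      using insert by (simp only: add[OF u S] sc[OF c]) simp
    ultimately show ?case by (simp only: sum.insert[OF insert.hyps])
  qed
  moreover have "(\<Sum>b\<in>B. fscale (z b) (basis_vec b)) = z"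
  proof
    fix y
    show "(\<Sum>b\<in>B. fscale (z b) (basis_vec b)) y = z y"
      using assms(1,3) by (simp add: sum_fun_apply fscale_def basis_vec_def free_module_def
        if_distrib cong: if_cong)
  qed
  ultimately show ?thesis by (metis order_refl)
qed


section \<open>Cochains as invariant functions on simplices\<close>

abbreviation ground :: "'a set list \<Rightarrow> 'a set" where
  "ground F \<equiv> \<Union>(set F)"

text \<open>
  The operation of the \<open>k\<close>-th face on decompositions. If \<open>F\<close> is read as the chain of the unions of
  its initial segments, with \<open>length F + 1\<close> members including the empty set, it omits the \<open>k\<close>-th
  member, counted from \<open>0\<close>, and takes successive differences again. The recursion handles the outer and the inner faces uniformly.
\<close>
fun drop_vertex :: "nat \<Rightarrow> 'a set list \<Rightarrow> 'a set list" where
  "drop_vertex 0 F = tl F"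
| "drop_vertex (Suc 0) [A] = []"
| "drop_vertex (Suc 0) (A # B # F) = (A \<union> B) # F"
| "drop_vertex (Suc (Suc k)) (A # F) = A # drop_vertex (Suc k) F"
| "drop_vertex (Suc k) [] = []"

lemma length_drop_vertex [simp]: "k \<le> length F \<Longrightarrow> length (drop_vertex k F) = length F - 1"
  by (induction k F rule: drop_vertex.induct) auto

lemma Union_drop_vertex_subset: "ground (drop_vertex k F) \<subseteq> ground F"
  proof (induction k F rule: drop_vertex.induct)
  case (1 F) then show ?case by (cases F) auto
qed auto

lemma Union_drop_vertex_inner:
  "0 < k \<Longrightarrow> k < length F \<Longrightarrow> ground (drop_vertex k F) = ground F"
  by (induction k F rule: drop_vertex.induct) auto

lemma drop_vertex_length: "F \<noteq> [] \<Longrightarrow> drop_vertex (length F) F = butlast F"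
proof (induction F)
  case (Cons A F) then show ?case by (cases F) auto
qed simp

lemma drop_vertex_merge: "0 < k \<Longrightarrow> k < length F \<Longrightarrow> drop_vertex k F = merge_at k F"
proof (induction k F rule: drop_vertex.induct)
  case (4 k A F)
  then show ?case by (cases k) (auto simp: merge_at_def)
qed (auto simp: merge_at_def)

lemma drop_vertex_map: "drop_vertex k (map ((`) \<sigma>) F) = map ((`) \<sigma>) (drop_vertex k F)"
  by (induction k F rule: drop_vertex.induct) (auto simp: map_tl image_Un)

text \<open>
  The simplicial identity: omitting the members \<open>j + 1\<close> and \<open>i\<close> of a chain in either order gives the
  same chain, and the member \<open>j + 1\<close> has become the \<open>j\<close>-th one once the \<open>i\<close>-th is gone.
\<close>
lemma drop_vertex_drop_vertex:
  "i \<le> j \<Longrightarrow> j < length F \<Longrightarrow>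
    drop_vertex i (drop_vertex (Suc j) F) = drop_vertex j (drop_vertex i F)"
proof (induction F arbitrary: i j)
  case (Cons A F)
  show ?case
  proof (cases i)
    case 0
    then show ?thesis using Cons.prems by (cases j; cases F) auto
  next
    case i: (Suc i')
    then obtain j' where j: "j = Suc j'" using Cons.prems by (cases j) auto
    then obtain B G where F: "F = B # G" using Cons.prems by (cases F) auto
    show ?thesis
    proof (cases i')
      case 0
      then show ?thesis using i j F Cons.prems by (cases j'; cases G) auto
    next
      case (Suc i'')
      then obtain j'' where "j' = Suc j''" using Cons.prems i j by (cases j') auto
      then show ?thesis using i j F Suc Cons.prems Cons.IH[of i' j'] by simp
    qed
  qed
qed simp

lemma drop_vertex_append_left:
  "k < length F \<Longrightarrow> drop_vertex k (F @ G) = drop_vertex k F @ G"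
proof (induction k F rule: drop_vertex.induct)
  case (1 F) then show ?case by (cases F) auto
qed auto

lemma drop_vertex_append_right:
  "0 < k \<Longrightarrow> drop_vertex (length F + k) (F @ G) = F @ drop_vertex k G"
proof (induction F)
  case (Cons A F) then show ?case by (cases "length F + k") auto
qed simp

abbreviation blocks_disjoint :: "'a set list \<Rightarrow> bool" where
  "blocks_disjoint \<equiv> sorted_wrt (\<lambda>A B. A \<inter> B = {})"

lemma decompositions_iff:
  "F \<in> decompositions n I \<longleftrightarrow> length F = n \<and> ground F = I \<and> blocks_disjoint F"
  by (auto simp: decompositions_def sorted_wrt_iff_nth_less)

lemma blocks_disjoint_drop_vertex: "blocks_disjoint F \<Longrightarrow> blocks_disjoint (drop_vertex k F)"
proof (induction k F rule: drop_vertex.induct)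
  case (1 F) then show ?case by (cases F) auto
next
  case (4 k A F)
  have "A \<inter> B = {}" if "B \<in> set (drop_vertex (Suc k) F)" for B
  proof -
    have "B \<subseteq> ground F" using that Union_drop_vertex_subset[of "Suc k" F] by blast
    then show ?thesis using "4.prems" by auto
  qed
  with 4 show ?case by auto
qed auto

type_synonym 'b simplex = "nat set list \<times> 'b"

definition simplices :: "'b set_species \<Rightarrow> nat \<Rightarrow> 'b simplex set" where
  "simplices P n = {(F, b). F \<in> decompositions n (ground F) \<and> finite (ground F) \<and>
     b \<in> str P (ground F)}"

text \<open>
  For an inner face the ground set is unchanged and restricting to it is the identity; this lets one
  formula serve all faces.
\<close>
definition face :: "'b set_species \<Rightarrow> nat \<Rightarrow> 'b simplex \<Rightarrow> 'b simplex" where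
  "face P k = (\<lambda>(F, b). (drop_vertex k F, restrict_str P (ground (drop_vertex k F)) b))"

definition relabel_simplex :: "'b set_species \<Rightarrow> (nat \<Rightarrow> nat) \<Rightarrow> 'b simplex \<Rightarrow> 'b simplex" where
  "relabel_simplex P \<sigma> = (\<lambda>(F, b). (map ((`) \<sigma>) F, relabel P \<sigma> b))"

definition invariant_functions :: "'b set_species \<Rightarrow> nat \<Rightarrow> ('b simplex \<Rightarrow> 'k::comm_ring_1) set" where
  "invariant_functions P n = {a. (\<forall>x. x \<notin> simplices P n \<longrightarrow> a x = 0) \<and>
     (\<forall>x \<sigma>. x \<in> simplices P n \<longrightarrow> inj_on \<sigma> (ground (fst x)) \<longrightarrow>
        a (relabel_simplex P \<sigma> x) = a x)}"

definition simplicial_diff :: "'b set_species \<Rightarrow> nat \<Rightarrow> ('b simplex \<Rightarrow> 'k::comm_ring_1)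
    \<Rightarrow> 'b simplex \<Rightarrow> 'k" where
  "simplicial_diff P n a x =
     (if x \<in> simplices P (Suc n) then \<Sum>i\<le>Suc n. (- 1) ^ i * a (face P i x) else 0)"

text \<open>
  The values of a cochain at basis vectors. They determine the cochain, and every invariant function
  arises (\<open>of_coefficients_coefficients\<close>, \<open>coefficients_of_coefficients\<close>).
\<close>
definition coefficients :: "('k::comm_ring_1, 'b \<Rightarrow> 'k) cochain \<Rightarrow> 'b simplex \<Rightarrow> 'k" where
  "coefficients \<alpha> = (\<lambda>(F, b). cf \<alpha> F (basis_vec b))"

definition of_coefficients :: "'b set_species \<Rightarrow> ('b simplex \<Rightarrow> 'k::comm_ring_1)
    \<Rightarrow> ('k, 'b \<Rightarrow> 'k) cochain" where
  "of_coefficients P a I z F = (if finite I \<and> z \<in> free_module (str P I) \<and> ground F = I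
     then \<Sum>b\<in>str P I. z b * a (F, b) else 0)"

lemma simplices_iff:
  "(F, b) \<in> simplices P n \<longleftrightarrow> length F = n \<and> blocks_disjoint F \<and> finite (ground F) \<and>
     b \<in> str P (ground F)"
  by (auto simp: simplices_def decompositions_iff)

text \<open>
  The cancellation behind \<open>\<delta> \<circ> \<delta> = 0\<close>: the terms with \<open>i < j\<close> and those with \<open>i \<ge> j\<close> are matched
  by \<open>(i, j) \<mapsto> (j - 1, i)\<close>, which changes the sign.
\<close>
lemma sum_alternating_cancel:
  fixes t :: "nat \<Rightarrow> nat \<Rightarrow> 'a::comm_ring_1"
  assumes "\<And>i j. i \<le> j \<Longrightarrow> j \<le> n \<Longrightarrow> t i (Suc j) = t j i"
  shows "(\<Sum>j\<le>Suc n. \<Sum>i\<le>n. (- 1) ^ i * (- 1) ^ j * t i j) = 0"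
proof -
  let ?u = "\<lambda>(i, j). (- 1) ^ i * (- 1) ^ j * t i j"
  let ?A = "{(i, j). i < j \<and> j \<le> Suc n}" and ?B = "{(i, j). j \<le> i \<and> i \<le> n}"
  have fin: "finite ?A" "finite ?B"
    by (rule finite_subset[of _ "{..Suc n} \<times> {..Suc n}"]; auto)+
  have "(\<Sum>j\<le>Suc n. \<Sum>i\<le>n. (- 1) ^ i * (- 1) ^ j * t i j) = sum ?u ({..n} \<times> {..Suc n})"
    by (subst sum.swap) (simp add: sum.cartesian_product del: sum.atMost_Suc)
  also have "{..n} \<times> {..Suc n} = ?A \<union> ?B" by auto
  also have "sum ?u \<dots> = sum ?u ?A + sum ?u ?B"
    by (rule sum.union_disjoint) (use fin in auto)
  also have "sum ?u ?A = - sum ?u ?B"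
    unfolding sum_negf[symmetric]
  proof (rule sum.reindex_bij_witness[of _ "\<lambda>(i, j). (j, Suc i)" "\<lambda>(i, j). (j - 1, i)"])
    fix p assume "p \<in> ?A"
    then obtain i j where "p = (i, Suc j)" "i \<le> j" "j \<le> n"
      by (cases p; cases "snd p") auto
    then show "- ?u ((\<lambda>(i, j). (j - 1, i)) p) = ?u p"
      by (simp add: assms)
  qed auto
  finally show ?thesis by simp
qed

lemma invariant_functionsI:
  assumes "\<And>x. x \<notin> simplices P n \<Longrightarrow> a x = 0"
    and "\<And>x \<sigma>. \<lbrakk>x \<in> simplices P n; inj_on \<sigma> (ground (fst x))\<rbrakk> \<Longrightarrow> a (relabel_simplex P \<sigma> x) = a x"
  shows "a \<in> invariant_functions P n"
  using assms unfolding invariant_functions_def by blast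

lemma invariant_functions_zero: "a \<in> invariant_functions P n \<Longrightarrow> x \<notin> simplices P n \<Longrightarrow> a x = 0"
  unfolding invariant_functions_def by blast

lemma invariant_functions_relabel:
  "\<lbrakk>a \<in> invariant_functions P n; x \<in> simplices P n; inj_on \<sigma> (ground (fst x))\<rbrakk>
    \<Longrightarrow> a (relabel_simplex P \<sigma> x) = a x"
  unfolding invariant_functions_def by blast

context restriction_species
begin

lemma face_in_simplices:
  assumes "x \<in> simplices P (Suc n)" "k \<le> Suc n"
  shows "face P k x \<in> simplices P n"
proof -
  obtain F b where x: "x = (F, b)" by (cases x)
  have "ground (drop_vertex k F) \<subseteq> ground F" by (rule Union_drop_vertex_subset)
  then show ?thesis
    using assms unfolding x face_def
    by (auto simp: simplices_iff blocks_disjoint_drop_vertex intro: finite_subset restrict_closed)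
qed

lemma face_face:
  assumes "x \<in> simplices P n" "i \<le> j" "j < n"
  shows "face P i (face P (Suc j) x) = face P j (face P i x)"
proof -
  obtain F b where x: "x = (F, b)" by (cases x)
  have sub: "ground (drop_vertex k (drop_vertex l F)) \<subseteq> ground (drop_vertex l F)"
    "ground (drop_vertex l F) \<subseteq> ground F" for k l
    by (rule Union_drop_vertex_subset)+
  have F: "drop_vertex i (drop_vertex (Suc j) F) = drop_vertex j (drop_vertex i F)"
    using assms by (intro drop_vertex_drop_vertex) (simp_all add: x simplices_iff)
  have "restrict_str P (ground (drop_vertex k (drop_vertex l F)))
      (restrict_str P (ground (drop_vertex l F)) b)
    = restrict_str P (ground (drop_vertex k (drop_vertex l F))) b" for k l
    by (rule restrict_restrict[OF _ sub]) (use assms(1) in \<open>simp_all add: x simplices_iff\<close>)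
  from this[of i "Suc j"] this[of j i] show ?thesis
    by (simp add: x face_def F)
qed

lemma relabel_simplex_in_simplices:
  assumes "x \<in> simplices P n" "inj_on \<sigma> (ground (fst x))"
  shows "relabel_simplex P \<sigma> x \<in> simplices P n"
proof -
  obtain F b where x: "x = (F, b)" by (cases x)
  have "map ((`) \<sigma>) F \<in> decompositions n (\<sigma> ` ground F)"
    using assms unfolding x by (intro decompositions_image) (auto simp: simplices_def)
  moreover have "ground (map ((`) \<sigma>) F) = \<sigma> ` ground F" by auto
  ultimately show ?thesis
    using assms unfolding x by (simp add: simplices_def relabel_simplex_def relabel_closed)
qed

lemma face_relabel_simplex:
  assumes "x \<in> simplices P n" "inj_on \<sigma> (ground (fst x))"
  shows "face P k (relabel_simplex P \<sigma> x) = relabel_simplex P \<sigma> (face P k x)"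
proof -
  obtain F b where x: "x = (F, b)" by (cases x)
  have "ground (drop_vertex k (map ((`) \<sigma>) F)) = \<sigma> ` ground (drop_vertex k F)"
    by (auto simp: drop_vertex_map)
  moreover have "ground (drop_vertex k F) \<subseteq> ground F" by (rule Union_drop_vertex_subset)
  ultimately show ?thesis
    using assms unfolding x relabel_simplex_def face_def
    by (simp add: simplices_iff restrict_relabel[of "ground F"] drop_vertex_map)
qed

lemma inj_on_face:
  assumes "inj_on \<sigma> (ground (fst x))"
  shows "inj_on \<sigma> (ground (fst (face P k x)))"
  using inj_on_subset[OF assms Union_drop_vertex_subset[of k "fst x"]]
  by (cases x) (simp add: face_def)

lemma simplicial_diff_closed:
  fixes a :: "'b simplex \<Rightarrow> 'k::comm_ring_1"
  assumes a: "a \<in> invariant_functions P n"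
  shows "simplicial_diff P n a \<in> invariant_functions P (Suc n)"
proof -
  have "a (face P i (relabel_simplex P \<sigma> x)) = a (face P i x)"
    if "x \<in> simplices P (Suc n)" "inj_on \<sigma> (ground (fst x))" "i \<le> Suc n" for i \<sigma> x
  proof -
    have "face P i x \<in> simplices P n" using that by (intro face_in_simplices)
    moreover have "inj_on \<sigma> (ground (fst (face P i x)))" using that(2) by (rule inj_on_face)
    ultimately show ?thesis
      using invariant_functions_relabel[OF a] face_relabel_simplex[OF that(1,2)] by simp
  qed
  then show ?thesis
    by (auto simp: invariant_functions_def simplicial_diff_def relabel_simplex_in_simplices
      simp del: sum.atMost_Suc intro!: sum.cong)
qed

lemma simplicial_diff_diff:
  "simplicial_diff P (Suc n) (simplicial_diff P n a) = (\<lambda>x. 0)"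
proof
  fix x
  show "simplicial_diff P (Suc n) (simplicial_diff P n a) x = 0"
  proof (cases "x \<in> simplices P (Suc (Suc n))")
    case True
    have "simplicial_diff P (Suc n) (simplicial_diff P n a) x
        = (\<Sum>j\<le>Suc (Suc n). \<Sum>i\<le>Suc n. (- 1) ^ i * (- 1) ^ j * a (face P i (face P j x)))"
      using True
      by (auto simp: simplicial_diff_def face_in_simplices sum_distrib_left mult_ac
        simp del: sum.atMost_Suc intro!: sum.cong)
    also have "\<dots> = 0"
      using True by (intro sum_alternating_cancel) (simp add: face_face)
    finally show ?thesis .
  qed (simp add: simplicial_diff_def)
qed


section \<open>Coefficients of cochains\<close>

lemma obj_linearize: "obj (linearize P) I = free_module (str P I)"
  and scal_linearize: "scal (linearize P) = fscale"
  by (simp_all add: linearize_def)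

lemma cochains_linear:
  "\<alpha> \<in> cochains n (linearize P) \<Longrightarrow> finite I \<Longrightarrow>
    linear_on (free_module (str P I)) fscale fscale (\<alpha> I)"
  by (auto simp: cochains_def species_hom_def E_power_def obj_linearize scal_linearize)

lemma cochains_zero:
  assumes "\<alpha> \<in> cochains n (linearize P)"
    "\<not> (finite I \<and> z \<in> free_module (str P I) \<and> F \<in> decompositions n I)"
  shows "\<alpha> I z F = 0"
proof (cases "finite I \<and> z \<in> free_module (str P I)")
  case True
  then have "\<alpha> I z \<in> free_module (decompositions n I)"
    using assms(1)
    by (simp add: cochains_def species_hom_def E_power_def obj_linearize image_subset_iff)
  then show ?thesis using True assms(2) by (simp add: free_module_def)
next
  case False
  then have "\<alpha> I z = 0"
    using assms(1) by (simp add: cochains_def species_hom_def obj_linearize)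
  then show ?thesis by simp
qed

lemma cochains_expand:
  fixes \<alpha> :: "('k::comm_ring_1, 'b \<Rightarrow> 'k) cochain"
  assumes \<alpha>: "\<alpha> \<in> cochains n (linearize P)" and "finite I" "z \<in> free_module (str P I)"
  shows "\<alpha> I z F = (\<Sum>b\<in>str P I. z b * \<alpha> I (basis_vec b) F)"
proof -
  have "linear_on (free_module (str P I)) fscale (*) (\<lambda>z. \<alpha> I z F)"
    using cochains_linear[OF \<alpha> \<open>finite I\<close>] by (auto simp: linear_on_def fscale_def)
  then show ?thesis
    using assms by (intro linear_on_free_module_expand) (auto intro: finite_str)
qed

text \<open>
  A bijection permutes the basis of the \<open>n\<close>-th Cauchy power, so it only relabels coefficients.
\<close>
lemma lin_ext_image_apply:
  assumes "finite I" "inj_on \<sigma> I" "F \<in> decompositions n I"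
  shows "lin_ext (decompositions n I) (map ((`) \<sigma>)) v (map ((`) \<sigma>) F) = v F"
proof -
  have "G = F" if "G \<in> decompositions n I" "map ((`) \<sigma>) G = map ((`) \<sigma>) F" for G
  proof (rule map_inj_on[OF that(2)])
    have "set G \<union> set F \<subseteq> Pow I" using that(1) assms(3) by (auto simp: decompositions_iff)
    then show "inj_on ((`) \<sigma>) (set G \<union> set F)"
      using inj_on_image_Pow[OF assms(2)] by (rule inj_on_subset[rotated])
  qed
  then have "{G \<in> decompositions n I. map ((`) \<sigma>) G = map ((`) \<sigma>) F} = {F}"
    using assms(3) by auto
  then show ?thesis by (simp add: lin_ext_def)
qed

lemma of_coefficients_coefficients:
  assumes \<alpha>: "\<alpha> \<in> cochains n (linearize P)"
  shows "of_coefficients P (coefficients \<alpha>) = \<alpha>"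
proof (intro ext)
  fix I z and F :: "nat set list"
  show "of_coefficients P (coefficients \<alpha>) I z F = \<alpha> I z F"
  proof (cases "finite I \<and> z \<in> free_module (str P I) \<and> ground F = I")
    case True
    then show ?thesis
      using cochains_expand[OF \<alpha>, of I z F] by (simp add: of_coefficients_def coefficients_def cf_def)
  next
    case False
    then show ?thesis
      using cochains_zero[OF \<alpha>, of I z F] by (auto simp: of_coefficients_def decompositions_iff)
  qed
qed

lemma coefficients_of_coefficients:
  fixes a :: "'b simplex \<Rightarrow> 'k::comm_ring_1"
  assumes a: "a \<in> invariant_functions P n"
  shows "coefficients (of_coefficients P a) = a"
proof
  fix x :: "'b simplex"
  obtain F b where x: "x = (F, b)" by (cases x)
  let ?I = "ground F"
  show "coefficients (of_coefficients P a) x = a x"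
  proof (cases "finite ?I \<and> b \<in> str P ?I")
    case True
    have "(\<Sum>c\<in>str P ?I. basis_vec b c * a (F, c)) = a (F, b)"
      using True finite_str[of ?I] by (simp add: basis_vec_def if_distrib[of "\<lambda>t. t * _"] cong: if_cong)
    then show ?thesis
      using True by (simp add: x coefficients_def cf_def of_coefficients_def basis_vec_in_free_module)
  next
    case False
    then have "x \<notin> simplices P n" by (simp add: x simplices_iff)
    then show ?thesis
      using False invariant_functions_zero[OF a, of x]
      by (auto simp: x coefficients_def cf_def of_coefficients_def basis_vec_in_free_module)
  qed
qed

lemma coefficients_closed:
  fixes \<alpha> :: "('k::comm_ring_1, 'b \<Rightarrow> 'k) cochain"
  assumes \<alpha>: "\<alpha> \<in> cochains n (linearize P)"
  shows "coefficients \<alpha> \<in> invariant_functions P n"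
proof -
  have "coefficients \<alpha> x = 0" if "x \<notin> simplices P n" for x
    using that cochains_zero[OF \<alpha>]
    by (cases x) (auto simp: simplices_def coefficients_def cf_def basis_vec_in_free_module)
  moreover have "coefficients \<alpha> (relabel_simplex P \<sigma> x) = coefficients \<alpha> x"
    if x: "x \<in> simplices P n" and \<sigma>: "inj_on \<sigma> (ground (fst x))" for x \<sigma>
  proof -
    obtain F b where xF: "x = (F, b)" by (cases x)
    let ?I = "ground F" and ?X = "linearize P :: ('k, 'b \<Rightarrow> 'k) bicomodule"
    have F: "F \<in> decompositions n ?I" "finite ?I" "b \<in> str P ?I" "inj_on \<sigma> ?I"
      using x \<sigma> by (simp_all add: xF simplices_def)
    have "\<alpha> (\<sigma> ` ?I) (act ?X ?I \<sigma> (basis_vec b))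
        = lin_ext (decompositions n ?I) (map ((`) \<sigma>)) (\<alpha> ?I (basis_vec b))"
      using \<alpha> F
      by (simp add: cochains_def species_hom_def E_power_def obj_linearize basis_vec_in_free_module)
    moreover have "act ?X ?I \<sigma> (basis_vec b) = basis_vec (relabel P \<sigma> b)"
      using F finite_str[of ?I] by (simp add: linearize_def lin_ext_basis_vec)
    moreover have "ground (map ((`) \<sigma>) F) = \<sigma> ` ?I" by auto
    ultimately show ?thesis
      using F by (simp add: xF relabel_simplex_def coefficients_def cf_def lin_ext_image_apply
          image_UN[symmetric] del: set_map)
  qed
  ultimately show ?thesis by (simp add: invariant_functions_def)
qed

lemma inj_on_relabel:
  assumes "finite I" "inj_on \<sigma> I"
  shows "inj_on (relabel P \<sigma>) (str P I)"
proof (rule inj_on_inverseI)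
  fix b assume b: "b \<in> str P I"
  have "relabel P (inv_into I \<sigma>) (relabel P \<sigma> b) = relabel P (inv_into I \<sigma> \<circ> \<sigma>) b"
    using assms b by (intro relabel_comp) (auto simp: inj_on_inv_into)
  also have "\<dots> = b"
    using assms b by (intro relabel_id) auto
  finally show "relabel P (inv_into I \<sigma>) (relabel P \<sigma> b) = b" .
qed

lemma bij_betw_relabel:
  assumes "finite I" "inj_on \<sigma> I"
  shows "bij_betw (relabel P \<sigma>) (str P I) (str P (\<sigma> ` I))"
proof (rule bij_betw_imageI[OF inj_on_relabel[OF assms]])
  have "b \<in> relabel P \<sigma> ` str P I" if b: "b \<in> str P (\<sigma> ` I)" for b
  proof -
    have inv: "inj_on (inv_into I \<sigma>) (\<sigma> ` I)" by (simp add: inj_on_inv_into)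
    have "relabel P \<sigma> (relabel P (inv_into I \<sigma>) b) = relabel P (\<sigma> \<circ> inv_into I \<sigma>) b"
      using assms b inv by (intro relabel_comp[of "\<sigma> ` I"]) auto
    also have "\<dots> = b"
      using assms b by (intro relabel_id[of "\<sigma> ` I"]) (auto simp: f_inv_into_f)
    finally show ?thesis
      using relabel_closed[OF _ inv b] assms by (metis finite_imageI image_eqI image_inv_into_cancel
          inv_into_image_cancel order_refl)
  qed
  then show "relabel P \<sigma> ` str P I = str P (\<sigma> ` I)"
    using relabel_closed[OF assms] by auto
qed

lemma act_closed:
  assumes "finite I" "inj_on \<sigma> I"
  shows "act (linearize P) I \<sigma> v \<in> free_module (str P (\<sigma> ` I))"
proof -
  have "relabel P \<sigma> ` str P I \<subseteq> str P (\<sigma> ` I)"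
    using bij_betw_relabel[OF assms] by (simp add: bij_betw_def)
  then have "lin_ext (str P I) (relabel P \<sigma>) v \<in> free_module (str P (\<sigma> ` I))"
    by (rule lin_ext_closed)
  then show ?thesis by (simp only: linearize_def bicomodule.simps species.simps)
qed

lemma sum_act:
  fixes v :: "'b \<Rightarrow> 'k::comm_ring_1"
  assumes "finite I" "inj_on \<sigma> I"
  shows "(\<Sum>c\<in>str P (\<sigma> ` I). act (linearize P) I \<sigma> v c * h c)
    = (\<Sum>b\<in>str P I. v b * h (relabel P \<sigma> b))"
proof -
  have "act (linearize P) I \<sigma> v (relabel P \<sigma> b) = v b" if "b \<in> str P I" for b
  proof -
    have "{c \<in> str P I. relabel P \<sigma> c = relabel P \<sigma> b} = {b}"
      using inj_onD[OF inj_on_relabel[OF assms]] that by blast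
    then show ?thesis by (simp add: linearize_def lin_ext_def)
  qed
  then show ?thesis
    using sum.reindex_bij_betw[OF bij_betw_relabel[OF assms],
        of "\<lambda>c. act (linearize P) I \<sigma> v c * h c"]
    by simp
qed

text \<open>
  Naturality is checked at a decomposition \<open>F'\<close> of \<open>\<sigma> ` I\<close>. If \<open>F'\<close> is the image of a decomposition
  of \<open>I\<close>, it follows from invariance by reindexing the sum over structures; otherwise \<open>F'\<close> is not a
  decomposition and both sides vanish.
\<close>
lemma of_coefficients_closed:
  fixes a :: "'b simplex \<Rightarrow> 'k::comm_ring_1"
  assumes a: "a \<in> invariant_functions P n"
  shows "of_coefficients P a \<in> cochains n (linearize P)"
proof -
  let ?\<alpha> = "of_coefficients P a"
  have supp: "?\<alpha> I z F = 0" if "F \<notin> decompositions n I" for I z F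
    using that invariant_functions_zero[OF a] 
    by (auto simp: of_coefficients_def simplices_def intro!: sum.neutral)
  have "linear_on (free_module (str P I)) fscale fscale (?\<alpha> I)" for I
    by (auto simp: linear_on_def of_coefficients_def fscale_def free_module_def fun_eq_iff
        sum.distrib sum_distrib_left algebra_simps)
  moreover have "?\<alpha> (\<sigma> ` I) (act (linearize P) I \<sigma> z)
      = lin_ext (decompositions n I) (map ((`) \<sigma>)) (?\<alpha> I z)"
    if I: "finite I" "inj_on \<sigma> I" "z \<in> free_module (str P I)" for I \<sigma> z
  proof
    fix F'
    show "?\<alpha> (\<sigma> ` I) (act (linearize P) I \<sigma> z) F'
      = lin_ext (decompositions n I) (map ((`) \<sigma>)) (?\<alpha> I z) F'"
    proof (cases "F' \<in> map ((`) \<sigma>) ` decompositions n I")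
      case True
      then obtain F where F: "F \<in> decompositions n I" "F' = map ((`) \<sigma>) F" by auto
      have "a (map ((`) \<sigma>) F, relabel P \<sigma> b) = a (F, b)" if "b \<in> str P I" for b
        using invariant_functions_relabel[OF a, of "(F, b)" \<sigma>] that F I
        by (auto simp: relabel_simplex_def simplices_def decompositions_iff)
      then have "(\<Sum>c\<in>str P (\<sigma> ` I). act (linearize P) I \<sigma> z c * a (F', c))
          = (\<Sum>b\<in>str P I. z b * a (F, b))"
        by (simp add: sum_act[OF I(1,2)] F(2))
      moreover have "act (linearize P) I \<sigma> z \<in> free_module (str P (\<sigma> ` I))"
        by (rule act_closed[OF I(1,2)])
      moreover have "ground F' = \<sigma> ` I" "ground F = I"
        using F by (auto simp: decompositions_iff)
      ultimately show ?thesis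
        using I F(1) by (simp add: lin_ext_image_apply F(2)) (simp add: of_coefficients_def)
    next
      case False
      have "F' \<notin> decompositions n (\<sigma> ` I)"
      proof
        assume F': "F' \<in> decompositions n (\<sigma> ` I)"
        have inv: "inj_on (inv_into I \<sigma>) (\<sigma> ` I)" by (simp add: inj_on_inv_into)
        have "map ((`) (inv_into I \<sigma>)) F' \<in> decompositions n (inv_into I \<sigma> ` \<sigma> ` I)"
          by (rule decompositions_image[OF F' inv])
        moreover have "inv_into I \<sigma> ` \<sigma> ` I = I" using I(2) by simp
        moreover have "map ((`) \<sigma>) (map ((`) (inv_into I \<sigma>)) F') = map ((`) (\<sigma> \<circ> inv_into I \<sigma>)) F'"
          by (simp add: image_comp)
        moreover have "map ((`) (\<sigma> \<circ> inv_into I \<sigma>)) F' = F'"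
          by (rule map_image_id[OF F']) (simp add: f_inv_into_f)
        ultimately show False using False by (metis image_eqI)
      qed
      moreover have empty: "{F \<in> decompositions n I. map ((`) \<sigma>) F = F'} = {}" using False by auto
      ultimately show ?thesis using supp unfolding lin_ext_def empty by simp
    qed
  qed
  moreover have "?\<alpha> I z \<in> free_module (decompositions n I)" for I z
    using supp by (simp add: free_module_def)
  moreover have "?\<alpha> I z = 0" if "\<not> (finite I \<and> z \<in> free_module (str P I))" for I z
    using that by (auto simp: of_coefficients_def fun_eq_iff)
  ultimately show ?thesis
    by (auto simp: cochains_def species_hom_def E_power_def obj_linearize scal_linearize)
qed

text \<open>
  Each coface is linear in \<open>z\<close>, so it is determined by its values at basis vectors, where it is the
  evaluation at a face. For the outer cofaces this uses that the complement of the first or last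
  block is the union of the remaining ones.
\<close>
lemma coboundary_coefficients:
  fixes \<alpha> :: "('k::comm_ring_1, 'b \<Rightarrow> 'k) cochain"
  assumes \<alpha>: "\<alpha> \<in> cochains n (linearize P)"
  shows "coboundary n (linearize P) \<alpha> = of_coefficients P (simplicial_diff P n (coefficients \<alpha>))"
proof (intro ext)
  fix I z and F :: "nat set list"
  let ?X = "linearize P :: ('k, 'b \<Rightarrow> 'k) bicomodule"
  show "coboundary n ?X \<alpha> I z F
    = of_coefficients P (simplicial_diff P n (coefficients \<alpha>)) I z F"
  proof (cases "finite I \<and> z \<in> free_module (str P I) \<and> F \<in> decompositions (n + 1) I")
    case True
    then have I: "finite I" "z \<in> free_module (str P I)" and lenF: "length F = Suc n"
      and UF: "ground F = I" and dis: "blocks_disjoint F"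
      by (simp_all add: decompositions_iff)
    have restr_linear: "linear_on (free_module (str P I)) fscale fscale (restr ?X I S)" for S
      by (simp add: linearize_def lin_ext_linear)
    have restr_closed: "restr ?X I S v \<in> free_module (str P S)" if "S \<subseteq> I" for S v
      using that I restrict_closed by (auto simp: linearize_def intro!: lin_ext_closed)
    have cf_restr: "cf \<alpha> G (restr ?X I (ground G) v)
      = (\<Sum>b\<in>str P I. v b * coefficients \<alpha> (G, restrict_str P (ground G) b))"
      if G: "ground G \<subseteq> I" and v: "v \<in> free_module (str P I)" for G v
    proof -
      let ?S = "ground G"
      have S: "finite ?S" using G I finite_subset by blast
      have "linear_on (free_module (str P I)) fscale (*) (\<lambda>v. \<alpha> ?S (restr ?X I ?S v) G)"
        using cochains_linear[OF \<alpha> S] restr_linear[of ?S] restr_closed[OF G]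
        by (auto simp: linear_on_def fscale_def)
      then have "\<alpha> ?S (restr ?X I ?S v) G
        = (\<Sum>b\<in>str P I. v b * \<alpha> ?S (restr ?X I ?S (basis_vec b)) G)"
        using v I by (intro linear_on_free_module_expand) (auto intro: finite_str)
      also have "\<dots> = (\<Sum>b\<in>str P I. v b * coefficients \<alpha> (G, restrict_str P ?S b))"
        using I finite_str[of I]
        by (intro sum.cong) (simp_all add: linearize_def lin_ext_basis_vec coefficients_def cf_def)
      finally show ?thesis by (simp add: cf_def)
    qed
    have res_I: "restr ?X I I v = v" if "v \<in> free_module (str P I)" for v
      using that I by (auto simp: linearize_def intro!: lin_ext_id restrict_id)
    have coface: "coface n ?X i \<alpha> I z F = (\<Sum>b\<in>str P I. z b * coefficients \<alpha> (face P i (F, b)))"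
      if i: "i \<le> Suc n" for i
    proof -
      let ?G = "drop_vertex i F"
      have G: "ground ?G \<subseteq> I" using Union_drop_vertex_subset[of i F] UF by simp
      have "coface n ?X i \<alpha> I z F = cf \<alpha> ?G (restr ?X I (ground ?G) z)"
      proof -
        consider "i = 0" | "0 < i" "i < Suc n" | "0 < i" "i = Suc n" using i by linarith
        then show ?thesis
        proof cases
          case 1
          obtain A F' where F: "F = A # F'" using lenF by (cases F) auto
          then have "I - A = ground F'" using UF dis by auto
          then show ?thesis using True 1 F by (simp add: coface_def obj_linearize)
        next
          case 2
          then have "ground ?G = I" using Union_drop_vertex_inner[of i F] UF lenF by simp
          then show ?thesis
            using True 2 lenF res_I[of z] drop_vertex_merge[of i F]
            by (simp add: coface_def obj_linearize)
        next
          case 3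
          obtain A F' where F: "F = F' @ [A]" using lenF by (cases F rule: rev_cases) auto
          then have "I - A = ground F'" using UF dis by (auto simp: sorted_wrt_append)
          moreover have "?G = F'" using drop_vertex_length[of F] 3 lenF F by simp
          ultimately show ?thesis using True 3 F by (simp add: coface_def obj_linearize)
        qed
      qed
      also have "\<dots> = (\<Sum>b\<in>str P I. z b * coefficients \<alpha> (face P i (F, b)))"
        using cf_restr[OF G I(2)] by (simp add: face_def)
      finally show ?thesis .
    qed
    have "coboundary n ?X \<alpha> I z F
      = (\<Sum>i\<le>Suc n. \<Sum>b\<in>str P I. z b * ((- 1) ^ i * coefficients \<alpha> (face P i (F, b))))"
      unfolding coboundary_def
      by (simp add: coface sum_distrib_left mult_ac del: sum.atMost_Suc)
    also have "\<dots> = (\<Sum>b\<in>str P I. z b * simplicial_diff P n (coefficients \<alpha>) (F, b))"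
      using True UF
      by (subst sum.swap)
        (simp add: simplicial_diff_def simplices_def sum_distrib_left del: sum.atMost_Suc)
    finally show ?thesis using I UF by (simp add: of_coefficients_def)
  next
    case False
    then have "coface n ?X i \<alpha> I z F = 0" for i
      unfolding coface_def obj_linearize by (rule if_not_P)
    moreover have "of_coefficients P (simplicial_diff P n (coefficients \<alpha>)) I z F = 0"
      using False
      by (auto simp: of_coefficients_def simplicial_diff_def simplices_def intro!: sum.neutral)
    ultimately show ?thesis by (simp add: coboundary_def del: sum.atMost_Suc)
  qed
qed

lemma coboundary_closed:
  "\<alpha> \<in> cochains n (linearize P) \<Longrightarrow> coboundary n (linearize P) \<alpha> \<in> cochains (Suc n) (linearize P)"
  by (simp add: coboundary_coefficients of_coefficients_closed simplicial_diff_closed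
      coefficients_closed)

lemma coefficients_coboundary:
  "\<alpha> \<in> cochains n (linearize P) \<Longrightarrow>
    coefficients (coboundary n (linearize P) \<alpha>) = simplicial_diff P n (coefficients \<alpha>)"
  by (simp add: coboundary_coefficients coefficients_of_coefficients[OF simplicial_diff_closed]
      coefficients_closed)

lemma of_coefficients_zero: "of_coefficients P (\<lambda>x. 0) = 0"
  by (simp add: of_coefficients_def fun_eq_iff)

lemma coboundary_coboundary:
  assumes "\<alpha> \<in> cochains n (linearize P)"
  shows "coboundary (Suc n) (linearize P) (coboundary n (linearize P) \<alpha>) = 0"
  using assms coboundary_coefficients[OF coboundary_closed[OF assms]]
  by (simp add: coefficients_coboundary simplicial_diff_diff of_coefficients_zero)

end

section \<open>Restricting invariant functions along linear orders\<close>

abbreviation singletons :: "nat list \<Rightarrow> nat set list" where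
  "singletons \<equiv> map (\<lambda>i. {i})"

interpretation Lin: restriction_species Lin by (rule restriction_species_Lin)
interpretation Comp: restriction_species Comp by (rule restriction_species_Comp)

lemma singletons_relabel: "singletons (relabel Lin \<sigma> xs) = relabel Comp \<sigma> (singletons xs)"
  by (simp add: Lin_def Comp_def)

lemma singletons_restrict: "singletons (restrict_str Lin S xs) = restrict_str Comp S (singletons xs)"
  by (induction xs) (auto simp: Lin_def Comp_def)

text \<open>
  The simplices with singleton blocks are exactly those coming from linear orders. With the two
  previous lemmas this identifies linear orders with a part of compositions that is stable under
  relabelling and faces.
\<close>
lemma singletons_in_str_iff: "singletons xs \<in> str Comp I \<longleftrightarrow> xs \<in> str Lin I"
proof
  assume "singletons xs \<in> str Comp I"
  then have "distinct (singletons xs)" "set xs = I"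
    by (auto simp: Comp_def compositions_iff)
  then show "xs \<in> str Lin I"
    by (simp add: Lin_def permutations_of_set_def distinct_map)
qed (simp add: Lin_def Comp_def singletons_in_compositions)

lemma singletons_in_simplices_iff:
  "(F, singletons xs) \<in> simplices Comp n \<longleftrightarrow> (F, xs) \<in> simplices Lin n"
  by (simp add: simplices_def singletons_in_str_iff)

definition pull_singletons :: "nat \<Rightarrow> (nat set list simplex \<Rightarrow> 'k::comm_ring_1) \<Rightarrow> nat list simplex \<Rightarrow> 'k" where
  "pull_singletons n a = (\<lambda>(F, xs). if (F, xs) \<in> simplices Lin n then a (F, singletons xs) else 0)"

lemma pull_singletons_apply:
  "a \<in> invariant_functions Comp n \<Longrightarrow> pull_singletons n a (F, xs) = a (F, singletons xs)"
  using invariant_functions_zero[of a Comp n "(F, singletons xs)"]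
  by (auto simp: pull_singletons_def singletons_in_simplices_iff)

lemma pull_singletons_closed:
  assumes a: "a \<in> invariant_functions Comp n"
  shows "pull_singletons n a \<in> invariant_functions Lin n"
proof -
  have inv: "pull_singletons n a (relabel_simplex Lin \<sigma> x) = pull_singletons n a x"
    if x: "x \<in> simplices Lin n" and \<sigma>: "inj_on \<sigma> (ground (fst x))" for x \<sigma>
  proof -
    obtain F xs where F: "x = (F, xs)" by (cases x)
    then have "(F, singletons xs) \<in> simplices Comp n" using x by (simp add: singletons_in_simplices_iff)
    then have "a (relabel_simplex Comp \<sigma> (F, singletons xs)) = a (F, singletons xs)"
      using \<sigma> F by (intro invariant_functions_relabel[OF a]) simp_all
    moreover have "relabel_simplex Lin \<sigma> x = (map ((`) \<sigma>) F, relabel Lin \<sigma> xs)"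
      by (simp add: F relabel_simplex_def)
    ultimately show ?thesis
      by (simp only: F pull_singletons_apply[OF a] singletons_relabel) (simp add: relabel_simplex_def)
  qed
  show ?thesis
  proof (rule invariant_functionsI)
    fix x :: "_ simplex" assume "x \<notin> simplices Lin n"
    then show "pull_singletons n a x = 0" by (auto simp: pull_singletons_def split: prod.splits)
  qed (rule inv)
qed

lemma pull_singletons_diff:
  assumes a: "a \<in> invariant_functions Comp n"
  shows "pull_singletons (Suc n) (simplicial_diff Comp n a) = simplicial_diff Lin n (pull_singletons n a)"
proof
  fix x :: "nat list simplex"
  obtain F xs where F: "x = (F, xs)" by (cases x)
  have "a (face Comp i (F, singletons xs)) = pull_singletons n a (face Lin i (F, xs))" for i
    by (simp only: face_def prod.case pull_singletons_apply[OF a] singletons_restrict)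
  then show "pull_singletons (Suc n) (simplicial_diff Comp n a) x = simplicial_diff Lin n (pull_singletons n a) x"
    unfolding F pull_singletons_apply[OF Comp.simplicial_diff_closed[OF a]]
    by (simp add: simplicial_diff_def singletons_in_simplices_iff del: sum.atMost_Suc)
qed

text \<open>
  A section of \<open>pull_singletons\<close>. It does not commute with the coboundary: a face of a simplex outside
  the image of linear orders can lie inside.
\<close>
definition extend_by_zero :: "nat \<Rightarrow> (nat list simplex \<Rightarrow> 'k::comm_ring_1) \<Rightarrow> nat set list simplex \<Rightarrow> 'k" where
  "extend_by_zero n c = (\<lambda>(F, G). if (F, G) \<in> simplices Comp n \<and> G \<in> range singletons
     then c (F, map the_elem G) else 0)"

lemma the_elem_comp_singleton [simp]: "the_elem \<circ> (\<lambda>i. {i}) = id"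
  by auto

lemma in_range_singletonsI:
  assumes "\<And>B. B \<in> set G \<Longrightarrow> \<exists>i. B = {i}"
  shows "G \<in> range singletons"
proof
  have "{the_elem B} = B" if "B \<in> set G" for B
    using assms[OF that] by auto
  then show "G = singletons (map the_elem G)" by (simp add: map_idI o_def)
qed simp

text \<open>
  Relabelling preserves the size of blocks; this makes extension by zero invariant.
\<close>
lemma relabel_in_range_singletons_iff:
  assumes "(F, G) \<in> simplices Comp n" "inj_on \<sigma> (ground F)"
  shows "relabel Comp \<sigma> G \<in> range singletons \<longleftrightarrow> G \<in> range singletons"
proof
  assume "relabel Comp \<sigma> G \<in> range singletons"
  then obtain ys where ys: "map ((`) \<sigma>) G = singletons ys" by (auto simp: Comp_def)
  have "\<exists>i. B = {i}" if "B \<in> set G" for B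
  proof -
    have "B \<subseteq> ground F" using assms(1) that by (auto simp: simplices_iff Comp_def compositions_iff)
    then have "inj_on \<sigma> B" by (rule inj_on_subset[OF assms(2)])
    moreover have "\<sigma> ` B \<in> set (singletons ys)" unfolding ys[symmetric] using that by simp
    ultimately have "card B = 1" by (auto dest: card_image)
    then show ?thesis by (simp add: card_1_singleton_iff)
  qed
  then show "G \<in> range singletons" by (rule in_range_singletonsI)
next
  assume "G \<in> range singletons"
  then show "relabel Comp \<sigma> G \<in> range singletons"
    by (metis (no_types, lifting) imageE rangeI singletons_relabel)
qed

lemma extend_by_zero_closed:
  assumes c: "c \<in> invariant_functions Lin n"
  shows "extend_by_zero n c \<in> invariant_functions Comp n"
proof -
  have inv: "extend_by_zero n c (relabel_simplex Comp \<sigma> x) = extend_by_zero n c x"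
    if x: "x \<in> simplices Comp n" and \<sigma>: "inj_on \<sigma> (ground (fst x))" for x \<sigma>
  proof -
    obtain F G where F: "x = (F, G)" by (cases x)
    have mem: "relabel_simplex Comp \<sigma> x \<in> simplices Comp n"
      by (rule Comp.relabel_simplex_in_simplices[OF x \<sigma>])
    have iff: "relabel Comp \<sigma> G \<in> range singletons \<longleftrightarrow> G \<in> range singletons"
      using x \<sigma> by (intro relabel_in_range_singletons_iff) (simp_all add: F)
    show ?thesis
    proof (cases "G \<in> range singletons")
      case True
      then obtain xs where xs: "G = singletons xs" by auto
      have "(F, xs) \<in> simplices Lin n" using x by (simp add: F xs singletons_in_simplices_iff)
      then have "c (relabel_simplex Lin \<sigma> (F, xs)) = c (F, xs)"
        using \<sigma> F by (intro invariant_functions_relabel[OF c]) simp_all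
      moreover have "map the_elem (relabel Comp \<sigma> G) = relabel Lin \<sigma> xs"
        unfolding xs singletons_relabel[symmetric] by simp
      ultimately show ?thesis
        using x mem iff True
        by (simp add: F extend_by_zero_def relabel_simplex_def xs)
    next
      case False
      then show ?thesis using iff by (simp add: F extend_by_zero_def relabel_simplex_def)
    qed
  qed
  show ?thesis
  proof (rule invariant_functionsI)
    fix x :: "_ simplex" assume "x \<notin> simplices Comp n"
    then show "extend_by_zero n c x = 0" by (auto simp: extend_by_zero_def split: prod.splits)
  qed (rule inv)
qed

lemma pull_singletons_extend_by_zero:
  assumes c: "c \<in> invariant_functions Lin n"
  shows "pull_singletons n (extend_by_zero n c) = c"
proof
  fix x :: "nat list simplex"
  obtain F xs where F: "x = (F, xs)" by (cases x)
  show "pull_singletons n (extend_by_zero n c) x = c x"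
    using invariant_functions_zero[OF c, of x]
    by (auto simp: F pull_singletons_def extend_by_zero_def singletons_in_simplices_iff o_def)
qed

section \<open>Acyclicity of the relative complex\<close>

text \<open>
  The coefficients of the cochains that restrict to zero on linear orders.
\<close>
definition relative_functions :: "nat \<Rightarrow> (nat set list simplex \<Rightarrow> 'k::comm_ring_1) set" where
  "relative_functions n = {a \<in> invariant_functions Comp n. \<forall>F xs. a (F, singletons xs) = 0}"

definition big_block :: "nat set list \<Rightarrow> nat set" where
  "big_block G = hd (filter (\<lambda>B. 2 \<le> card B) G)"

definition lead :: "nat set \<Rightarrow> nat set list \<Rightarrow> nat" where
  "lead B F = length (takeWhile (\<lambda>U. U \<inter> B = {}) F)"

text \<open>
  The first block of \<open>F\<close> that meets the first large block \<open>B\<close> of \<open>G\<close> is replaced by a singleton in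
  \<open>B\<close> followed by the rest. The minimum is one possible choice of the singleton; by
  \<open>contraction_eq\<close> the value does not depend on it. The sign makes the term that merges the two parts
  again equal to the identity.
\<close>
definition contraction :: "nat \<Rightarrow> (nat set list simplex \<Rightarrow> 'k::comm_ring_1) \<Rightarrow> nat set list simplex \<Rightarrow> 'k" where
  "contraction m a = (\<lambda>(F, G).
     if (F, G) \<in> simplices Comp m \<and> G \<notin> range singletons then
       let B = big_block G; k = lead B F; x = Min (F ! k \<inter> B)
       in (- 1) ^ Suc k * a (take k F @ {x} # (F ! k - {x}) # drop (Suc k) F, G)
     else 0)"

lemma big_block:
  assumes "(F, G) \<in> simplices Comp n" "G \<notin> range singletons"
  shows "big_block G \<in> set G" "2 \<le> card (big_block G)" "big_block G \<subseteq> ground F"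
proof -
  have G: "ground G = ground F" "{} \<notin> set G" "finite (ground F)"
    using assms(1) by (auto simp: simplices_iff Comp_def compositions_iff)
  have "\<exists>B\<in>set G. 2 \<le> card B"
  proof (rule ccontr)
    assume *: "\<not> ?thesis"
    have "\<exists>i. B = {i}" if "B \<in> set G" for B
    proof -
      have "finite B" "B \<noteq> {}" using that G by (auto intro: finite_subset)
      then have "card B \<noteq> 0" by simp
      moreover have "\<not> 2 \<le> card B" using * that by blast
      ultimately have "card B = 1" by linarith
      then show ?thesis by (simp add: card_1_singleton_iff)
    qed
    then show False using assms(2) in_range_singletonsI by blast
  qed
  then have "filter (\<lambda>B. 2 \<le> card B) G \<noteq> []" by (simp add: filter_empty_conv)
  then have "big_block G \<in> set (filter (\<lambda>B. 2 \<le> card B) G)"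
    unfolding big_block_def by (rule hd_in_set)
  then show "big_block G \<in> set G" "2 \<le> card (big_block G)" by simp_all
  then show "big_block G \<subseteq> ground F" using G(1) by auto
qed

lemma lead_append:
  "\<lbrakk>\<forall>U\<in>set Us. U \<inter> B = {}; V \<inter> B \<noteq> {}\<rbrakk> \<Longrightarrow> lead B (Us @ V # Ws) = length Us"
  by (simp add: lead_def takeWhile_append)

lemma lead_le: "lead B F \<le> length F"
  by (simp add: lead_def length_takeWhile_le)

lemma split_at_lead:
  assumes "(F, G) \<in> simplices Comp n" "G \<notin> range singletons"
  obtains Us V Ws x where "F = Us @ V # Ws" "\<forall>U\<in>set Us. U \<inter> big_block G = {}" "x \<in> V \<inter> big_block G"
proof -
  have "big_block G \<noteq> {}" using big_block(2)[OF assms] by auto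
  then have "\<exists>V\<in>set F. V \<inter> big_block G \<noteq> {}" using big_block(3)[OF assms] by auto
  then obtain Us V Ws where "F = Us @ V # Ws" "V \<inter> big_block G \<noteq> {}"
    "\<forall>U\<in>set Us. \<not> U \<inter> big_block G \<noteq> {}"
    using split_list_first_prop[of F "\<lambda>V. V \<inter> big_block G \<noteq> {}"] by blast
  moreover from this obtain x where "x \<in> V \<inter> big_block G" by blast
  ultimately show thesis using that by blast
qed

lemma split_in_simplices:
  assumes "(Us @ V # Ws, G) \<in> simplices P n" "x \<in> V"
  shows "(Us @ {x} # (V - {x}) # Ws, G) \<in> simplices P (Suc n)"
proof -
  have "ground (Us @ {x} # (V - {x}) # Ws) = ground (Us @ V # Ws)" using assms(2) by auto
  then show ?thesis
    using assms unfolding simplices_iff by (auto simp: sorted_wrt_append)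
qed

text \<open>
  Blocks are sets, so a permutation within one block does nothing. This symmetry is what
  distinguishes a composition from a linear order; it is used both for the well-definedness of the
  contraction and for the vanishing of alternating forms.
\<close>
lemma relabel_transpose_in_block:
  assumes "G \<in> str Comp I" "B \<in> set G" "x \<in> B" "y \<in> B"
  shows "relabel Comp (Transposition.transpose x y) G = G"
proof -
  have "Transposition.transpose x y ` C = C" if "C \<in> set G" for C
  proof (cases "C = B")
    case True
    then show ?thesis using assms by (simp add: transpose_image_eq)
  next
    case False
    then have "C \<inter> B = {}"
      using that assms by (auto simp: Comp_def compositions_iff pairwise_def disjnt_def)
    then have "x \<notin> C" "y \<notin> C" using assms by auto
    then show ?thesis by (force simp: Transposition.transpose_def)
  qed
  then show ?thesis by (auto simp: Comp_def intro: map_idI)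
qed

text \<open>
  Two choices \<open>x\<close> and \<open>y\<close> of the singleton lie in the same block of \<open>F\<close> and in the same block of \<open>G\<close>.
  Their transposition therefore fixes all other blocks of \<open>F\<close> and the whole of \<open>G\<close>, and exchanges the
  two splittings; invariance gives equal values.
\<close>
lemma contraction_eq:
  assumes a: "a \<in> invariant_functions Comp (Suc m)"
    and F: "(Us @ V # Ws, G) \<in> simplices Comp m" "G \<notin> range singletons"
    and Us: "\<forall>U\<in>set Us. U \<inter> big_block G = {}" and x: "x \<in> V \<inter> big_block G"
  shows "contraction m a (Us @ V # Ws, G)
    = (- 1) ^ Suc (length Us) * a (Us @ {x} # (V - {x}) # Ws, G)"
proof -
  let ?B = "big_block G"
  define y where "y = Min (V \<inter> ?B)"
  have fin: "finite (ground (Us @ V # Ws))" using F(1) unfolding simplices_iff by blast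
  then have "finite (V \<inter> ?B)" by (auto intro: finite_subset)
  then have y: "y \<in> V \<inter> ?B" unfolding y_def using x by (intro Min_in) auto
  have dis: "blocks_disjoint (Us @ V # Ws)" using F(1) by (simp add: simplices_iff)
  let ?\<tau> = "Transposition.transpose x y"
  have "?\<tau> ` U = U" if "U \<in> set Us \<union> set Ws" for U
  proof -
    have "x \<notin> U" "y \<notin> U" using that dis x y by (auto simp: sorted_wrt_append)
    then show ?thesis by (force simp: Transposition.transpose_def)
  qed
  then have fix_rest: "map ((`) ?\<tau>) Us = Us" "map ((`) ?\<tau>) Ws = Ws" by (auto intro: map_idI)
  have fix_G: "relabel Comp ?\<tau> G = G"
    by (rule relabel_transpose_in_block[OF _ big_block(1)[OF F], of "ground (Us @ V # Ws)"])
      (use F x y in \<open>simp_all add: simplices_iff\<close>)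
  have V: "?\<tau> ` (V - {y}) = V - {x}"
    using x y by (simp add: image_set_diff transpose_image_eq)
  have "a (relabel_simplex Comp ?\<tau> (Us @ {y} # (V - {y}) # Ws, G)) = a (Us @ {y} # (V - {y}) # Ws, G)"
    using y F by (intro invariant_functions_relabel[OF a] split_in_simplices)
      (simp_all only: IntD1 inj_on_transpose)
  moreover have "relabel_simplex Comp ?\<tau> (Us @ {y} # (V - {y}) # Ws, G) = (Us @ {x} # (V - {x}) # Ws, G)"
    by (simp add: relabel_simplex_def fix_rest fix_G V)
  ultimately have "a (Us @ {y} # (V - {y}) # Ws, G) = a (Us @ {x} # (V - {x}) # Ws, G)" by simp
  moreover have "lead ?B (Us @ V # Ws) = length Us" using Us x by (intro lead_append) auto
  ultimately show ?thesis using F by (simp add: contraction_def Let_def flip: y_def)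
qed

text \<open>
  The relabelled simplex is split at the relabelled element, which need not be the minimum there;
  by \<open>contraction_eq\<close> this does not matter.
\<close>
lemma contraction_closed:
  assumes "a \<in> relative_functions (Suc m)"
  shows "contraction m a \<in> relative_functions m"
proof -
  have a: "a \<in> invariant_functions Comp (Suc m)" using assms by (simp add: relative_functions_def)
  have inv: "contraction m a (relabel_simplex Comp \<sigma> x) = contraction m a x"
    if x: "x \<in> simplices Comp m" and \<sigma>: "inj_on \<sigma> (ground (fst x))" for x \<sigma>
  proof -
    obtain F G where xF: "x = (F, G)" by (cases x)
    have F: "(F, G) \<in> simplices Comp m" and inj: "inj_on \<sigma> (ground F)" using x \<sigma> by (simp_all add: xF)
    have F': "(map ((`) \<sigma>) F, relabel Comp \<sigma> G) \<in> simplices Comp m"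
      using Comp.relabel_simplex_in_simplices[OF x \<sigma>] by (simp add: xF relabel_simplex_def)
    note iff = relabel_in_range_singletons_iff[OF F inj]
    show ?thesis
    proof (cases "G \<in> range singletons")
      case True
      then show ?thesis using iff by (simp add: xF contraction_def relabel_simplex_def)
    next
      case False
      let ?B = "big_block G"
      obtain Us V Ws y where split: "F = Us @ V # Ws" "\<forall>U\<in>set Us. U \<inter> ?B = {}" "y \<in> V \<inter> ?B"
        using split_at_lead[OF F False] by blast
      have sub: "C \<subseteq> ground F" if "C \<in> set G" for C
        using F that by (auto simp: simplices_iff Comp_def compositions_iff)
      have "card (\<sigma> ` C) = card C" if "C \<in> set G" for C
        using sub[OF that] inj by (metis card_image inj_on_subset)
      then have "filter (\<lambda>B. 2 \<le> card B) (map ((`) \<sigma>) G) = map ((`) \<sigma>) (filter (\<lambda>B. 2 \<le> card B) G)"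
        by (simp add: filter_map o_def cong: filter_cong)
      moreover have "filter (\<lambda>B. 2 \<le> card B) G \<noteq> []"
        using big_block(1,2)[OF F False] by (metis (no_types, lifting) filter_empty_conv)
      ultimately have B: "big_block (relabel Comp \<sigma> G) = \<sigma> ` ?B"
        by (simp add: big_block_def Comp_def hd_map)
      have inter: "\<sigma> ` U \<inter> \<sigma> ` ?B = \<sigma> ` (U \<inter> ?B)" if "U \<in> set F" for U
        using inj_on_image_Int[OF inj, of U ?B] that big_block(3)[OF F False] by auto
      have "contraction m a (map ((`) \<sigma>) Us @ \<sigma> ` V # map ((`) \<sigma>) Ws, relabel Comp \<sigma> G)
        = (- 1) ^ Suc (length (map ((`) \<sigma>) Us)) *
          a (map ((`) \<sigma>) Us @ {\<sigma> y} # (\<sigma> ` V - {\<sigma> y}) # map ((`) \<sigma>) Ws, relabel Comp \<sigma> G)"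
      proof (rule contraction_eq[OF a])
        show "(map ((`) \<sigma>) Us @ \<sigma> ` V # map ((`) \<sigma>) Ws, relabel Comp \<sigma> G) \<in> simplices Comp m"
          using F' split(1) by simp
        show "relabel Comp \<sigma> G \<notin> range singletons" using False iff by simp
        show "\<forall>U\<in>set (map ((`) \<sigma>) Us). U \<inter> big_block (relabel Comp \<sigma> G) = {}"
          using split(2) inter by (auto simp: B split(1))
        show "\<sigma> y \<in> \<sigma> ` V \<inter> big_block (relabel Comp \<sigma> G)" using split(3) by (auto simp: B)
      qed
      also have "\<sigma> ` V - {\<sigma> y} = \<sigma> ` (V - {y})"
        using split inj_on_image_set_diff[OF inj, of V "{y}"] by auto
      also have "a (map ((`) \<sigma>) Us @ {\<sigma> y} # \<sigma> ` (V - {y}) # map ((`) \<sigma>) Ws, relabel Comp \<sigma> G)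
        = a (relabel_simplex Comp \<sigma> (Us @ {y} # (V - {y}) # Ws, G))"
        by (simp add: relabel_simplex_def)
      also have "\<dots> = a (Us @ {y} # (V - {y}) # Ws, G)"
      proof (rule invariant_functions_relabel[OF a])
        show "(Us @ {y} # (V - {y}) # Ws, G) \<in> simplices Comp (Suc m)"
          using F split by (intro split_in_simplices) auto
        show "inj_on \<sigma> (ground (fst (Us @ {y} # (V - {y}) # Ws, G)))"
          by (rule inj_on_subset[OF inj]) (use split in auto)
      qed
      finally show ?thesis
        using contraction_eq[OF a F[unfolded split(1)] False split(2,3)]
        by (simp add: xF split(1) relabel_simplex_def)
    qed
  qed
  have "contraction m a \<in> invariant_functions Comp m"
  proof (rule invariant_functionsI)
    fix x :: "_ simplex" assume "x \<notin> simplices Comp m"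
    then show "contraction m a x = 0" by (auto simp: contraction_def split: prod.splits)
  qed (rule inv)
  moreover have "contraction m a (F, singletons xs) = 0" for F xs
    by (simp add: contraction_def)
  ultimately show ?thesis by (simp only: relative_functions_def mem_Collect_eq simp_thms)
qed

text \<open>
  Splitting a block keeps the ground set, so the contraction of \<open>a\<close> vanishes at all simplices over a
  ground set over which \<open>a\<close> vanishes.
\<close>
lemma contraction_zero:
  assumes a: "a \<in> invariant_functions Comp (Suc m)"
    and "\<And>F' G'. \<lbrakk>(F', G') \<in> simplices Comp (Suc m); ground F' = ground F\<rbrakk> \<Longrightarrow> a (F', G') = 0"
  shows "contraction m a (F, G) = 0"
proof (cases "(F, G) \<in> simplices Comp m \<and> G \<notin> range singletons")
  case True
  then obtain Us V Ws y where split: "F = Us @ V # Ws" "\<forall>U\<in>set Us. U \<inter> big_block G = {}"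
    "y \<in> V \<inter> big_block G" using split_at_lead[of F G m] by blast
  have "(Us @ {y} # (V - {y}) # Ws, G) \<in> simplices Comp (Suc m)"
    using True split by (intro split_in_simplices) auto
  moreover have "ground (Us @ {y} # (V - {y}) # Ws) = ground F" using split by auto
  ultimately have "a (Us @ {y} # (V - {y}) # Ws, G) = 0" by (simp only: assms(2))
  moreover have "contraction m a (F, G) = (- 1) ^ Suc (length Us) * a (Us @ {y} # (V - {y}) # Ws, G)"
    unfolding split(1) by (rule contraction_eq[OF a]) (use True split in simp_all)
  ultimately show ?thesis by simp
next
  case False
  then show ?thesis unfolding contraction_def prod.case by (rule if_not_P)
qed

lemma invariant_functions_add:
  "\<lbrakk>a \<in> invariant_functions P n; b \<in> invariant_functions P n\<rbrakk>
    \<Longrightarrow> (\<lambda>x. a x + b x) \<in> invariant_functions P n"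
  by (rule invariant_functionsI) (simp_all add: invariant_functions_zero invariant_functions_relabel)

lemma invariant_functions_diff:
  "\<lbrakk>a \<in> invariant_functions P n; b \<in> invariant_functions P n\<rbrakk>
    \<Longrightarrow> (\<lambda>x. a x - b x) \<in> invariant_functions P n"
  by (rule invariant_functionsI) (simp_all add: invariant_functions_zero invariant_functions_relabel)

lemma relative_functions_diff:
  "\<lbrakk>a \<in> relative_functions n; b \<in> relative_functions n\<rbrakk> \<Longrightarrow> (\<lambda>x. a x - b x) \<in> relative_functions n"
  by (simp add: relative_functions_def invariant_functions_diff)

lemma relative_functions_sum:
  "(\<And>k. k \<in> A \<Longrightarrow> a k \<in> relative_functions n) \<Longrightarrow> (\<lambda>x. \<Sum>k\<in>A. a k x) \<in> relative_functions n"
proof (induction A rule: infinite_finite_induct)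
  case (insert k A)
  then show ?case by (simp add: relative_functions_def invariant_functions_add)
qed (auto simp: relative_functions_def intro: invariant_functionsI)

lemma relative_functions_iff:
  "a \<in> invariant_functions Comp n \<Longrightarrow> a \<in> relative_functions n \<longleftrightarrow> pull_singletons n a = (\<lambda>x. 0)"
  by (auto simp: relative_functions_def pull_singletons_apply fun_eq_iff)

lemma simplicial_diff_zero: "simplicial_diff P n (\<lambda>x. 0) = (\<lambda>x. 0)"
  by (simp add: simplicial_diff_def fun_eq_iff del: sum.atMost_Suc)

lemma simplicial_diff_minus:
  "simplicial_diff P n (\<lambda>x. a x - b x) = (\<lambda>x. simplicial_diff P n a x - simplicial_diff P n b x)"
  by (simp add: simplicial_diff_def fun_eq_iff right_diff_distrib sum_subtractf del: sum.atMost_Suc)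

lemma simplicial_diff_sum:
  "simplicial_diff P n (\<lambda>x. \<Sum>k\<in>A. a k x) x = (\<Sum>k\<in>A. simplicial_diff P n (a k) x)"
  by (auto simp: simplicial_diff_def sum_distrib_left simp del: sum.atMost_Suc intro: sum.swap)

lemma relative_functions_simplicial_diff:
  assumes "a \<in> relative_functions n"
  shows "simplicial_diff Comp n a \<in> relative_functions (Suc n)"
proof -
  have a: "a \<in> invariant_functions Comp n" using assms by (simp add: relative_functions_def)
  show ?thesis
    using assms unfolding relative_functions_iff[OF a] relative_functions_iff[OF Comp.simplicial_diff_closed[OF a]]
    by (simp add: pull_singletons_diff[OF a] simplicial_diff_zero)
qed

text \<open>
  The comparison of the faces \<open>X\<close> of a simplex with the faces \<open>Y\<close> of the same simplex with the block
  \<open>l\<close> split in two: faces before the split correspond with equal index, those after it with index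
  shifted by one, the two faces that move the split vanish, and \<open>Y (Suc l)\<close> undoes the split.
\<close>
lemma alternating_sum_shift:
  fixes X Y :: "nat \<Rightarrow> 'a::comm_ring_1"
  assumes "l \<le> N" and Y: "(\<Sum>k\<le>Suc N. (- 1) ^ k * Y k) = 0"
    and "\<And>k. k < l \<Longrightarrow> X k = (- 1) ^ l * Y k" "X l = 0" "Y l = 0"
    and "\<And>k. \<lbrakk>l < k; k \<le> N\<rbrakk> \<Longrightarrow> X k = (- 1) ^ Suc l * Y (Suc k)"
  shows "(\<Sum>k\<le>N. (- 1) ^ k * X k) = Y (Suc l)"
proof -
  let ?L = "\<Sum>k<l. (- 1) ^ k * Y k" and ?R = "\<Sum>k\<in>{Suc l..N}. (- 1) ^ k * Y (Suc k)"
  have N: "{..N} = {..<l} \<union> {l} \<union> {Suc l..N}"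
    and SN: "{..Suc N} = {..<l} \<union> {l} \<union> {Suc l} \<union> {Suc (Suc l)..Suc N}"
    using \<open>l \<le> N\<close> by auto
  have "(\<Sum>k\<le>N. (- 1) ^ k * X k) = (\<Sum>k<l. (- 1) ^ k * X k) + (\<Sum>k\<in>{Suc l..N}. (- 1) ^ k * X k)"
    unfolding N using assms(4) by (subst sum.union_disjoint) (auto simp: sum.union_disjoint)
  also have "(\<Sum>k<l. (- 1) ^ k * X k) = (- 1) ^ l * ?L"
    using assms(3) by (simp add: sum_distrib_left mult_ac)
  also have "(\<Sum>k\<in>{Suc l..N}. (- 1) ^ k * X k) = - ((- 1) ^ l * ?R)"
    using assms(6) by (simp add: sum_distrib_left sum_negf mult_ac)
  finally have X: "(\<Sum>k\<le>N. (- 1) ^ k * X k) = (- 1) ^ l * (?L - ?R)" by (simp add: algebra_simps)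
  have "(\<Sum>k\<le>Suc N. (- 1) ^ k * Y k) = ?L + (- 1) ^ l * Y l + (- 1) ^ Suc l * Y (Suc l)
      + (\<Sum>k\<in>{Suc (Suc l)..Suc N}. (- 1) ^ k * Y k)"
    unfolding SN by (subst sum.union_disjoint; (auto; fail)?)+
  also have "(\<Sum>k\<in>{Suc (Suc l)..Suc N}. (- 1) ^ k * Y k) = - ?R"
    unfolding sum.shift_bounds_cl_Suc_ivl by (simp add: sum_negf)
  finally have "?L + (- 1) ^ Suc l * Y (Suc l) - ?R = 0" using Y assms(5) by simp
  then have "?L - ?R = (- 1) ^ l * Y (Suc l)" by (simp add: algebra_simps)
  then show ?thesis using X by (simp flip: mult.assoc power_add)
qed

lemma (in restriction_species) face_eq_same_ground:
  assumes "(F, b) \<in> simplices P n" "ground (drop_vertex k F) = ground F"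
  shows "face P k (F, b) = (drop_vertex k F, b)"
  using assms by (simp add: face_def simplices_iff restrict_id)

text \<open>
  The homotopy formula at one simplex, for a cocycle \<open>r\<close> that already vanishes on everything smaller.
  With \<open>l\<close> the position of the first block \<open>V\<close> meeting \<open>B\<close>, the faces of \<open>F\<close> are compared with those
  of the split decomposition, whose alternating sum is zero as \<open>r\<close> is a cocycle. A face that shrinks
  the ground set contributes nothing. A face away from \<open>V\<close> commutes with the splitting. The faces that
  merge \<open>V\<close>, or the singleton, into the preceding block make \<open>B\<close> be met earlier and contribute
  nothing either. What remains is the face that merges the two parts of \<open>V\<close>, which gives \<open>r (F, G)\<close>.
\<close>
lemma diff_contraction:
  fixes r :: "nat set list simplex \<Rightarrow> 'k::comm_ring_1"
  assumes r: "r \<in> relative_functions (Suc m)" and cocycle: "simplicial_diff Comp (Suc m) r = (\<lambda>x. 0)"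
    and x: "(F, G) \<in> simplices Comp (Suc m)" and big: "G \<notin> range singletons"
    and smaller: "\<And>F' G'. \<lbrakk>(F', G') \<in> simplices Comp (Suc m); card (ground F') < card (ground F)\<rbrakk>
      \<Longrightarrow> r (F', G') = 0"
    and earlier: "\<And>F'. \<lbrakk>(F', G) \<in> simplices Comp (Suc m); ground F' = ground F;
      lead (big_block G) F' < lead (big_block G) F\<rbrakk> \<Longrightarrow> r (F', G) = 0"
  shows "simplicial_diff Comp m (contraction m r) (F, G) = r (F, G)"
proof -
  let ?B = "big_block G"
  have r_inv: "r \<in> invariant_functions Comp (Suc m)" using r by (simp add: relative_functions_def)
  obtain Us V Ws v where F: "F = Us @ V # Ws" and Us: "\<forall>U\<in>set Us. U \<inter> ?B = {}" and v: "v \<in> V \<inter> ?B"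
    using split_at_lead[OF x big] by blast
  let ?l = "length Us" and ?S = "Us @ {v} # (V - {v}) # Ws" and ?I = "ground F"
  have fin: "finite ?I" and lenF: "length F = Suc m" and dis: "blocks_disjoint (Us @ V # Ws)"
    using x by (simp_all add: simplices_iff F del: sorted_wrt_append)
  have S: "(?S, G) \<in> simplices Comp (Suc (Suc m))"
    using split_in_simplices[of Us V Ws G Comp "Suc m" v] x v by (simp add: F)
  have US: "ground ?S = ?I" using v by (auto simp: F)
  have lead: "lead ?B F = ?l" unfolding F using Us v by (intro lead_append) auto
  define X where "X = (\<lambda>k. contraction m r (face Comp k (F, G)))"
  define Y where "Y = (\<lambda>k. r (face Comp k (?S, G)))"
  have r_vanish: "r (F', G') = 0" if "card (ground F') < card ?I" for F' G'
    using smaller that invariant_functions_zero[OF r_inv, of "(F', G')"] by blast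
  have c_vanish: "contraction m r (F', G') = 0" if "card (ground F') < card ?I" for F' G'
    using r_vanish that by (intro contraction_zero[OF r_inv]) simp
  have X_vanish: "X k = 0" if "ground (drop_vertex k F) \<subset> ?I" for k
    unfolding X_def face_def prod.case by (rule c_vanish) (rule psubset_card_mono[OF fin that])
  have Y_vanish: "Y k = 0" if "ground (drop_vertex k ?S) \<subset> ?I" for k
    unfolding Y_def face_def prod.case by (rule r_vanish) (rule psubset_card_mono[OF fin that])
  have X_eq: "X k = (- 1) ^ Suc (length Us') * r (Us' @ {v} # (V' - {v}) # Ws', G)"
    if "drop_vertex k F = Us' @ V' # Ws'" "\<forall>U\<in>set Us'. U \<inter> ?B = {}" "v \<in> V'"
      "ground (drop_vertex k F) = ?I" "k \<le> Suc m" for k Us' V' Ws'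
  proof -
    have face: "face Comp k (F, G) = (Us' @ V' # Ws', G)"
      using Comp.face_eq_same_ground[OF x that(4)] that(1) by simp
    moreover have "face Comp k (F, G) \<in> simplices Comp m"
      using x that(5) by (rule Comp.face_in_simplices)
    ultimately have "(Us' @ V' # Ws', G) \<in> simplices Comp m" by simp
    then show ?thesis
      unfolding X_def face by (rule contraction_eq[OF r_inv]) (use that v big in simp_all)
  qed
  have Y_eq: "Y k = r (drop_vertex k ?S, G)" if "ground (drop_vertex k ?S) = ?I" for k
    unfolding Y_def using Comp.face_eq_same_ground[OF S] that US by simp
  have before: "X k = (- 1) ^ ?l * Y k" if k: "k < ?l" for k
  proof -
    have dF: "drop_vertex k F = drop_vertex k Us @ V # Ws"
      and dS: "drop_vertex k ?S = drop_vertex k Us @ {v} # (V - {v}) # Ws"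
      using k by (simp_all add: F drop_vertex_append_left)
    have same: "ground (drop_vertex k ?S) = ground (drop_vertex k F)" using v by (auto simp: dF dS)
    show ?thesis
    proof (cases "ground (drop_vertex k F) = ?I")
      case True
      have "\<forall>U\<in>set (drop_vertex k Us). U \<inter> ?B = {}"
        using Us Union_drop_vertex_subset[of k Us] by blast
      then have "X k = (- 1) ^ Suc (length (drop_vertex k Us)) * r (drop_vertex k ?S, G)"
        using True k v lenF by (subst X_eq[OF dF]) (simp_all add: dS F)
      moreover have "Suc (length (drop_vertex k Us)) = ?l" using k by simp
      ultimately show ?thesis using True same by (simp add: Y_eq)
    next
      case False
      then have "ground (drop_vertex k F) \<subset> ?I" using Union_drop_vertex_subset[of k F] by blast
      then show ?thesis using same by (simp add: X_vanish Y_vanish)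
    qed
  qed
  have at: "X ?l = 0 \<and> Y ?l = 0"
  proof (cases Us rule: rev_cases)
    case Nil
    have "v \<notin> ground Ws" using dis v by (auto simp: Nil)
    then show ?thesis
      using v by (intro conjI X_vanish Y_vanish) (auto simp: Nil F)
  next
    case (snoc Us' U)
    have dF: "drop_vertex ?l F = Us' @ (U \<union> V) # Ws"
      and dS: "drop_vertex ?l ?S = Us' @ (U \<union> {v}) # (V - {v}) # Ws"
      using drop_vertex_append_right[of 1 Us'] by (simp_all add: F snoc)
    have vU: "v \<notin> U" using dis v by (auto simp: snoc sorted_wrt_append)
    have Us': "\<forall>U\<in>set Us'. U \<inter> ?B = {}" using Us by (simp add: snoc)
    have "length Us' < lead ?B F" by (simp add: lead snoc)
    moreover have "lead ?B (Us' @ {v} # (U \<union> V - {v}) # Ws) = length Us'"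
      "lead ?B (Us' @ (U \<union> {v}) # (V - {v}) # Ws) = length Us'"
      using Us' v by (intro lead_append; auto)+
    moreover have "ground (Us' @ {v} # (U \<union> V - {v}) # Ws) = ?I"
      "ground (Us' @ (U \<union> {v}) # (V - {v}) # Ws) = ?I"
      using v by (auto simp: F snoc)
    ultimately have *: "r (Us' @ {v} # (U \<union> V - {v}) # Ws, G) = 0"
      "r (Us' @ (U \<union> {v}) # (V - {v}) # Ws, G) = 0"
      using earlier invariant_functions_zero[OF r_inv] by metis+
    have "X ?l = (- 1) ^ Suc (length Us') * r (Us' @ {v} # (U \<union> V - {v}) # Ws, G)"
    proof (rule X_eq[OF dF Us'])
      show "ground (drop_vertex ?l F) = ?I" unfolding dF by (auto simp: F snoc)
    qed (use v lenF in \<open>simp_all add: F\<close>)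
    moreover have "Y ?l = r (Us' @ (U \<union> {v}) # (V - {v}) # Ws, G)"
    proof -
      have "ground (drop_vertex ?l ?S) = ?I" unfolding dS using v by (auto simp: F snoc)
      then show ?thesis using dS by (simp add: Y_eq)
    qed
    ultimately show ?thesis using * by simp
  qed
  have at_Suc: "Y (Suc ?l) = r (F, G)"
  proof -
    have "insert v V = V" using v by auto
    then have "drop_vertex (Suc ?l) ?S = F"
      using drop_vertex_append_right[of 1 Us "{v} # (V - {v}) # Ws"] by (simp add: F)
    then show ?thesis using Y_eq[of "Suc ?l"] by simp
  qed
  have after: "X k = (- 1) ^ Suc ?l * Y (Suc k)" if k: "?l < k" "k \<le> Suc m" for k
  proof -
    obtain j where kj: "k = ?l + Suc j" using k(1) less_imp_Suc_add by fastforce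
    have dF: "drop_vertex k F = Us @ drop_vertex (Suc j) (V # Ws)"
      and dS: "drop_vertex (Suc k) ?S = Us @ {v} # drop_vertex (Suc j) ((V - {v}) # Ws)"
      using drop_vertex_append_right[of "Suc j" Us "V # Ws"]
        drop_vertex_append_right[of "Suc (Suc j)" Us "{v} # (V - {v}) # Ws"]
      by (simp_all add: F kj)
    show ?thesis
    proof (cases "j = 0 \<and> Ws = []")
      case True
      have "?B \<subseteq> V" using big_block(3)[OF x big] Us True by (auto simp: F)
      moreover have "?B \<noteq> {v}" using big_block(2)[OF x big] by auto
      ultimately obtain w where w: "w \<in> V" "w \<noteq> v" using v by blast
      have notin: "v \<notin> ground Us" "w \<notin> ground Us" using dis v w by (auto simp: sorted_wrt_append)
      have "ground (drop_vertex k F) \<subset> ?I" "ground (drop_vertex (Suc k) ?S) \<subset> ?I"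
        unfolding dF dS using True v w notin by (auto simp: F)
      then show ?thesis by (simp add: X_vanish Y_vanish)
    next
      case False
      obtain V' Ws' where V': "drop_vertex (Suc j) (V # Ws) = V' # Ws'" "v \<in> V'"
        "drop_vertex (Suc j) ((V - {v}) # Ws) = (V' - {v}) # Ws'"
      proof (cases j)
        case 0
        then obtain W Ws' where Ws: "Ws = W # Ws'" using False by (cases Ws) auto
        have "v \<notin> W" using dis v by (auto simp: Ws sorted_wrt_append)
        then have "V - {v} \<union> W = V \<union> W - {v}" by auto
        then show ?thesis using that[of "V \<union> W" Ws'] v by (simp add: 0 Ws)
      next
        case (Suc i)
        then show ?thesis using that[of V "drop_vertex (Suc i) Ws"] v by simp
      qed
      have same: "ground (drop_vertex (Suc k) ?S) = ground (drop_vertex k F)"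
        using V'(2) by (auto simp: dF dS V'(1,3))
      show ?thesis
      proof (cases "ground (drop_vertex k F) = ?I")
        case True
        then have "X k = (- 1) ^ Suc ?l * r (Us @ {v} # (V' - {v}) # Ws', G)"
          using Us V' k(2) by (intro X_eq) (simp_all add: dF)
        moreover have "Y (Suc k) = r (Us @ {v} # (V' - {v}) # Ws', G)"
          using Y_eq[of "Suc k"] True same by (simp add: dS V'(3))
        ultimately show ?thesis by simp
      next
        case False
        then have "ground (drop_vertex k F) \<subset> ?I" using Union_drop_vertex_subset[of k F] by blast
        then show ?thesis using same by (simp add: X_vanish Y_vanish)
      qed
    qed
  qed
  have "(\<Sum>k\<le>Suc (Suc m). (- 1) ^ k * Y k) = simplicial_diff Comp (Suc m) r (?S, G)"
    using S by (simp add: simplicial_diff_def Y_def del: sum.atMost_Suc)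
  also have "\<dots> = 0" by (simp add: cocycle)
  finally have Y_sum: "(\<Sum>k\<le>Suc (Suc m). (- 1) ^ k * Y k) = 0" .
  have l_le: "?l \<le> Suc m" using lenF by (simp add: F)
  have "(\<Sum>k\<le>Suc m. (- 1) ^ k * X k) = Y (Suc ?l)"
    by (rule alternating_sum_shift[where X = X and Y = Y, OF l_le Y_sum before _ _ after])
      (use at in blast)+
  then show ?thesis using x at_Suc by (simp add: simplicial_diff_def X_def del: sum.atMost_Suc)
qed

text \<open>
  The error left after \<open>k\<close> corrections by coboundaries of contractions.
\<close>
primrec residue :: "nat \<Rightarrow> (nat set list simplex \<Rightarrow> 'k::comm_ring_1) \<Rightarrow> nat \<Rightarrow> nat set list simplex \<Rightarrow> 'k" where
  "residue m r 0 = r"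
| "residue m r (Suc k) = (\<lambda>x. residue m r k x - simplicial_diff Comp m (contraction m (residue m r k)) x)"

lemma residue_relative:
  assumes "r \<in> relative_functions (Suc m)" "simplicial_diff Comp (Suc m) r = (\<lambda>x. 0)"
  shows "residue m r k \<in> relative_functions (Suc m) \<and>
    simplicial_diff Comp (Suc m) (residue m r k) = (\<lambda>x. 0)"
proof (induction k)
  case (Suc k)
  then show ?case
    by (simp add: relative_functions_diff relative_functions_simplicial_diff contraction_closed
        simplicial_diff_minus Comp.simplicial_diff_diff)
qed (use assms in simp)

text \<open>
  The measure encodes the lexicographic order on the size of the ground set and the position of the
  first block meeting the large one. That position is at most \<open>m + 1\<close>, the number of blocks, so the
  factor \<open>m + 2\<close> makes a smaller ground set outweigh any position. Each correction removes the error at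
  the smallest measure still present.
\<close>
lemma residue_vanishes:
  assumes r: "r \<in> relative_functions (Suc m)" "simplicial_diff Comp (Suc m) r = (\<lambda>x. 0)"
    and x: "(F, G) \<in> simplices Comp (Suc m)"
    and "card (ground F) * (m + 2) + lead (big_block G) F < k"
  shows "residue m r k (F, G) = 0"
  using assms(3,4)
proof (induction k arbitrary: F G)
  case (Suc k)
  let ?r = "residue m r k"
  have r': "?r \<in> relative_functions (Suc m)" "simplicial_diff Comp (Suc m) ?r = (\<lambda>x. 0)"
    using residue_relative[OF r] by blast+
  show ?case
  proof (cases "G \<in> range singletons")
    case True
    then show ?thesis using residue_relative[OF r, of "Suc k"] by (auto simp: relative_functions_def)
  next
    case False
    have "simplicial_diff Comp m (contraction m ?r) (F, G) = ?r (F, G)"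
    proof (rule diff_contraction[OF r' Suc.prems(1) False])
      fix F' G' assume F': "(F', G') \<in> simplices Comp (Suc m)" "card (ground F') < card (ground F)"
      have "lead (big_block G') F' < m + 2"
        using lead_le[of "big_block G'" F'] F'(1) by (simp add: simplices_iff)
      moreover have "card (ground F') * (m + 2) + (m + 2) \<le> card (ground F) * (m + 2)"
        using mult_le_mono1[of "Suc (card (ground F'))" "card (ground F)" "m + 2"] F'(2) by simp
      ultimately show "?r (F', G') = 0" using Suc.prems(2) by (intro Suc.IH[OF F'(1)]) linarith
    next
      fix F' assume "(F', G) \<in> simplices Comp (Suc m)" "ground F' = ground F"
        "lead (big_block G) F' < lead (big_block G) F"
      then show "?r (F', G) = 0" using Suc.prems(2) by (intro Suc.IH) simp_all
    qed
    then show ?thesis by simp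
  qed
qed simp

text \<open>
  At a given simplex only finitely many corrections are non-zero, so their infinite sum \<open>c\<close> makes sense.
  To compute its coboundary at a simplex, the sum may be cut off at the bound of that simplex, which
  also bounds all its faces; the partial sums telescope.
\<close>
lemma relative_complex_acyclic:
  fixes r :: "nat set list simplex \<Rightarrow> 'k::comm_ring_1"
  assumes r: "r \<in> relative_functions (Suc m)" "simplicial_diff Comp (Suc m) r = (\<lambda>x. 0)"
  obtains c where "c \<in> relative_functions m" "simplicial_diff Comp m c = r"
proof -
  let ?h = "\<lambda>k. contraction m (residue m r k)"
  define bound where "bound F = Suc (card (ground F)) * (m + 2)" for F :: "nat set list"
  define c where "c = (\<lambda>(F, G). \<Sum>k<bound F. ?h k (F, G))"
  have vanish: "residue m r k (F, G) = 0" if "bound F \<le> k" for k F G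
  proof (cases "(F, G) \<in> simplices Comp (Suc m)")
    case True
    then have "lead (big_block G) F < m + 2"
      using lead_le[of "big_block G" F] by (simp add: simplices_iff)
    then show ?thesis using that True by (intro residue_vanishes[OF r]) (auto simp: bound_def)
  next
    case False
    have "residue m r k \<in> invariant_functions Comp (Suc m)"
      using residue_relative[OF r, of k] by (simp add: relative_functions_def)
    then show ?thesis using False by (rule invariant_functions_zero)
  qed
  have h_zero: "?h k (F, G) = 0" if "bound F \<le> k" for k F G
  proof (rule contraction_zero)
    show "residue m r k \<in> invariant_functions Comp (Suc m)"
      using residue_relative[OF r] by (simp add: relative_functions_def)
    show "residue m r k (F', G') = 0" if "ground F' = ground F" for F' G'
      using \<open>bound F \<le> k\<close> that by (intro vanish) (simp add: bound_def)
  qed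
  have c_eq: "c (F, G) = (\<Sum>k<K. ?h k (F, G))" if "bound F \<le> K" for K F G
    unfolding c_def prod.case using that by (intro sum.mono_neutral_left) (auto intro: h_zero)
  \<comment> \<open>The cut-off depends on the size of the ground set only, so \<open>c\<close> inherits invariance and vanishing
    on linear orders from the partial sums.\<close>
  have partial: "(\<lambda>x. \<Sum>k<K. ?h k x) \<in> relative_functions m" for K
    using residue_relative[OF r] by (intro relative_functions_sum contraction_closed) blast
  have c: "c \<in> relative_functions m"
  proof -
    have "c \<in> invariant_functions Comp m"
    proof (rule invariant_functionsI)
      fix x assume x: "x \<notin> simplices Comp m"
      obtain F G where F: "x = (F, G)" by (cases x)
      have "(\<lambda>x. \<Sum>k<bound F. ?h k x) \<in> invariant_functions Comp m"
        using partial[of "bound F"] by (simp add: relative_functions_def)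
      from invariant_functions_zero[OF this x] show "c x = 0"
        using c_eq[of F "bound F" G] by (simp add: F)
    next
      fix x and \<sigma> :: "nat \<Rightarrow> nat"
      assume x: "x \<in> simplices Comp m" "inj_on \<sigma> (ground (fst x))"
      obtain F G where F: "x = (F, G)" by (cases x)
      have "ground (map ((`) \<sigma>) F) = \<sigma> ` ground F" by auto
      then have "bound (map ((`) \<sigma>) F) = bound F"
        using x(2) F by (simp add: bound_def card_image)
      then have "c (relabel_simplex Comp \<sigma> x) = (\<Sum>k<bound F. ?h k (relabel_simplex Comp \<sigma> x))"
        using c_eq[of "map ((`) \<sigma>) F" "bound F" "relabel Comp \<sigma> G"] by (simp add: F relabel_simplex_def)
      also have "\<dots> = (\<Sum>k<bound F. ?h k x)"
        using partial[of "bound F"] invariant_functions_relabel[OF _ x] by (auto simp: relative_functions_def)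
      finally show "c (relabel_simplex Comp \<sigma> x) = c x" using c_eq[of F "bound F" G] by (simp add: F)
    qed
    moreover have "c (F, singletons xs) = 0" for F xs
      using partial[of "bound F"] c_eq[of F "bound F" "singletons xs"] by (simp add: relative_functions_def)
    ultimately show ?thesis by (simp add: relative_functions_def)
  qed
  have "simplicial_diff Comp m c (F, G) = r (F, G)" for F G
  proof -
    let ?K = "bound F"
    have "c (face Comp i (F, G)) = (\<Sum>k<?K. ?h k (face Comp i (F, G)))"
      if "(F, G) \<in> simplices Comp (Suc m)" for i
    proof -
      have "card (ground (drop_vertex i F)) \<le> card (ground F)"
        using that by (intro card_mono Union_drop_vertex_subset) (simp add: simplices_iff)
      then have "bound (drop_vertex i F) \<le> ?K" unfolding bound_def by (intro mult_le_mono1) simp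
      then show ?thesis unfolding face_def prod.case by (rule c_eq)
    qed
    then have "simplicial_diff Comp m c (F, G) = simplicial_diff Comp m (\<lambda>x. \<Sum>k<?K. ?h k x) (F, G)"
      by (simp add: simplicial_diff_def del: sum.atMost_Suc)
    also have "\<dots> = (\<Sum>k<?K. residue m r k (F, G) - residue m r (Suc k) (F, G))"
      by (simp add: simplicial_diff_sum)
    also have "\<dots> = r (F, G) - residue m r ?K (F, G)"
      unfolding sum_lessThan_telescope'[of "\<lambda>k. residue m r k (F, G)"] by simp
    also have "residue m r ?K (F, G) = 0" by (rule vanish) simp
    finally show ?thesis by simp
  qed
  then have "simplicial_diff Comp m c = r" by auto
  with c that show thesis by blast
qed

section \<open>The isomorphism in cohomology\<close>

text \<open>
  The isomorphism criterion for quotients written as sets of cosets. The scalar multiples and images of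
  cosets are saturated by adding the subgroup, which turns them into the expected cosets.
\<close>
lemma linear_iso_quotients:
  fixes p :: "'a::ab_group_add \<Rightarrow> 'b::ab_group_add"
  assumes B: "0 \<in> B" "\<And>x y. x \<in> B \<Longrightarrow> y \<in> B \<Longrightarrow> x + y \<in> B" "\<And>x. x \<in> B \<Longrightarrow> - x \<in> B"
    and B': "0 \<in> B'" "\<And>x y. x \<in> B' \<Longrightarrow> y \<in> B' \<Longrightarrow> x + y \<in> B'" "\<And>x. x \<in> B' \<Longrightarrow> - x \<in> B'"
    and s: "\<And>c x y. s c (x + y) = s c x + s c y" "\<And>c x. x \<in> B \<Longrightarrow> s c x \<in> B"
    and t: "\<And>c x y. t c (x + y) = t c x + t c y" "\<And>c x. x \<in> B' \<Longrightarrow> t c x \<in> B'"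
    and p: "\<And>x y. p (x + y) = p x + p y" "\<And>c x. p (s c x) = t c (p x)" "\<And>x. x \<in> B \<Longrightarrow> p x \<in> B'"
    and Z: "\<And>x. x \<in> Z \<Longrightarrow> p x \<in> Z'"
    and inj: "\<And>x y. \<lbrakk>x \<in> Z; y \<in> Z; p (x - y) \<in> B'\<rbrakk> \<Longrightarrow> x - y \<in> B"
    and surj: "\<And>y. y \<in> Z' \<Longrightarrow> \<exists>x\<in>Z. p x = y"
  shows "linear_iso ((\<lambda>x. x +o B) ` Z) (\<lambda>c A. s c ` A + B) ((\<lambda>x. x +o B') ` Z') (\<lambda>c A. t c ` A + B')
    (\<lambda>A. p ` A + B')"
proof -
  have coset_image: "f ` (x +o C) + D = f x +o D"
    if f: "\<And>u v. f (u + v) = f u + f v" "\<And>u. u \<in> C \<Longrightarrow> f u \<in> D" and "0 \<in> C"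
      and D: "0 \<in> D" "\<And>u v. u \<in> D \<Longrightarrow> v \<in> D \<Longrightarrow> u + v \<in> D"
    for f :: "'u::ab_group_add \<Rightarrow> 'w::ab_group_add" and x C D
  proof
    show "f ` (x +o C) + D \<subseteq> f x +o D"
    proof
      fix w assume "w \<in> f ` (x +o C) + D"
      then obtain u v where "u \<in> C" "v \<in> D" "w = f (x + u) + v"
        by (auto simp: set_plus_def elt_set_plus_def)
      then have "w = f x + (f u + v)" "f u + v \<in> D" using f D(2) by (auto simp: add.assoc)
      then show "w \<in> f x +o D" by auto
    qed
    show "f x +o D \<subseteq> f ` (x +o C) + D"
    proof
      fix w assume "w \<in> f x +o D"
      then obtain v where v: "w = f (x + 0) + v" "v \<in> D" by (auto simp: elt_set_plus_def)
      have "f (x + 0) \<in> f ` (x +o C)" using \<open>0 \<in> C\<close> by (intro imageI set_plus_intro2)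
      then show "w \<in> f ` (x +o C) + D" unfolding v(1) using v(2) by (rule set_plus_intro)
    qed
  qed
  have coset_add: "(x +o C) + (y +o C) = (x + y) +o C"
    if C: "0 \<in> C" "\<And>u v. u \<in> C \<Longrightarrow> v \<in> C \<Longrightarrow> u + v \<in> C" for x y and C :: "'u::ab_group_add set"
  proof -
    have "C + C = C"
    proof
      show "C + C \<subseteq> C" using C(2) by (auto simp: set_plus_def)
      show "C \<subseteq> C + C"
      proof
        fix u assume "u \<in> C"
        then have "u + 0 \<in> C + C" using C(1) by (rule set_plus_intro)
        then show "u \<in> C + C" by simp
      qed
    qed
    then show ?thesis by (simp only: set_plus_rearrange)
  qed
  have coset_eq: "x +o C = y +o C \<longleftrightarrow> x - y \<in> C"
    if C: "0 \<in> C" "\<And>u v. u \<in> C \<Longrightarrow> v \<in> C \<Longrightarrow> u + v \<in> C" "\<And>u. u \<in> C \<Longrightarrow> - u \<in> C"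
    for x y and C :: "'u::ab_group_add set"
  proof
    assume "x +o C = y +o C"
    moreover have "x + 0 \<in> x +o C" using C(1) by (rule set_plus_intro2)
    ultimately have "x \<in> y +o C" by simp
    then show "x - y \<in> C" by (auto simp: elt_set_plus_def)
  next
    assume xy: "x - y \<in> C"
    have "\<exists>b\<in>C. x + u = y + b \<and> (\<exists>b\<in>C. y + u = x + b)" if "u \<in> C" for u
    proof (intro bexI conjI)
      show "x + u = y + (x - y + u)" "y + u = x + (- (x - y) + u)" by simp_all
    qed (use that C(2)[OF xy that] C(2)[OF C(3)[OF xy] that] in simp_all)
    then show "x +o C = y +o C" unfolding elt_set_plus_def by blast
  qed
  have p_coset: "p ` (x +o B) + B' = p x +o B'" for x
    using p B(1) B' by (intro coset_image) auto
  have s_coset: "s c ` (x +o B) + B = s c x +o B" for c x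
    using s B by (intro coset_image) auto
  have t_coset: "t c ` (x +o B') + B' = t c x +o B'" for c x
    using t B' by (intro coset_image) auto
  have "linear_on ((\<lambda>x. x +o B) ` Z) (\<lambda>c A. s c ` A + B) (\<lambda>c A. t c ` A + B') (\<lambda>A. p ` A + B')"
    unfolding linear_on_def
    by (auto simp: p_coset s_coset t_coset coset_add[OF B(1,2)] coset_add[OF B'(1,2)] p(1,2))
  moreover have "bij_betw (\<lambda>A. p ` A + B') ((\<lambda>x. x +o B) ` Z) ((\<lambda>x. x +o B') ` Z')"
  proof (rule bij_betw_imageI)
    have "p (x - y) = p x - p y" for x y
      using p(1)[of "x - y" y] by (simp add: algebra_simps)
    then show "inj_on (\<lambda>A. p ` A + B') ((\<lambda>x. x +o B) ` Z)"
      by (auto simp: inj_on_def p_coset coset_eq[OF B] coset_eq[OF B'] intro: inj)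
    show "(\<lambda>A. p ` A + B') ` (\<lambda>x. x +o B) ` Z = (\<lambda>x. x +o B') ` Z'"
    proof
      show "(\<lambda>A. p ` A + B') ` (\<lambda>x. x +o B) ` Z \<subseteq> (\<lambda>x. x +o B') ` Z'"
        using Z by (auto simp: p_coset)
      show "(\<lambda>x. x +o B') ` Z' \<subseteq> (\<lambda>A. p ` A + B') ` (\<lambda>x. x +o B) ` Z"
      proof
        fix A assume "A \<in> (\<lambda>x. x +o B') ` Z'"
        then obtain y where "y \<in> Z'" "A = y +o B'" by auto
        moreover from this surj obtain x where "x \<in> Z" "p x = y" by blast
        ultimately have "A = p ` (x +o B) + B'" "x \<in> Z" by (simp_all add: p_coset)
        then show "A \<in> (\<lambda>A. p ` A + B') ` (\<lambda>x. x +o B) ` Z" by blast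
      qed
    qed
  qed
  ultimately show ?thesis by (simp add: linear_iso_def)
qed

definition cochain_scale :: "'k::comm_ring_1 \<Rightarrow> ('k, 'v) cochain \<Rightarrow> ('k, 'v) cochain" where
  "cochain_scale c \<alpha> = (\<lambda>I z F. c * \<alpha> I z F)"

lemma cochain_scale_add: "cochain_scale c (\<alpha> + \<beta>) = cochain_scale c \<alpha> + cochain_scale c \<beta>"
  by (simp add: cochain_scale_def fun_eq_iff distrib_left)

lemma coboundary_add: "coboundary n X (\<alpha> + \<beta>) = coboundary n X \<alpha> + coboundary n X \<beta>"
proof -
  have "coface n X i (\<alpha> + \<beta>) I z F = coface n X i \<alpha> I z F + coface n X i \<beta> I z F" for i I z F
    by (simp add: coface_def cf_def)
  then show ?thesis
    by (simp add: coboundary_def fun_eq_iff sum.distrib distrib_left del: sum.atMost_Suc)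
qed

lemma coboundary_scale: "coboundary n X (cochain_scale c \<alpha>) = cochain_scale c (coboundary n X \<alpha>)"
proof -
  have "coface n X i (cochain_scale c \<alpha>) I z F = c * coface n X i \<alpha> I z F" for i I z F
    by (simp add: coface_def cf_def cochain_scale_def)
  then show ?thesis
    unfolding cochain_scale_def
    by (simp add: coboundary_def fun_eq_iff sum_distrib_left mult_ac del: sum.atMost_Suc)
qed

lemma minus_eq_cochain_scale: "- \<alpha> = cochain_scale (- 1) \<alpha>"
  by (simp add: cochain_scale_def fun_eq_iff)

lemma coboundary_minus: "coboundary n X (- \<alpha>) = - coboundary n X \<alpha>"
  by (simp only: minus_eq_cochain_scale coboundary_scale)

lemma coboundary_diff: "coboundary n X (\<alpha> - \<beta>) = coboundary n X \<alpha> - coboundary n X \<beta>"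
  by (simp only: diff_conv_add_uminus coboundary_add coboundary_minus)

context restriction_species
begin

lemma cochains_eq: "cochains n (linearize P) = of_coefficients P ` invariant_functions P n"
proof
  show "cochains n (linearize P) \<subseteq> of_coefficients P ` invariant_functions P n"
    using coefficients_closed of_coefficients_coefficients by (metis image_eqI subsetI)
qed (auto intro: of_coefficients_closed)

lemma cochains_zero_mem: "0 \<in> cochains n (linearize P)"
proof -
  have "(\<lambda>x. 0) \<in> invariant_functions P n" by (rule invariant_functionsI) simp_all
  then show ?thesis using of_coefficients_closed of_coefficients_zero by metis
qed

lemma cochains_add:
  assumes "\<alpha> \<in> cochains n (linearize P)" "\<beta> \<in> cochains n (linearize P)"
  shows "\<alpha> + \<beta> \<in> cochains n (linearize P)"
proof -
  obtain a b where "a \<in> invariant_functions P n" "b \<in> invariant_functions P n"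
    and ab: "\<alpha> = of_coefficients P a" "\<beta> = of_coefficients P b"
    using assms unfolding cochains_eq by blast
  then have "of_coefficients P (\<lambda>x. a x + b x) \<in> cochains n (linearize P)"
    by (intro of_coefficients_closed invariant_functions_add)
  also have "of_coefficients P (\<lambda>x. a x + b x) = \<alpha> + \<beta>"
    by (simp add: ab of_coefficients_def fun_eq_iff distrib_left sum.distrib)
  finally show ?thesis .
qed

lemma cochains_scale:
  assumes "\<alpha> \<in> cochains n (linearize P)"
  shows "cochain_scale c \<alpha> \<in> cochains n (linearize P)"
proof -
  obtain a where a: "a \<in> invariant_functions P n" "\<alpha> = of_coefficients P a"
    using assms unfolding cochains_eq by blast
  then have "(\<lambda>x. c * a x) \<in> invariant_functions P n"
    by (intro invariant_functionsI) (simp_all add: invariant_functions_zero invariant_functions_relabel)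
  then have "of_coefficients P (\<lambda>x. c * a x) \<in> cochains n (linearize P)"
    by (rule of_coefficients_closed)
  also have "of_coefficients P (\<lambda>x. c * a x) = cochain_scale c \<alpha>"
    by (simp add: a(2) of_coefficients_def cochain_scale_def fun_eq_iff sum_distrib_left mult_ac)
  finally show ?thesis .
qed

lemma cochains_minus: "\<alpha> \<in> cochains n (linearize P) \<Longrightarrow> - \<alpha> \<in> cochains n (linearize P)"
  by (simp only: minus_eq_cochain_scale cochains_scale)

lemma cochains_diff:
  "\<lbrakk>\<alpha> \<in> cochains n (linearize P); \<beta> \<in> cochains n (linearize P)\<rbrakk> \<Longrightarrow> \<alpha> - \<beta> \<in> cochains n (linearize P)"
  by (simp only: diff_conv_add_uminus cochains_add cochains_minus)

lemma coboundaries_zero: "0 \<in> coboundaries n (linearize P)"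
proof (cases n)
  case (Suc m)
  have "coboundary m (linearize P) 0 = 0" using coboundary_add[of m "linearize P" 0 0] by simp
  then show ?thesis using Suc cochains_zero_mem by (auto simp: coboundaries_def image_iff intro!: bexI)
qed (simp add: coboundaries_def)

lemma coboundaries_add:
  "\<lbrakk>\<alpha> \<in> coboundaries n (linearize P); \<beta> \<in> coboundaries n (linearize P)\<rbrakk>
    \<Longrightarrow> \<alpha> + \<beta> \<in> coboundaries n (linearize P)"
  by (auto simp: coboundaries_def simp flip: coboundary_add intro: cochains_add split: nat.splits)

lemma coboundaries_scale:
  "\<alpha> \<in> coboundaries n (linearize P) \<Longrightarrow> cochain_scale c \<alpha> \<in> coboundaries n (linearize P)"
proof (cases n)
  case (Suc m)
  assume "\<alpha> \<in> coboundaries n (linearize P)"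
  then show ?thesis using Suc
    by (auto simp: coboundaries_def cochains_scale simp flip: coboundary_scale)
qed (simp add: coboundaries_def cochain_scale_def fun_eq_iff)

lemma coboundaries_minus:
  "\<alpha> \<in> coboundaries n (linearize P) \<Longrightarrow> - \<alpha> \<in> coboundaries n (linearize P)"
  by (simp only: minus_eq_cochain_scale coboundaries_scale)

end

abbreviation pull :: "('k::comm_ring_1, nat set list \<Rightarrow> 'k) cochain \<Rightarrow> ('k, nat list \<Rightarrow> 'k) cochain" where
  "pull \<equiv> pullback LL L_to_C"

lemma L_to_C_basis_vec:
  assumes "finite I" "xs \<in> str Lin I"
  shows "L_to_C I (basis_vec xs) = basis_vec (singletons xs)"
  using assms Lin.finite_str[of I]
  by (simp add: L_to_C_def Lin.obj_linearize basis_vec_in_free_module lin_ext_basis_vec)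

lemma L_to_C_linear:
  fixes z :: "nat list \<Rightarrow> 'k::comm_ring_1"
  assumes "finite I"
  shows "linear_on (free_module (str Lin I)) fscale fscale (L_to_C I :: (nat list \<Rightarrow> 'k) \<Rightarrow> _)"
    and "z \<in> free_module (str Lin I) \<Longrightarrow> L_to_C I z \<in> free_module (str Comp I)"
proof -
  have "(L_to_C :: _ \<Rightarrow> (nat list \<Rightarrow> 'k) \<Rightarrow> _) \<in> species_hom LL CC" by (rule L_to_C_hom)
  then show "linear_on (free_module (str Lin I)) fscale fscale (L_to_C I :: (nat list \<Rightarrow> 'k) \<Rightarrow> _)"
    "z \<in> free_module (str Lin I) \<Longrightarrow> L_to_C I z \<in> free_module (str Comp I)"
    using assms
    by (simp_all add: species_hom_def Lin.obj_linearize Comp.obj_linearize Lin.scal_linearize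
        Comp.scal_linearize image_subset_iff)
qed

lemma pull_coefficients:
  fixes \<alpha> :: "('k::comm_ring_1, nat set list \<Rightarrow> 'k) cochain"
  assumes \<alpha>: "\<alpha> \<in> cochains n CC"
  shows "pull \<alpha> = of_coefficients Lin (pull_singletons n (coefficients \<alpha>))"
proof (intro ext)
  fix I z and F :: "nat set list"
  show "pull \<alpha> I z F = of_coefficients Lin (pull_singletons n (coefficients \<alpha>)) I z F"
  proof (cases "finite I \<and> z \<in> free_module (str Lin I)")
    case True
    show ?thesis
    proof (cases "ground F = I")
      case U: True
      have "linear_on (free_module (str Lin I)) fscale (*) (\<lambda>z. \<alpha> I (L_to_C I z) F)"
        using Comp.cochains_linear[OF \<alpha>, of I] L_to_C_linear[where 'k = 'k, of I] True
        by (auto simp: linear_on_def fscale_def)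
      then have "\<alpha> I (L_to_C I z) F = (\<Sum>xs\<in>str Lin I. z xs * \<alpha> I (L_to_C I (basis_vec xs)) F)"
        using True Lin.finite_str[of I] by (intro linear_on_free_module_expand) simp_all
      also have "\<dots> = (\<Sum>xs\<in>str Lin I. z xs * pull_singletons n (coefficients \<alpha>) (F, xs))"
        unfolding pull_singletons_apply[OF Comp.coefficients_closed[OF \<alpha>]]
        using True U by (intro sum.cong) (simp_all add: L_to_C_basis_vec coefficients_def cf_def)
      finally show ?thesis using True U by (simp add: pullback_def of_coefficients_def Lin.obj_linearize)
    next
      case False
      then show ?thesis
        using Comp.cochains_zero[OF \<alpha>, of I _ F]
        by (simp add: pullback_def of_coefficients_def decompositions_iff)
    qed
  next
    case False
    then show ?thesis by (auto simp: pullback_def of_coefficients_def Lin.obj_linearize)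
  qed
qed

lemma pull_closed: "\<alpha> \<in> cochains n CC \<Longrightarrow> pull \<alpha> \<in> cochains n LL"
  by (simp add: pull_coefficients Lin.of_coefficients_closed pull_singletons_closed
      Comp.coefficients_closed)

lemma coefficients_pull:
  "\<alpha> \<in> cochains n CC \<Longrightarrow> coefficients (pull \<alpha>) = pull_singletons n (coefficients \<alpha>)"
  by (simp add: pull_coefficients Lin.coefficients_of_coefficients[OF pull_singletons_closed]
      Comp.coefficients_closed)

lemma pull_coboundary:
  assumes \<alpha>: "\<alpha> \<in> cochains n CC"
  shows "pull (coboundary n CC \<alpha>) = coboundary n LL (pull \<alpha>)"
  unfolding pull_coefficients[OF Comp.coboundary_closed[OF \<alpha>]]
    Lin.coboundary_coefficients[OF pull_closed[OF \<alpha>]]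
    Comp.coefficients_coboundary[OF \<alpha>] coefficients_pull[OF \<alpha>]
    pull_singletons_diff[OF Comp.coefficients_closed[OF \<alpha>]] ..

lemma pull_surjective:
  assumes \<beta>: "\<beta> \<in> cochains n LL"
  obtains \<alpha> where "\<alpha> \<in> cochains n CC" "pull \<alpha> = \<beta>"
proof
  let ?a = "extend_by_zero n (coefficients \<beta>)"
  have a: "?a \<in> invariant_functions Comp n"
    by (rule extend_by_zero_closed[OF Lin.coefficients_closed[OF \<beta>]])
  show \<alpha>: "of_coefficients Comp ?a \<in> cochains n CC"
    by (rule Comp.of_coefficients_closed[OF a])
  show "pull (of_coefficients Comp ?a) = \<beta>"
    unfolding pull_coefficients[OF \<alpha>] Comp.coefficients_of_coefficients[OF a]
      pull_singletons_extend_by_zero[OF Lin.coefficients_closed[OF \<beta>]]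
    by (rule Lin.of_coefficients_coefficients[OF \<beta>])
qed

lemma coefficients_zero: "coefficients 0 = (\<lambda>x. 0)"
  by (auto simp: coefficients_def cf_def)

lemma coefficients_relative:
  assumes "\<alpha> \<in> cochains n CC" "pull \<alpha> = 0"
  shows "coefficients \<alpha> \<in> relative_functions n"
  unfolding relative_functions_iff[OF Comp.coefficients_closed[OF assms(1)]]
  using coefficients_pull[OF assms(1)] by (simp add: assms(2) coefficients_zero)

lemma pull_kernel_acyclic:
  assumes \<alpha>: "\<alpha> \<in> cochains (Suc m) CC" "coboundary (Suc m) CC \<alpha> = 0" "pull \<alpha> = 0"
  obtains \<gamma> where "\<gamma> \<in> cochains m CC" "pull \<gamma> = 0" "coboundary m CC \<gamma> = \<alpha>"
proof -
  have "simplicial_diff Comp (Suc m) (coefficients \<alpha>) = (\<lambda>x. 0)"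
    using Comp.coefficients_coboundary[OF \<alpha>(1)] by (simp add: \<alpha>(2) coefficients_zero)
  then obtain c where c: "c \<in> relative_functions m" "simplicial_diff Comp m c = coefficients \<alpha>"
    using relative_complex_acyclic[OF coefficients_relative[OF \<alpha>(1,3)]] by blast
  then have c_inv: "c \<in> invariant_functions Comp m" by (simp add: relative_functions_def)
  have \<gamma>: "of_coefficients Comp c \<in> cochains m CC" by (rule Comp.of_coefficients_closed[OF c_inv])
  moreover have "pull (of_coefficients Comp c) = 0"
    using c(1) unfolding pull_coefficients[OF \<gamma>] Comp.coefficients_of_coefficients[OF c_inv]
      relative_functions_iff[OF c_inv] by (simp add: Lin.of_coefficients_zero)
  moreover have "coboundary m CC (of_coefficients Comp c) = \<alpha>"
    unfolding Comp.coboundary_coefficients[OF \<gamma>] Comp.coefficients_of_coefficients[OF c_inv] c(2)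
    by (rule Comp.of_coefficients_coefficients[OF \<alpha>(1)])
  ultimately show thesis by (rule that)
qed

text \<open>
  In degree \<open>0\<close> the only decomposition is the empty one, over the empty set, and the only composition
  of the empty set comes from a linear order.
\<close>
lemma pull_kernel_degree_0:
  assumes \<alpha>: "\<alpha> \<in> cochains 0 CC" "pull \<alpha> = 0"
  shows "\<alpha> = 0"
proof -
  have a: "coefficients \<alpha> \<in> relative_functions 0" using \<alpha> by (rule coefficients_relative)
  have "coefficients \<alpha> x = 0" for x
  proof (cases "x \<in> simplices Comp 0")
    case True
    then obtain G where G: "x = ([], G)" "G \<in> compositions {}"
      by (cases x) (auto simp: simplices_iff Comp_def)
    then have "G = singletons []" by (cases G) (auto simp: compositions_iff)
    then show ?thesis using a by (simp only: G relative_functions_def mem_Collect_eq)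
  next
    case False
    then show ?thesis by (rule invariant_functions_zero[OF Comp.coefficients_closed[OF \<alpha>(1)]])
  qed
  then have "coefficients \<alpha> = (\<lambda>x. 0)" by blast
  then show ?thesis
    using Comp.of_coefficients_coefficients[OF \<alpha>(1)] by (simp add: Comp.of_coefficients_zero)
qed

lemma pull_add: "pull (\<alpha> + \<beta>) = pull \<alpha> + pull \<beta>"
  by (simp add: pullback_def fun_eq_iff)

lemma pull_scale: "pull (cochain_scale c \<alpha>) = cochain_scale c (pull \<alpha>)"
  by (simp add: pullback_def cochain_scale_def fun_eq_iff)

lemma pull_diff: "pull (\<alpha> - \<beta>) = pull \<alpha> - pull \<beta>"
  by (simp add: pullback_def fun_eq_iff)

text \<open>
  The part of the long exact sequence that is needed, spelled out. Injectivity: if a cocycle restricts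
  to a coboundary, correct it by the coboundary of a lift and apply acyclicity to the difference.
  Surjectivity: lift a cocycle to a cochain \<open>\<eta>\<close>; its coboundary restricts to zero, hence is the
  coboundary of some \<open>\<epsilon>\<close> that restricts to zero, and \<open>\<eta> - \<epsilon>\<close> is the cocycle wanted.
\<close>
lemma cohomology_map_iso:
  "linear_iso (cohomology n (CC :: ('k::comm_ring_1, nat set list \<Rightarrow> 'k) bicomodule)) (class_scale n CC)
     (cohomology n (LL :: ('k, nat list \<Rightarrow> 'k) bicomodule)) (class_scale n LL)
     (cohomology_map n LL L_to_C)"
proof -
  have scale_eq: "class_scale n X = (\<lambda>c A. cochain_scale c ` A + coboundaries n X)" for X :: "('k, 'w::ab_group_add) bicomodule"
    by (simp add: class_scale_def cochain_scale_def fun_eq_iff)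
  have map_eq: "cohomology_map n LL L_to_C = (\<lambda>A. pull ` A + coboundaries n LL)"
    by (simp add: cohomology_map_def fun_eq_iff)
  have pull_cocycle: "pull \<alpha> \<in> cocycles n LL" if "\<alpha> \<in> cocycles n CC" for \<alpha> :: "('k, _) cochain"
  proof -
    have "\<alpha> \<in> cochains n CC" "coboundary n CC \<alpha> = 0" using that by (simp_all add: cocycles_def)
    then show ?thesis
      using pull_coboundary[of \<alpha> n] pull_add[of 0 "0 :: ('k, _) cochain"] by (simp add: cocycles_def pull_closed)
  qed
  have cocycle_diff: "\<alpha> - \<beta> \<in> cocycles n CC" if "\<alpha> \<in> cocycles n CC" "\<beta> \<in> cocycles n CC"
    for \<alpha> \<beta> :: "('k, _) cochain"
    using that by (simp add: cocycles_def Comp.cochains_diff coboundary_diff)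
  have injective: "\<alpha> \<in> coboundaries n CC"
    if cocycle: "\<alpha> \<in> cocycles n CC" and pull: "pull \<alpha> \<in> coboundaries n LL" for \<alpha> :: "('k, _) cochain"
  proof (cases n)
    case 0
    then show ?thesis using that by (auto simp: coboundaries_def cocycles_def intro: pull_kernel_degree_0)
  next
    case (Suc m)
    have \<alpha>: "\<alpha> \<in> cochains (Suc m) CC" "coboundary (Suc m) CC \<alpha> = 0"
      using cocycle by (simp_all add: cocycles_def Suc)
    obtain \<gamma> where \<gamma>: "\<gamma> \<in> cochains m LL" "pull \<alpha> = coboundary m LL \<gamma>"
      using pull by (auto simp: coboundaries_def Suc)
    obtain \<eta> where \<eta>: "\<eta> \<in> cochains m CC" "pull \<eta> = \<gamma>" by (rule pull_surjective[OF \<gamma>(1)])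
    let ?\<beta> = "\<alpha> - coboundary m CC \<eta>"
    have "?\<beta> \<in> cochains (Suc m) CC"
      using \<alpha>(1) \<eta>(1) by (intro Comp.cochains_diff Comp.coboundary_closed)
    moreover have "coboundary (Suc m) CC ?\<beta> = 0"
      by (simp only: coboundary_diff \<alpha>(2) Comp.coboundary_coboundary[OF \<eta>(1)] diff_zero)
    moreover have "pull ?\<beta> = 0" by (simp only: pull_diff pull_coboundary[OF \<eta>(1)] \<eta>(2) \<gamma>(2) diff_self)
    ultimately obtain \<epsilon> where \<epsilon>: "\<epsilon> \<in> cochains m CC" "coboundary m CC \<epsilon> = ?\<beta>"
      by (rule pull_kernel_acyclic)
    have "\<alpha> = coboundary m CC (\<epsilon> + \<eta>)" by (simp add: coboundary_add \<epsilon>(2))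
    then show ?thesis using \<epsilon>(1) \<eta>(1) by (simp add: coboundaries_def Suc Comp.cochains_add)
  qed
  have surjective: "\<exists>\<alpha>\<in>cocycles n CC. pull \<alpha> = \<beta>" if "\<beta> \<in> cocycles n LL" for \<beta> :: "('k, _) cochain"
  proof -
    have \<beta>: "\<beta> \<in> cochains n LL" "coboundary n LL \<beta> = 0" using that by (simp_all add: cocycles_def)
    obtain \<eta> where \<eta>: "\<eta> \<in> cochains n CC" "pull \<eta> = \<beta>" by (rule pull_surjective[OF \<beta>(1)])
    have "pull (coboundary n CC \<eta>) = 0" by (simp only: pull_coboundary[OF \<eta>(1)] \<eta>(2) \<beta>(2))
    then obtain \<epsilon> where \<epsilon>: "\<epsilon> \<in> cochains n CC" "pull \<epsilon> = 0" "coboundary n CC \<epsilon> = coboundary n CC \<eta>"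
      by (rule pull_kernel_acyclic[OF Comp.coboundary_closed[OF \<eta>(1)] Comp.coboundary_coboundary[OF \<eta>(1)]])
    have "\<eta> - \<epsilon> \<in> cocycles n CC"
      using \<eta>(1) \<epsilon>(1) by (simp add: cocycles_def Comp.cochains_diff coboundary_diff \<epsilon>(3))
    moreover have "pull (\<eta> - \<epsilon>) = \<beta>" by (simp add: pull_diff \<eta>(2) \<epsilon>(2))
    ultimately show ?thesis by blast
  qed
  have pull_coboundaries: "pull \<alpha> \<in> coboundaries n LL" if "\<alpha> \<in> coboundaries n CC" for \<alpha> :: "('k, _) cochain"
  proof (cases n)
    case 0
    then show ?thesis using that pull_add[of 0 "0 :: ('k, _) cochain"] by (simp add: coboundaries_def)
  next
    case (Suc m)
    then show ?thesis using that by (auto simp: coboundaries_def pull_coboundary pull_closed)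
  qed
  show ?thesis
    unfolding cohomology_def scale_eq map_eq
    by (rule linear_iso_quotients)
      (assumption | rule cochain_scale_add Comp.coboundaries_zero Comp.coboundaries_add
        Comp.coboundaries_minus Comp.coboundaries_scale Lin.coboundaries_zero Lin.coboundaries_add
        Lin.coboundaries_minus Lin.coboundaries_scale pull_add pull_scale pull_coboundaries
        pull_cocycle surjective cocycle_diff | rule injective)+
qed

section \<open>Signs of relabellings\<close>

text \<open>The ground sets \<open>{1..p}\<close> of alternating forms are to stay in this form under simplification.\<close>
declare One_nat_def [simp del]

definition pairs :: "nat set \<Rightarrow> nat set set" where
  "pairs S = {A. A \<subseteq> S \<and> card A = 2}"

text \<open>
  Used for two-element sets \<open>A\<close> and \<open>\<sigma>\<close> injective on \<open>A\<close>: the sign says whether \<open>\<sigma>\<close> keeps or reverses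
  the order of the two elements.
\<close>
definition pair_sign :: "(nat \<Rightarrow> nat) \<Rightarrow> nat set \<Rightarrow> int" where
  "pair_sign \<sigma> A = (if \<forall>x\<in>A. \<forall>y\<in>A. x < y \<longrightarrow> \<sigma> x < \<sigma> y then 1 else - 1)"

text \<open>
  The parity of the number of inversions of a bijection \<open>S \<rightarrow> \<sigma> ` S\<close> between sets of numbers. A
  product over subsets rather than over ordered pairs is multiplicative by mere reindexing.
\<close>
definition reorder_sign :: "(nat \<Rightarrow> nat) \<Rightarrow> nat set \<Rightarrow> int" where
  "reorder_sign \<sigma> S = (\<Prod>A\<in>pairs S. pair_sign \<sigma> A)"

lemma finite_pairs: "finite S \<Longrightarrow> finite (pairs S)"
  by (simp add: pairs_def)

lemma pair_sign_insert: "x < y \<Longrightarrow> pair_sign \<sigma> {x, y} = (if \<sigma> x < \<sigma> y then 1 else - 1)"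
  by (auto simp: pair_sign_def)

lemma pair_sign_neq:
  assumes "x \<noteq> y" "\<sigma> x \<noteq> \<sigma> y"
  shows "pair_sign \<sigma> {x, y} = (if x > y then - 1 else 1) * (if \<sigma> x > \<sigma> y then - 1 else 1)"
  using assms by (auto simp: pair_sign_def)

lemma pairsE:
  assumes "A \<in> pairs S"
  obtains x y where "A = {x, y}" "x < y" "x \<in> S" "y \<in> S"
proof -
  obtain x y where "A = {x, y}" "x \<noteq> y" using assms by (auto simp: pairs_def card_2_iff)
  moreover from this assms have "x \<in> S" "y \<in> S" by (auto simp: pairs_def)
  ultimately show thesis using that[of x y] that[of y x] by (cases "x < y") (auto simp: insert_commute)
qed

lemma reorder_sign_comp:
  assumes "inj_on \<sigma> S" "inj_on \<tau> (\<sigma> ` S)"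
  shows "reorder_sign (\<tau> \<circ> \<sigma>) S = reorder_sign \<tau> (\<sigma> ` S) * reorder_sign \<sigma> S"
proof -
  have bij: "bij_betw ((`) \<sigma>) (pairs S) (pairs (\<sigma> ` S))"
  proof (rule bij_betw_imageI)
    show "inj_on ((`) \<sigma>) (pairs S)"
      using inj_on_image_Pow[OF assms(1)] by (rule inj_on_subset) (auto simp: pairs_def)
    show "(`) \<sigma> ` pairs S = pairs (\<sigma> ` S)"
    proof
      show "(`) \<sigma> ` pairs S \<subseteq> pairs (\<sigma> ` S)"
        using assms(1) by (auto simp: pairs_def card_image[OF inj_on_subset])
      show "pairs (\<sigma> ` S) \<subseteq> (`) \<sigma> ` pairs S"
      proof
        fix A assume A: "A \<in> pairs (\<sigma> ` S)"
        then obtain B where "B \<subseteq> S" "A = \<sigma> ` B" by (auto simp: pairs_def subset_image_iff)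
        moreover from this have "card B = 2"
          using A assms(1) by (simp add: pairs_def card_image[OF inj_on_subset])
        ultimately show "A \<in> (`) \<sigma> ` pairs S" by (auto simp: pairs_def)
      qed
    qed
  qed
  have "pair_sign (\<tau> \<circ> \<sigma>) A = pair_sign \<tau> (\<sigma> ` A) * pair_sign \<sigma> A" if pair: "A \<in> pairs S" for A
  proof -
    obtain x y where A: "A = {x, y}" "x < y" "x \<in> S" "y \<in> S" using pair by (rule pairsE)
    have "\<sigma> x \<noteq> \<sigma> y" using A assms(1) by (auto dest: inj_onD)
    moreover from this have "\<tau> (\<sigma> x) \<noteq> \<tau> (\<sigma> y)" using A assms(2) by (auto dest: inj_onD)
    ultimately show ?thesis
      using A by (simp add: pair_sign_neq)
  qed
  then have "reorder_sign (\<tau> \<circ> \<sigma>) S = (\<Prod>A\<in>pairs S. pair_sign \<tau> (\<sigma> ` A)) * reorder_sign \<sigma> S"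
    by (simp add: reorder_sign_def prod.distrib)
  also have "(\<Prod>A\<in>pairs S. pair_sign \<tau> (\<sigma> ` A)) = reorder_sign \<tau> (\<sigma> ` S)"
    unfolding reorder_sign_def by (rule prod.reindex_bij_betw[OF bij])
  finally show ?thesis .
qed

lemma reorder_sign_mono:
  assumes "strict_mono_on S \<sigma>"
  shows "reorder_sign \<sigma> S = 1"
  unfolding reorder_sign_def
proof (rule prod.neutral, rule ballI)
  fix A assume "A \<in> pairs S"
  then obtain x y where "A = {x, y}" "x < y" "x \<in> S" "y \<in> S" by (rule pairsE)
  then show "pair_sign \<sigma> A = 1" using strict_mono_onD[OF assms] by (simp add: pair_sign_insert)
qed

lemma reorder_sign_cong:
  assumes "\<And>x. x \<in> S \<Longrightarrow> \<sigma> x = \<tau> x"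
  shows "reorder_sign \<sigma> S = reorder_sign \<tau> S"
  unfolding reorder_sign_def
proof (rule prod.cong[OF refl])
  fix A assume "A \<in> pairs S"
  then have "A \<subseteq> S" by (simp add: pairs_def)
  then show "pair_sign \<sigma> A = pair_sign \<tau> A" using assms by (auto simp: pair_sign_def subset_iff)
qed

lemma sch_sign_image:
  assumes "finite S" "finite T" "inj_on \<sigma> (S \<union> T)"
  shows "(- 1 :: int) ^ sch (\<sigma> ` S) (\<sigma> ` T) = (\<Prod>(s, t)\<in>S \<times> T. if \<sigma> s > \<sigma> t then - 1 else 1)"
proof -
  let ?M = "{x \<in> S \<times> T. \<sigma> (fst x) > \<sigma> (snd x)}"
  have "{(s, t) \<in> \<sigma> ` S \<times> \<sigma> ` T. s > t} = map_prod \<sigma> \<sigma> ` ?M" by force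
  moreover have "inj_on (map_prod \<sigma> \<sigma>) ?M"
    using assms(3) by (auto simp: inj_on_def)
  ultimately have "sch (\<sigma> ` S) (\<sigma> ` T) = card ?M" by (simp add: sch_def card_image)
  then have "(- 1 :: int) ^ sch (\<sigma> ` S) (\<sigma> ` T) = (\<Prod>x\<in>?M. - 1)" by simp
  also have "\<dots> = (\<Prod>x\<in>S \<times> T. if \<sigma> (fst x) > \<sigma> (snd x) then - 1 else 1)"
    using assms(1,2) by (intro prod.inter_filter) simp
  finally show ?thesis by (simp add: case_prod_unfold)
qed

text \<open>
  A two-element subset of \<open>S \<union> T\<close> lies in \<open>S\<close>, lies in \<open>T\<close>, or has one element in each. A mixed pair
  is reversed iff it is an inversion of \<open>(S, T)\<close> before or after relabelling, but not both.
\<close>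
lemma reorder_sign_Un:
  assumes "finite S" "finite T" "S \<inter> T = {}" "inj_on \<sigma> (S \<union> T)"
  shows "reorder_sign \<sigma> (S \<union> T)
    = reorder_sign \<sigma> S * reorder_sign \<sigma> T * (- 1) ^ sch S T * (- 1) ^ sch (\<sigma> ` S) (\<sigma> ` T)"
proof -
  let ?C = "(\<lambda>(s, t). {s, t}) ` (S \<times> T)"
  have "pairs (S \<union> T) \<subseteq> pairs S \<union> pairs T \<union> ?C"
  proof
    fix A assume "A \<in> pairs (S \<union> T)"
    then obtain x y where A: "A = {x, y}" "x < y" "x \<in> S \<union> T" "y \<in> S \<union> T" by (rule pairsE)
    then consider "x \<in> S" "y \<in> S" | "x \<in> T" "y \<in> T" | "x \<in> S" "y \<in> T" | "y \<in> S" "x \<in> T" by blast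
    then show "A \<in> pairs S \<union> pairs T \<union> ?C"
      using A by cases (auto simp: pairs_def insert_commute)
  qed
  moreover have "pairs S \<union> pairs T \<union> ?C \<subseteq> pairs (S \<union> T)"
    using assms(3) by (auto simp: pairs_def card_insert_if)
  ultimately have pairs: "pairs (S \<union> T) = pairs S \<union> pairs T \<union> ?C" by blast
  have disj: "pairs S \<inter> pairs T = {}" "(pairs S \<union> pairs T) \<inter> ?C = {}"
    using assms(3) by (auto simp: pairs_def card_2_iff)
  have "inj_on (\<lambda>(s, t). {s, t}) (S \<times> T)"
    using assms(3) by (auto simp: inj_on_def doubleton_eq_iff)
  then have "(\<Prod>A\<in>?C. pair_sign \<sigma> A) = (\<Prod>(s, t)\<in>S \<times> T. pair_sign \<sigma> {s, t})"
    by (subst prod.reindex) (simp_all add: case_prod_unfold)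
  also have "\<dots> = (\<Prod>(s, t)\<in>S \<times> T. (if s > t then - 1 else 1) * (if \<sigma> s > \<sigma> t then - 1 else 1))"
  proof (rule prod.cong[OF refl], clarify)
    fix s t assume "s \<in> S" "t \<in> T"
    moreover from this have "s \<noteq> t" using assms(3) by auto
    ultimately show "pair_sign \<sigma> {s, t} = (if s > t then - 1 else 1) * (if \<sigma> s > \<sigma> t then - 1 else 1)"
      using assms(4) by (intro pair_sign_neq) (auto dest: inj_onD)
  qed
  also have "\<dots> = (- 1) ^ sch S T * (- 1) ^ sch (\<sigma> ` S) (\<sigma> ` T)"
    using sch_sign_image[of S T id] sch_sign_image[of S T \<sigma>] assms
    by (simp add: case_prod_unfold prod.distrib)
  finally show ?thesis
    unfolding reorder_sign_def pairs using disj assms(1,2)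
    by (simp add: prod.union_disjoint finite_pairs)
qed

text \<open>
  Split \<open>S\<close> into \<open>{a, b}\<close> and the rest: the transposition maps both parts to themselves, so the two
  factors counting mixed inversions are equal and cancel.
\<close>
lemma reorder_sign_transpose:
  assumes "finite S" "a \<in> S" "b \<in> S" "a \<noteq> b"
  shows "reorder_sign (Transposition.transpose a b) S = - 1"
proof -
  let ?\<tau> = "Transposition.transpose a b" and ?T = "S - {a, b}"
  have "?\<tau> ` {a, b} = {a, b}" by auto
  moreover have "?\<tau> ` ?T = ?T" by (simp add: transpose_image_eq)
  moreover have "reorder_sign ?\<tau> ?T = 1"
    by (rule reorder_sign_mono) (auto simp: strict_mono_on_def Transposition.transpose_def)
  moreover have "pairs {a, b} = {{a, b}}"
  proof
    show "pairs {a, b} \<subseteq> {{a, b}}" by (auto elim!: pairsE)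
  qed (use assms(4) in \<open>auto simp: pairs_def\<close>)
  then have "reorder_sign ?\<tau> {a, b} = - 1"
    using assms(4) by (simp add: reorder_sign_def pair_sign_neq)
  moreover have "reorder_sign ?\<tau> ({a, b} \<union> ?T) = reorder_sign ?\<tau> {a, b} * reorder_sign ?\<tau> ?T
      * (- 1) ^ sch {a, b} ?T * (- 1) ^ sch (?\<tau> ` {a, b}) (?\<tau> ` ?T)"
    using assms by (intro reorder_sign_Un inj_on_transpose) auto
  moreover have "{a, b} \<union> ?T = S" using assms by auto
  ultimately show ?thesis by (simp flip: power_add mult_2)
qed

lemma sign_eq_reorder_sign:
  assumes "finite S" "\<sigma> permutes S"
  shows "sign \<sigma> = reorder_sign \<sigma> S"
  using assms
proof (induction rule: permutes_rev_induct)
  case id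
  then show ?case by (simp add: reorder_sign_mono strict_mono_on_def)
next
  case (swap a b p)
  have "permutation p" using swap.hyps assms(1) by (auto simp: permutation_permutes)
  moreover have "reorder_sign (p \<circ> Transposition.transpose a b) S
      = reorder_sign p S * reorder_sign (Transposition.transpose a b) S"
    using reorder_sign_comp[of "Transposition.transpose a b" S p] swap.hyps
    by (simp add: transpose_image_eq permutes_inj_on)
  moreover have "sign (p \<circ> Transposition.transpose a b) = sign p * sign (Transposition.transpose a b)"
    using calculation(1) permutation_swap_id by (rule sign_compose)
  ultimately show ?case
    using swap.IH swap.hyps(3)
    by (simp only: sign_swap_id reorder_sign_transpose[OF assms(1) swap.hyps(1-3)] if_False)
qed

lemma std_strict_mono:
  assumes "finite S"
  shows "strict_mono_on S (std S)"
proof (rule strict_mono_onI)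
  fix s t assume "s \<in> S" "t \<in> S" "s < t"
  then have "{x \<in> S. x \<le> s} \<subseteq> {x \<in> S. x \<le> t}"
    "t \<in> {x \<in> S. x \<le> t}" "t \<notin> {x \<in> S. x \<le> s}" by auto
  then have "{x \<in> S. x \<le> s} \<subset> {x \<in> S. x \<le> t}" by blast
  then show "std S s < std S t" unfolding std_def by (rule psubset_card_mono[rotated]) (simp add: assms)
qed

lemma inj_on_std: "finite S \<Longrightarrow> inj_on (std S) S"
  by (rule strict_mono_on_imp_inj_on[OF std_strict_mono])

lemma std_image:
  assumes "finite S"
  shows "std S ` S = {1..card S}"
proof (rule card_subset_eq)
  show "std S ` S \<subseteq> {1..card S}"
  proof (rule image_subsetI)
    fix s assume "s \<in> S"
    then have "0 < card {x \<in> S. x \<le> s}" using assms by (auto simp: card_gt_0_iff)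
    moreover have "card {x \<in> S. x \<le> s} \<le> card S" using assms by (intro card_mono) auto
    ultimately show "std S s \<in> {1..card S}" by (simp add: std_def)
  qed
  show "card (std S ` S) = card {1..card S}"
    using assms by (simp add: card_image inj_on_std)
qed simp

lemma std_initial: "s \<in> {1..n} \<Longrightarrow> std {1..n} s = s"
proof -
  assume "s \<in> {1..n}"
  then have "{x \<in> {1..n}. x \<le> s} = {1..s}" by auto
  then show ?thesis by (simp add: std_def)
qed


section \<open>The product of alternating forms\<close>

definition splits :: "nat \<Rightarrow> nat \<Rightarrow> nat set \<Rightarrow> (nat set \<times> nat set) set" where
  "splits p q I = {(S, T). S \<union> T = I \<and> S \<inter> T = {} \<and> card S = p \<and> card T = q}"

lemma splitsD:
  assumes "(S, T) \<in> splits p q I" "finite I"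
  shows "S \<union> T = I" "S \<inter> T = {}" "card S = p" "card T = q" "S \<subseteq> I" "T \<subseteq> I" "finite S" "finite T"
proof -
  show ST: "S \<union> T = I" "S \<inter> T = {}" "card S = p" "card T = q"
    using assms(1) by (simp_all add: splits_def)
  then show "S \<subseteq> I" "T \<subseteq> I" by auto
  then show "finite S" "finite T" using assms(2) by (simp_all add: finite_subset)
qed

lemma finite_splits: "finite I \<Longrightarrow> finite (splits p q I)"
  by (rule finite_subset[of _ "Pow I \<times> Pow I"]) (auto simp: splits_def)

text \<open>
  A form on structures over \<open>{1..p}\<close> extended to all sets of size \<open>p\<close> by standardisation.
\<close>
definition extend_form :: "'b set_species \<Rightarrow> (('b \<Rightarrow> 'k::comm_ring_1) \<Rightarrow> 'k) \<Rightarrow> nat set \<Rightarrow> 'b \<Rightarrow> 'k" where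
  "extend_form P f S b = f (basis_vec (relabel P (std S) b))"

text \<open>
  The product formula on an arbitrary finite set; on \<open>{1..p + q}\<close> it is the given product
  (\<open>cup_basis_vec\<close>). In this generality it can be iterated without standardising in between.
\<close>
definition shuffle_product :: "'b set_species \<Rightarrow> nat \<Rightarrow> nat \<Rightarrow> (('b \<Rightarrow> 'k::comm_ring_1) \<Rightarrow> 'k)
    \<Rightarrow> (('b \<Rightarrow> 'k) \<Rightarrow> 'k) \<Rightarrow> nat set \<Rightarrow> 'b \<Rightarrow> 'k" where
  "shuffle_product P p q f g I b = (\<Sum>(S, T)\<in>splits p q I. (- 1) ^ sch S T *
     extend_form P f S (restrict_str P S b) * extend_form P g T (restrict_str P T b))"

definition linear_form :: "'b set_species \<Rightarrow> nat \<Rightarrow> ('b \<Rightarrow> 'k::comm_ring_1) \<Rightarrow> ('b \<Rightarrow> 'k) \<Rightarrow> 'k" where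
  "linear_form P p h v = (if v \<in> free_module (str P {1..p}) then \<Sum>b\<in>str P {1..p}. v b * h b else 0)"

lemma sch_Un_left:
  assumes "finite S" "finite T" "finite U" "S \<inter> T = {}"
  shows "sch (S \<union> T) U = sch S U + sch T U"
proof -
  have "{(s, t) \<in> (S \<union> T) \<times> U. s > t} = {(s, t) \<in> S \<times> U. s > t} \<union> {(s, t) \<in> T \<times> U. s > t}" by auto
  moreover have "finite {(s, t) \<in> R \<times> U. s > t}" if "finite R" for R
    using that assms(3) by (rule finite_subset[rotated, OF finite_cartesian_product]) auto
  ultimately show ?thesis unfolding sch_def using assms by (auto intro!: card_Un_disjoint)
qed

lemma sch_Un_right:
  assumes "finite S" "finite T" "finite U" "T \<inter> U = {}"
  shows "sch S (T \<union> U) = sch S T + sch S U"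
proof -
  have "{(s, t) \<in> S \<times> (T \<union> U). s > t} = {(s, t) \<in> S \<times> T. s > t} \<union> {(s, t) \<in> S \<times> U. s > t}" by auto
  moreover have "finite {(s, t) \<in> S \<times> R. s > t}" if "finite R" for R
    using assms(1) that by (rule finite_subset[rotated, OF finite_cartesian_product]) auto
  ultimately show ?thesis unfolding sch_def using assms by (auto intro!: card_Un_disjoint)
qed

text \<open>
  Every pair in \<open>S \<times> T\<close> is an inversion for exactly one of the two orders of the factors.
\<close>
lemma sch_swap:
  assumes "finite S" "finite T" "S \<inter> T = {}"
  shows "sch S T + sch T S = card S * card T"
proof -
  have "sch T S = card {(s, t) \<in> S \<times> T. s < t}"
    unfolding sch_def by (rule bij_betw_same_card[of prod.swap]) (auto simp: bij_betw_def inj_on_def image_iff)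
  moreover have "card ({(s, t) \<in> S \<times> T. s > t} \<union> {(s, t) \<in> S \<times> T. s < t})
      = sch S T + card {(s, t) \<in> S \<times> T. s < t}"
    unfolding sch_def
  proof (rule card_Un_disjoint)
    show "finite {(s, t) \<in> S \<times> T. s > t}" "finite {(s, t) \<in> S \<times> T. s < t}"
      by (rule finite_subset[OF _ finite_cartesian_product[OF assms(1,2)]], blast)+
  qed auto
  moreover have "{(s, t) \<in> S \<times> T. s > t} \<union> {(s, t) \<in> S \<times> T. s < t} = S \<times> T"
    using assms(3) by (auto simp: neq_iff)
  ultimately show ?thesis by (simp add: card_cartesian_product)
qed

lemma square_sign: "((- 1 :: 'a::comm_ring_1) ^ n) * ((- 1) ^ n * x) = x"
  by (simp flip: mult.assoc power_add)

context restriction_species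
begin

text \<open>
  Relabelling back along the inverse of \<open>\<sigma>\<close> sends both structures to \<open>b\<close>, and relabelling is
  injective.
\<close>
lemma relabel_cong:
  assumes "finite I" "inj_on \<sigma> I" "b \<in> str P I" "\<And>i. i \<in> I \<Longrightarrow> \<sigma> i = \<tau> i"
  shows "relabel P \<sigma> b = relabel P \<tau> b"
proof -
  have \<tau>: "inj_on \<tau> I" "\<tau> ` I = \<sigma> ` I"
    using assms(2,4) by (auto simp: inj_on_def)
  let ?\<rho> = "inv_into I \<sigma>"
  have \<rho>: "inj_on ?\<rho> (\<sigma> ` I)" by (simp add: inj_on_inv_into)
  have \<sigma>b: "relabel P ?\<rho> (relabel P \<sigma> b) = b"
    unfolding relabel_comp[OF assms(1,2) \<rho> assms(3)]
    by (rule relabel_id[OF assms(1,3)]) (simp add: assms(2))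
  have \<tau>b: "relabel P ?\<rho> (relabel P \<tau> b) = b"
    unfolding relabel_comp[OF assms(1) \<tau>(1) \<rho>[folded \<tau>(2)] assms(3)]
    by (rule relabel_id[OF assms(1,3)]) (simp add: assms(2) flip: assms(4))
  show ?thesis
  proof (rule inj_onD[OF inj_on_relabel[OF finite_imageI[OF assms(1)] \<rho>]])
    show "relabel P \<sigma> b \<in> str P (\<sigma> ` I)" by (rule relabel_closed[OF assms(1,2,3)])
    show "relabel P \<tau> b \<in> str P (\<sigma> ` I)"
      using relabel_closed[OF assms(1) \<tau>(1) assms(3)] by (simp only: \<tau>(2))
  qed (simp only: \<sigma>b \<tau>b)
qed

lemma act_basis_vec:
  "finite I \<Longrightarrow> b \<in> str P I \<Longrightarrow> act (linearize P) I \<sigma> (basis_vec b :: 'b \<Rightarrow> 'k::comm_ring_1) = basis_vec (relabel P \<sigma> b)"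
  by (simp add: linearize_def lin_ext_basis_vec finite_str)

lemma restr_basis_vec:
  "finite I \<Longrightarrow> b \<in> str P I \<Longrightarrow> restr (linearize P) I S (basis_vec b :: 'b \<Rightarrow> 'k::comm_ring_1) = basis_vec (restrict_str P S b)"
  by (simp add: linearize_def lin_ext_basis_vec finite_str)

lemma linear_form_basis_vec:
  "b \<in> str P {1..p} \<Longrightarrow> linear_form P p h (basis_vec b) = h b"
  using finite_str[of "{1..p}"]
  by (simp add: linear_form_def basis_vec_in_free_module)
    (simp add: basis_vec_def if_distrib[of "\<lambda>t. t * _"] cong: if_cong)

lemma linear_form_in_koszul:
  fixes h :: "'b \<Rightarrow> 'k::comm_ring_1"
  assumes h: "\<And>\<sigma> b. \<lbrakk>\<sigma> permutes {1..p}; b \<in> str P {1..p}\<rbrakk> \<Longrightarrow> h (relabel P \<sigma> b) = of_int (sign \<sigma>) * h b"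
  shows "linear_form P p h \<in> koszul p (linearize P)"
proof -
  let ?I = "{1..p}"
  have "linear_form P p h (act (linearize P) ?I \<sigma> v) = of_int (sign \<sigma>) * linear_form P p h v"
    if \<sigma>: "\<sigma> permutes ?I" and v: "v \<in> free_module (str P ?I)" for \<sigma> v
  proof -
    have inj: "inj_on \<sigma> ?I" and im: "\<sigma> ` ?I = ?I"
      using \<sigma> by (simp_all add: permutes_inj_on permutes_image)
    have closed: "act (linearize P) ?I \<sigma> v \<in> free_module (str P ?I)"
      using act_closed[OF finite_atLeastAtMost inj] by (simp only: im)
    have "(\<Sum>c\<in>str P ?I. act (linearize P) ?I \<sigma> v c * h c)
        = (\<Sum>b\<in>str P ?I. v b * h (relabel P \<sigma> b))"
      using sum_act[OF finite_atLeastAtMost inj] by (simp only: im)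
    also have "\<dots> = of_int (sign \<sigma>) * (\<Sum>b\<in>str P ?I. v b * h b)"
      using h[OF \<sigma>] by (simp add: sum_distrib_left mult_ac)
    finally show ?thesis using closed v by (simp add: linear_form_def)
  qed
  moreover have "linear_on (free_module (str P ?I)) fscale (*) (linear_form P p h)"
    by (auto simp: linear_on_def linear_form_def fscale_def free_module_def sum.distrib
        sum_distrib_left algebra_simps)
  ultimately show ?thesis
    by (simp add: koszul_def obj_linearize scal_linearize linear_form_def)
qed

lemma koszul_relabel:
  fixes f :: "('b \<Rightarrow> 'k::comm_ring_1) \<Rightarrow> 'k"
  assumes "f \<in> koszul p (linearize P)" "\<sigma> permutes {1..p}" "b \<in> str P {1..p}"
  shows "f (basis_vec (relabel P \<sigma> b)) = of_int (sign \<sigma>) * f (basis_vec b)"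
proof -
  have "f (act (linearize P) {1..p} \<sigma> (basis_vec b)) = of_int (sign \<sigma>) * f (basis_vec b)"
    using assms unfolding koszul_def obj_linearize by (simp add: basis_vec_in_free_module)
  then show ?thesis using assms(3) by (simp add: act_basis_vec)
qed

lemma koszul_expand:
  fixes f :: "('b \<Rightarrow> 'k::comm_ring_1) \<Rightarrow> 'k"
  assumes "f \<in> koszul p (linearize P)"
  shows "f = linear_form P p (\<lambda>b. f (basis_vec b))"
proof
  fix v
  show "f v = linear_form P p (\<lambda>b. f (basis_vec b)) v"
  proof (cases "v \<in> free_module (str P {1..p})")
    case True
    have "linear_on (free_module (str P {1..p})) fscale (*) f"
      using assms by (simp add: koszul_def obj_linearize scal_linearize)
    then have "f v = (\<Sum>b\<in>str P {1..p}. v b * f (basis_vec b))"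
      using True by (intro linear_on_free_module_expand) (simp_all add: finite_str)
    then show ?thesis using True by (simp add: linear_form_def)
  next
    case False
    then show ?thesis using assms by (simp add: koszul_def obj_linearize linear_form_def)
  qed
qed

lemma koszul_eqI:
  fixes f g :: "('b \<Rightarrow> 'k::comm_ring_1) \<Rightarrow> 'k"
  assumes "f \<in> koszul p (linearize P)" "g \<in> koszul p (linearize P)"
    and "\<And>b. b \<in> str P {1..p} \<Longrightarrow> f (basis_vec b) = g (basis_vec b)"
  shows "f = g"
proof -
  have "linear_form P p (\<lambda>b. f (basis_vec b)) = linear_form P p (\<lambda>b. g (basis_vec b))"
    using assms(3) by (auto simp: linear_form_def fun_eq_iff)
  then show ?thesis using koszul_expand assms(1,2) by metis
qed

text \<open>
  The bijection \<open>\<sigma>\<close> corresponds to a permutation \<open>\<pi>\<close> of \<open>{1..p}\<close> under the standardisations of its source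
  and target. These preserve the order, so \<open>\<pi>\<close> and \<open>\<sigma>\<close> have the same sign.
\<close>
lemma extend_form_relabel:
  fixes f :: "('b \<Rightarrow> 'k::comm_ring_1) \<Rightarrow> 'k"
  assumes f: "f \<in> koszul p (linearize P)"
    and S: "finite S" "card S = p" "inj_on \<sigma> S" "b \<in> str P S"
  shows "extend_form P f (\<sigma> ` S) (relabel P \<sigma> b) = of_int (reorder_sign \<sigma> S) * extend_form P f S b"
proof -
  let ?s = "std S" and ?s' = "std (\<sigma> ` S)"
  have fin: "finite (\<sigma> ` S)" and card: "card (\<sigma> ` S) = p" using S by (simp_all add: card_image)
  have s: "inj_on ?s S" "?s ` S = {1..p}" and s': "inj_on ?s' (\<sigma> ` S)" "?s' ` \<sigma> ` S = {1..p}"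
    using S inj_on_std[of S] std_image[of S] inj_on_std[OF fin] std_image[OF fin] card by simp_all
  define \<pi> where "\<pi> = (\<lambda>i. if i \<in> {1..p} then ?s' (\<sigma> (inv_into S ?s i)) else i)"
  have \<pi>: "\<pi> (?s i) = ?s' (\<sigma> i)" if "i \<in> S" for i
  proof -
    have "?s i \<in> {1..p}" using that s(2) by blast
    then show ?thesis using that s(1) by (simp add: \<pi>_def)
  qed
  have "\<pi> ` {1..p} = {1..p}"
  proof -
    have "\<pi> ` ?s ` S = ?s' ` \<sigma> ` S" using \<pi> by (force simp: image_iff)
    then show ?thesis using s(2) s'(2) by simp
  qed
  then have perm: "\<pi> permutes {1..p}"
    by (intro bij_imp_permutes) (auto simp: bij_betw_def \<pi>_def eq_card_imp_inj_on)
  have "reorder_sign (?s' \<circ> \<sigma>) S = reorder_sign (\<pi> \<circ> ?s) S"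
    using \<pi> by (intro reorder_sign_cong) simp
  moreover have "reorder_sign (?s' \<circ> \<sigma>) S = reorder_sign \<sigma> S"
    using reorder_sign_comp[OF S(3) s'(1)] std_strict_mono[OF fin] by (simp add: reorder_sign_mono)
  moreover have "reorder_sign (\<pi> \<circ> ?s) S = reorder_sign \<pi> {1..p}"
    using reorder_sign_comp[OF s(1), of \<pi>] std_strict_mono[OF S(1)] s(2) perm
    by (simp add: reorder_sign_mono permutes_inj_on)
  ultimately have sign: "sign \<pi> = reorder_sign \<sigma> S"
    using sign_eq_reorder_sign[OF _ perm] by simp
  have "relabel P ?s' (relabel P \<sigma> b) = relabel P (?s' \<circ> \<sigma>) b"
    by (rule relabel_comp[OF S(1,3) s'(1) S(4)])
  also have "\<dots> = relabel P (\<pi> \<circ> ?s) b"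
    using S \<pi> s' by (intro relabel_cong[OF S(1) _ S(4)]) (auto intro: comp_inj_on)
  also have "\<dots> = relabel P \<pi> (relabel P ?s b)"
    using S s perm by (intro relabel_comp[symmetric]) (auto simp: permutes_inj_on)
  finally have eq: "relabel P ?s' (relabel P \<sigma> b) = relabel P \<pi> (relabel P ?s b)" .
  have "relabel P ?s b \<in> str P {1..p}"
    using relabel_closed[OF S(1) s(1) S(4)] s(2) by simp
  then show ?thesis
    unfolding extend_form_def eq sign[symmetric] by (rule koszul_relabel[OF f perm])
qed

text \<open>
  The splitting \<open>(S, T)\<close> on the right corresponds to \<open>(\<sigma> ` S, \<sigma> ` T)\<close> on the left; by
  \<open>reorder_sign_Un\<close> the signs of the corresponding terms differ by the sign of \<open>\<sigma>\<close>.
\<close>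
lemma shuffle_product_relabel:
  fixes f g :: "('b \<Rightarrow> 'k::comm_ring_1) \<Rightarrow> 'k"
  assumes f: "f \<in> koszul p (linearize P)" and g: "g \<in> koszul q (linearize P)"
    and I: "finite I" "inj_on \<sigma> I" "b \<in> str P I"
  shows "shuffle_product P p q f g (\<sigma> ` I) (relabel P \<sigma> b)
    = of_int (reorder_sign \<sigma> I) * shuffle_product P p q f g I b"
proof -
  have bij: "bij_betw (map_prod ((`) \<sigma>) ((`) \<sigma>)) (splits p q I) (splits p q (\<sigma> ` I))"
  proof (rule bij_betw_imageI)
    have "inj_on (map_prod ((`) \<sigma>) ((`) \<sigma>)) (Pow I \<times> Pow I)"
      using inj_on_image_Pow[OF I(2)] by (rule map_prod_inj_on) (rule inj_on_image_Pow[OF I(2)])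
    then show "inj_on (map_prod ((`) \<sigma>) ((`) \<sigma>)) (splits p q I)"
      by (rule inj_on_subset) (auto simp: splits_def)
    show "map_prod ((`) \<sigma>) ((`) \<sigma>) ` splits p q I = splits p q (\<sigma> ` I)"
    proof
      show "map_prod ((`) \<sigma>) ((`) \<sigma>) ` splits p q I \<subseteq> splits p q (\<sigma> ` I)"
      proof (rule image_subsetI)
        fix x assume "x \<in> splits p q I"
        then obtain S T where x: "x = (S, T)" and ST: "S \<union> T = I" "S \<inter> T = {}" "card S = p" "card T = q"
          by (auto simp: splits_def)
        have "inj_on \<sigma> S" "inj_on \<sigma> T" using ST(1) I(2) by (auto intro: inj_on_subset)
        moreover have "\<sigma> ` S \<inter> \<sigma> ` T = {}"
          using inj_on_image_Int[OF I(2), of S T] ST by auto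
        moreover have "\<sigma> ` S \<union> \<sigma> ` T = \<sigma> ` I" using ST(1) by auto
        ultimately show "map_prod ((`) \<sigma>) ((`) \<sigma>) x \<in> splits p q (\<sigma> ` I)"
          using ST by (simp add: x splits_def card_image)
      qed
      show "splits p q (\<sigma> ` I) \<subseteq> map_prod ((`) \<sigma>) ((`) \<sigma>) ` splits p q I"
      proof clarify
        fix S' T' assume "(S', T') \<in> splits p q (\<sigma> ` I)"
        then have *: "S' \<union> T' = \<sigma> ` I" "S' \<inter> T' = {}" "card S' = p" "card T' = q" by (auto simp: splits_def)
        define S T where "S = {i \<in> I. \<sigma> i \<in> S'}" and "T = {i \<in> I. \<sigma> i \<in> T'}"
        have im: "\<sigma> ` S = S'" "\<sigma> ` T = T'" using *(1) by (auto simp: S_def T_def)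
        moreover have "inj_on \<sigma> S" "inj_on \<sigma> T" using I(2) by (auto simp: S_def T_def intro: inj_on_subset)
        ultimately have "card S = p" "card T = q" using *(3,4) by (auto dest: card_image)
        moreover have "S \<union> T = I" "S \<inter> T = {}" using *(1,2) by (auto simp: S_def T_def)
        ultimately have "(S, T) \<in> splits p q I" by (simp add: splits_def)
        then show "(S', T') \<in> map_prod ((`) \<sigma>) ((`) \<sigma>) ` splits p q I" using im by force
      qed
    qed
  qed
  let ?t = "\<lambda>b (S, T). (- 1) ^ sch S T * extend_form P f S (restrict_str P S b) * extend_form P g T (restrict_str P T b)"
  have "?t (relabel P \<sigma> b) (map_prod ((`) \<sigma>) ((`) \<sigma>) x) = of_int (reorder_sign \<sigma> I) * ?t b x"
    if x: "x \<in> splits p q I" for x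
  proof -
    obtain S T where xST: "x = (S, T)" by (cases x)
    have ST: "S \<union> T = I" "S \<inter> T = {}" "card S = p" "card T = q" "S \<subseteq> I" "T \<subseteq> I"
      using x by (auto simp: xST splits_def)
    have fin: "finite S" "finite T" using ST I(1) by (auto intro: finite_subset)
    have inj: "inj_on \<sigma> S" "inj_on \<sigma> T" using ST I(2) by (auto intro: inj_on_subset)
    have ext: "extend_form P f (\<sigma> ` S) (restrict_str P (\<sigma> ` S) (relabel P \<sigma> b))
        = of_int (reorder_sign \<sigma> S) * extend_form P f S (restrict_str P S b)"
      "extend_form P g (\<sigma> ` T) (restrict_str P (\<sigma> ` T) (relabel P \<sigma> b))
        = of_int (reorder_sign \<sigma> T) * extend_form P g T (restrict_str P T b)"
      using ST I fin inj
      by (simp_all add: restrict_relabel[OF I(1)] extend_form_relabel[OF f] extend_form_relabel[OF g]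
          restrict_closed[OF I(1)])
    have "reorder_sign \<sigma> I = reorder_sign \<sigma> S * reorder_sign \<sigma> T * (- 1) ^ sch S T * (- 1) ^ sch (\<sigma> ` S) (\<sigma> ` T)"
      using reorder_sign_Un[OF fin ST(2), of \<sigma>] ST(1) I(2) by simp
    then have "(of_int (reorder_sign \<sigma> I) :: 'k) * (- 1) ^ sch S T
        = of_int (reorder_sign \<sigma> S) * of_int (reorder_sign \<sigma> T) * (- 1) ^ sch (\<sigma> ` S) (\<sigma> ` T)"
      using square_sign[of "sch S T" "1 :: 'k"] by (simp add: mult_ac square_sign)
    then show ?thesis
      unfolding xST map_prod_simp prod.case ext by (simp add: mult_ac) (simp add: mult.assoc[symmetric])
  qed
  then show ?thesis
    unfolding shuffle_product_def sum.reindex_bij_betw[OF bij, symmetric]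
    by (simp add: sum_distrib_left)
qed

lemma cup_eq:
  fixes f g :: "('b \<Rightarrow> 'k::comm_ring_1) \<Rightarrow> 'k"
  shows "cup P p q f g = linear_form P (p + q) (shuffle_product P p q f g {1..p + q})"
proof -
  let ?I = "{1..p + q}"
  have "cup_basis P p q f g (basis_vec b) = shuffle_product P p q f g ?I b" if b: "b \<in> str P ?I" for b
  proof -
    have "act (linearize P) S (std S) (restr (linearize P) ?I S (basis_vec b :: 'b \<Rightarrow> 'k))
        = basis_vec (relabel P (std S) (restrict_str P S b))" if "S \<subseteq> ?I" for S
      using that b restrict_closed[of ?I S b] finite_subset[OF that]
      by (simp add: restr_basis_vec act_basis_vec)
    then show ?thesis
      unfolding cup_basis_def shuffle_product_def splits_def extend_form_def
      by (intro sum.cong) (auto dest: equalityD1)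
  qed
  then show ?thesis by (auto simp: cup_def linear_form_def fun_eq_iff)
qed

lemma cup_closed:
  assumes "f \<in> koszul p (linearize P)" "g \<in> koszul q (linearize P)"
  shows "cup P p q f g \<in> koszul (p + q) (linearize P)"
  unfolding cup_eq
proof (rule linear_form_in_koszul)
  fix \<sigma> b assume *: "\<sigma> permutes {1..p + q}" "b \<in> str P {1..p + q}"
  show "shuffle_product P p q f g {1..p + q} (relabel P \<sigma> b)
      = of_int (sign \<sigma>) * shuffle_product P p q f g {1..p + q} b"
    using shuffle_product_relabel[OF assms finite_atLeastAtMost permutes_inj_on[OF *(1)] *(2)]
    unfolding permutes_image[OF *(1)] sign_eq_reorder_sign[OF finite_atLeastAtMost *(1)] .
qed

lemma cup_basis_vec:
  "b \<in> str P {1..p + q} \<Longrightarrow> cup P p q f g (basis_vec b) = shuffle_product P p q f g {1..p + q} b"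
  by (simp add: cup_eq linear_form_basis_vec)

text \<open>
  Standardisation preserves the order, so it does not change the shuffle product.
\<close>
lemma extend_form_cup:
  fixes f g :: "('b \<Rightarrow> 'k::comm_ring_1) \<Rightarrow> 'k"
  assumes f: "f \<in> koszul p (linearize P)" and g: "g \<in> koszul q (linearize P)"
    and I: "finite I" "card I = p + q" "b \<in> str P I"
  shows "extend_form P (cup P p q f g) I b = shuffle_product P p q f g I b"
proof -
  have "relabel P (std I) b \<in> str P {1..p + q}"
    using relabel_closed[OF I(1) inj_on_std I(3)] std_image I by simp
  then show ?thesis
    using shuffle_product_relabel[OF f g I(1) inj_on_std I(3)] std_image I
    by (simp add: extend_form_def cup_basis_vec reorder_sign_mono std_strict_mono)
qed

lemma extend_form_initial:
  assumes "b \<in> str P {1..p}"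
  shows "extend_form P f {1..p} b = f (basis_vec b)"
proof -
  have "relabel P (std {1..p}) b = b"
    using finite_atLeastAtMost assms by (rule relabel_id) (rule std_initial)
  then show ?thesis by (simp only: extend_form_def)
qed

lemma cup_unit_left:
  fixes f :: "('b \<Rightarrow> 'k::comm_ring_1) \<Rightarrow> 'k"
  assumes f: "f \<in> koszul p (linearize P)"
  shows "cup P 0 p (cup_unit P) f = f"
proof (rule koszul_eqI[OF _ f])
  have "cup_unit P = linear_form P 0 (\<lambda>b. 1 :: 'k)"
    by (simp add: cup_unit_def linear_form_def fun_eq_iff)
  also have "\<dots> \<in> koszul 0 (linearize P)" by (rule linear_form_in_koszul) simp
  finally have unit: "(cup_unit P :: ('b \<Rightarrow> 'k) \<Rightarrow> 'k) \<in> koszul 0 (linearize P)" .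
  then show "cup P 0 p (cup_unit P) f \<in> koszul p (linearize P)" using cup_closed[OF unit f] by simp
  fix b assume b: "b \<in> str P {1..p}"
  have "splits 0 p {1..p} = {({}, {1..p})}"
  proof
    show "splits 0 p {1..p} \<subseteq> {({}, {1..p})}"
    proof clarify
      fix S T assume "(S, T) \<in> splits 0 p {1..p}"
      note ST = splitsD[OF this]
      have "S = {}" using ST(3,7) by simp
      then show "S = {} \<and> T = {1..p}" using ST(1) by simp
    qed
  qed (simp add: splits_def)
  moreover have "restrict_str P {} b \<in> str P {}" using b by (intro restrict_closed[of "{1..p}"]) auto
  then have "extend_form P (cup_unit P) {} (restrict_str P {} b) = (1 :: 'k)"
    using relabel_closed[of "{}" "std {}" "restrict_str P {} b"] finite_str[of "{}"]
    by (simp add: extend_form_def cup_unit_def basis_vec_in_free_module) (simp add: basis_vec_def)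
  ultimately show "cup P 0 p (cup_unit P) f (basis_vec b) = f (basis_vec b)"
    using b cup_basis_vec[of b 0 p "cup_unit P" f] restrict_id[OF finite_atLeastAtMost b]
      extend_form_initial[OF b, of f]
    by (simp add: shuffle_product_def sch_def)
qed

lemma cup_graded_commute:
  fixes f g :: "('b \<Rightarrow> 'k::comm_ring_1) \<Rightarrow> 'k"
  shows "cup P p q f g = (\<lambda>v. (- 1) ^ (p * q) * cup P q p g f v)"
proof -
  have "shuffle_product P p q f g {1..p + q} b = (- 1) ^ (p * q) * shuffle_product P q p g f {1..p + q} b" for b
    unfolding shuffle_product_def sum_distrib_left
  proof (rule sum.reindex_bij_witness[of _ prod.swap prod.swap])
    fix x assume x: "x \<in> splits p q {1..p + q}"
    obtain S T where xST: "x = (S, T)" by (cases x)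
    note ST = splitsD[OF x[unfolded xST] finite_atLeastAtMost]
    then have "p * q = sch S T + sch T S" using sch_swap[of S T] by simp
    then have sign: "((- 1 :: 'k) ^ (p * q)) * (- 1) ^ sch T S = (- 1) ^ sch S T"
      by (simp add: power_add mult.assoc flip: power_mult_distrib)
    show "(- 1) ^ (p * q) * (case prod.swap x of (S, T) \<Rightarrow> (- 1) ^ sch S T *
          extend_form P g S (restrict_str P S b) * extend_form P f T (restrict_str P T b))
        = (case x of (S, T) \<Rightarrow> (- 1) ^ sch S T * extend_form P f S (restrict_str P S b) *
          extend_form P g T (restrict_str P T b))"
      unfolding xST swap_simp prod.case sign[symmetric] by (simp only: mult_ac)
  qed (auto simp: splits_def)
  then show ?thesis
    unfolding cup_eq add.commute[of q p]
    by (auto simp: linear_form_def fun_eq_iff sum_distrib_left mult_ac)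
qed

text \<open>
  Both sides are sums over the decompositions of the ground set into three parts \<open>S\<close>, \<open>T\<close>, \<open>U\<close>, and both
  signs are \<open>sch S T + sch S U + sch T U\<close> by additivity of \<open>sch\<close>.
\<close>
lemma cup_assoc:
  fixes f g h :: "('b \<Rightarrow> 'k::comm_ring_1) \<Rightarrow> 'k"
  assumes f: "f \<in> koszul p (linearize P)" and g: "g \<in> koszul q (linearize P)"
    and h: "h \<in> koszul r (linearize P)"
  shows "cup P (p + q) r (cup P p q f g) h = cup P p (q + r) f (cup P q r g h)"
proof (rule koszul_eqI)
  show "cup P (p + q) r (cup P p q f g) h \<in> koszul (p + (q + r)) (linearize P)"
    using cup_closed[OF cup_closed[OF f g] h] by (simp add: add.assoc)
  show "cup P p (q + r) f (cup P q r g h) \<in> koszul (p + (q + r)) (linearize P)"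
    by (rule cup_closed[OF f cup_closed[OF g h]])
  fix b assume b: "b \<in> str P {1..p + (q + r)}"
  let ?I = "{1..p + (q + r)}"
  let ?e = "\<lambda>k S. extend_form P k S (restrict_str P S b)"
  have ext: "extend_form P (cup P p' q' k l) R (restrict_str P R b)
      = (\<Sum>(S, T)\<in>splits p' q' R. (- 1) ^ sch S T * ?e k S * ?e l T)"
    if "R \<subseteq> ?I" "card R = p' + q'" "k \<in> koszul p' (linearize P)" "l \<in> koszul q' (linearize P)"
    for R p' q' and k l :: "('b \<Rightarrow> 'k) \<Rightarrow> 'k"
  proof -
    have R: "finite R" using that(1) by (rule finite_subset) simp
    have "extend_form P (cup P p' q' k l) R (restrict_str P R b)
        = shuffle_product P p' q' k l R (restrict_str P R b)"
      using that R b by (intro extend_form_cup restrict_closed[of ?I]) simp_all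
    also have "\<dots> = (\<Sum>(S, T)\<in>splits p' q' R. (- 1) ^ sch S T * ?e k S * ?e l T)"
      unfolding shuffle_product_def
    proof (rule sum.cong[OF refl], clarify)
      fix S T assume "(S, T) \<in> splits p' q' R"
      then have "S \<subseteq> R" "T \<subseteq> R" by (auto simp: splits_def)
      then show "(- 1) ^ sch S T * extend_form P k S (restrict_str P S (restrict_str P R b)) *
          extend_form P l T (restrict_str P T (restrict_str P R b)) = (- 1) ^ sch S T * ?e k S * ?e l T"
        using that(1) b by (simp add: restrict_restrict[of ?I])
    qed
    finally show ?thesis .
  qed
  have "cup P (p + q) r (cup P p q f g) h (basis_vec b)
    = (\<Sum>(R, U)\<in>splits (p + q) r ?I. \<Sum>(S, T)\<in>splits p q R.
        (- 1) ^ sch R U * (- 1) ^ sch S T * ?e f S * ?e g T * ?e h U)"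
  proof -
    have "cup P (p + q) r (cup P p q f g) h (basis_vec b)
      = shuffle_product P (p + q) r (cup P p q f g) h ?I b"
      using b cup_basis_vec[of b "p + q" r] by (simp add: add.assoc)
    also have "\<dots> = (\<Sum>(R, U)\<in>splits (p + q) r ?I. \<Sum>(S, T)\<in>splits p q R.
        (- 1) ^ sch R U * (- 1) ^ sch S T * ?e f S * ?e g T * ?e h U)"
      unfolding shuffle_product_def
    proof (rule sum.cong[OF refl], clarify)
      fix R U assume "(R, U) \<in> splits (p + q) r ?I"
      note RU = splitsD[OF this finite_atLeastAtMost]
      show "(- 1) ^ sch R U * ?e (cup P p q f g) R * ?e h U = (\<Sum>(S, T)\<in>splits p q R.
          (- 1) ^ sch R U * (- 1) ^ sch S T * ?e f S * ?e g T * ?e h U)"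
        unfolding ext[OF RU(5,3) f g] by (simp add: sum_distrib_left sum_distrib_right mult_ac case_prod_unfold)
    qed
    finally show ?thesis .
  qed
  also have "\<dots> = (\<Sum>((R, U), (S, T))\<in>(SIGMA x:splits (p + q) r ?I. splits p q (fst x)).
        (- 1) ^ sch R U * (- 1) ^ sch S T * ?e f S * ?e g T * ?e h U)"
    unfolding case_prod_unfold
  proof (rule sum.Sigma[unfolded case_prod_unfold])
    show "\<forall>x\<in>splits (p + q) r ?I. finite (splits p q (fst x))"
      using splitsD(7)[OF _ finite_atLeastAtMost] by (auto intro: finite_splits)
  qed (simp add: finite_splits)
  also have "\<dots> = (\<Sum>((S, R), (T, U))\<in>(SIGMA x:splits p (q + r) ?I. splits q r (snd x)).
        (- 1) ^ sch S R * (- 1) ^ sch T U * ?e f S * ?e g T * ?e h U)"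
  proof (rule sum.reindex_bij_witness[of _
        "\<lambda>((S, R), (T, U)). ((S \<union> T, U), (S, T))" "\<lambda>((R, U), (S, T)). ((S, T \<union> U), (T, U))"])
    fix x assume "x \<in> (SIGMA x:splits (p + q) r ?I. splits p q (fst x))"
    then obtain R U S T where x: "x = ((R, U), (S, T))" "(R, U) \<in> splits (p + q) r ?I" "(S, T) \<in> splits p q R"
      by auto
    note RU = splitsD[OF x(2) finite_atLeastAtMost]
    have fin: "finite S" "finite T" "finite U" using splitsD[OF x(3) RU(7)] RU(8) by simp_all
    have disj: "S \<inter> T = {}" "T \<inter> U = {}" "S \<inter> U = {}" "R = S \<union> T" using x(2,3) by (auto simp: splits_def)
    show "(\<lambda>((S, R), (T, U)). ((S \<union> T, U), (S, T))) ((\<lambda>((R, U), (S, T)). ((S, T \<union> U), (T, U))) x) = x"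
      using disj by (simp add: x(1))
    show "(\<lambda>((R, U), (S, T)). ((S, T \<union> U), (T, U))) x \<in> (SIGMA x:splits p (q + r) ?I. splits q r (snd x))"
      using x(2,3) fin disj by (auto simp: x(1) splits_def card_Un_disjoint)
    show "(\<lambda>((S, R), (T, U)). (- 1) ^ sch S R * (- 1) ^ sch T U * ?e f S * ?e g T * ?e h U)
          ((\<lambda>((R, U), (S, T)). ((S, T \<union> U), (T, U))) x)
        = (\<lambda>((R, U), (S, T)). (- 1) ^ sch R U * (- 1) ^ sch S T * ?e f S * ?e g T * ?e h U) x"
      using fin disj by (simp add: x(1) sch_Un_left sch_Un_right power_add mult_ac)
  next
    fix x assume "x \<in> (SIGMA x:splits p (q + r) ?I. splits q r (snd x))"
    then obtain R U S T where x: "x = ((S, R), (T, U))" "(S, R) \<in> splits p (q + r) ?I" "(T, U) \<in> splits q r R"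
      by auto
    note SR = splitsD[OF x(2) finite_atLeastAtMost]
    have fin: "finite S" "finite T" "finite U" using splitsD[OF x(3) SR(8)] SR(7) by simp_all
    have disj: "S \<inter> T = {}" "T \<inter> U = {}" "S \<inter> U = {}" "R = T \<union> U" using x(2,3) by (auto simp: splits_def)
    show "(\<lambda>((R, U), (S, T)). ((S, T \<union> U), (T, U))) ((\<lambda>((S, R), (T, U)). ((S \<union> T, U), (S, T))) x) = x"
      using disj by (simp add: x(1))
    show "(\<lambda>((S, R), (T, U)). ((S \<union> T, U), (S, T))) x \<in> (SIGMA x:splits (p + q) r ?I. splits p q (fst x))"
      using x(2,3) fin disj by (auto simp: x(1) splits_def card_Un_disjoint)
  qed
  also have "\<dots> = (\<Sum>(S, R)\<in>splits p (q + r) ?I. \<Sum>(T, U)\<in>splits q r R.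
        (- 1) ^ sch S R * (- 1) ^ sch T U * ?e f S * ?e g T * ?e h U)"
    unfolding case_prod_unfold
  proof (rule sum.Sigma[unfolded case_prod_unfold, symmetric])
    show "\<forall>x\<in>splits p (q + r) ?I. finite (splits q r (snd x))"
      using splitsD(8)[OF _ finite_atLeastAtMost] by (auto intro: finite_splits)
  qed (simp add: finite_splits)
  also have "\<dots> = cup P p (q + r) f (cup P q r g h) (basis_vec b)"
  proof -
    have "(\<Sum>(S, R)\<in>splits p (q + r) ?I. \<Sum>(T, U)\<in>splits q r R.
        (- 1) ^ sch S R * (- 1) ^ sch T U * ?e f S * ?e g T * ?e h U)
      = shuffle_product P p (q + r) f (cup P q r g h) ?I b"
      unfolding shuffle_product_def
    proof (rule sum.cong[OF refl], clarify)
      fix S R assume "(S, R) \<in> splits p (q + r) ?I"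
      note SR = splitsD[OF this finite_atLeastAtMost]
      show "(\<Sum>(T, U)\<in>splits q r R. (- 1) ^ sch S R * (- 1) ^ sch T U * ?e f S * ?e g T * ?e h U)
        = (- 1) ^ sch S R * ?e f S * ?e (cup P q r g h) R"
        unfolding ext[OF SR(6,4) g h] by (simp add: sum_distrib_left mult_ac case_prod_unfold)
    qed
    then show ?thesis using b by (simp add: cup_basis_vec)
  qed
  finally show "cup P (p + q) r (cup P p q f g) h (basis_vec b) = cup P p (q + r) f (cup P q r g h) (basis_vec b)" .
qed

end

section \<open>The graded algebra of alternating forms\<close>

text \<open>
  Both sides run over the triples \<open>(p, q, r)\<close> with \<open>p + q + r = n\<close>.
\<close>
lemma sum_triangle_swap:
  fixes t :: "nat \<Rightarrow> nat \<Rightarrow> nat \<Rightarrow> 'a::comm_monoid_add"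
  shows "(\<Sum>m\<le>n. \<Sum>p\<le>m. t p (m - p) (n - m)) = (\<Sum>p\<le>n. \<Sum>q\<le>n - p. t p q (n - p - q))"
proof -
  have "(\<Sum>m\<le>n. \<Sum>p\<le>m. t p (m - p) (n - m)) = (\<Sum>(m, p)\<in>(SIGMA m:{..n}. {..m}). t p (m - p) (n - m))"
    by (rule sum.Sigma) simp_all
  also have "\<dots> = (\<Sum>(p, q)\<in>(SIGMA p:{..n}. {..n - p}). t p q (n - p - q))"
    by (rule sum.reindex_bij_witness[of _ "\<lambda>(p, q). (p + q, p)" "\<lambda>(m, p). (p, m - p)"]) auto
  also have "\<dots> = (\<Sum>p\<le>n. \<Sum>q\<le>n - p. t p q (n - p - q))"
    by (rule sum.Sigma[symmetric]) simp_all
  finally show ?thesis .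
qed

lemma cring_scalar_ring: "cring (scalar_ring :: 'k::comm_ring_1 ring)"
proof (rule cringI)
  show "abelian_group (scalar_ring :: 'k ring)"
  proof (rule abelian_groupI)
    fix x :: 'k assume "x \<in> carrier scalar_ring"
    show "\<exists>y\<in>carrier scalar_ring. y \<oplus>\<^bsub>scalar_ring\<^esub> x = \<zero>\<^bsub>scalar_ring\<^esub>"
      by (rule bexI[of _ "- x"]) (simp_all add: scalar_ring_def)
  qed (simp_all add: scalar_ring_def algebra_simps)
  show "comm_monoid (scalar_ring :: 'k ring)"
    by (rule comm_monoidI) (simp_all add: scalar_ring_def algebra_simps)
qed (simp add: scalar_ring_def algebra_simps)

lemma cup_add_left: "cup P p q (f + f') g = cup P p q f g + cup P p q f' g"
  unfolding cup_def cup_basis_def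
  by (auto simp: fun_eq_iff case_prod_unfold algebra_simps sum.distrib sum_distrib_left)

lemma cup_add_right: "cup P p q f (g + g') = cup P p q f g + cup P p q f g'"
  unfolding cup_def cup_basis_def
  by (auto simp: fun_eq_iff case_prod_unfold algebra_simps sum.distrib sum_distrib_left)

lemma cup_zero_left: "cup P p q 0 g = 0"
  unfolding cup_def cup_basis_def by (simp add: fun_eq_iff case_prod_unfold)

lemma cup_zero_right: "cup P p q f 0 = 0"
  unfolding cup_def cup_basis_def by (simp add: fun_eq_iff case_prod_unfold)

lemma cup_scale_left: "cup P p q (\<lambda>v. c * f v) g = (\<lambda>v. c * cup P p q f g v)"
  unfolding cup_def cup_basis_def
  by (auto simp: fun_eq_iff case_prod_unfold algebra_simps sum_distrib_left)

lemma cup_sum_left: "cup P p q (\<Sum>i\<in>A. f i) g = (\<Sum>i\<in>A. cup P p q (f i) g)"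
proof (induction A rule: infinite_finite_induct)
  case (insert i A)
  then show ?case by (simp only: sum.insert[OF insert.hyps] cup_add_left)
qed (simp_all only: sum.infinite sum.empty not_False_eq_True cup_zero_left)

lemma cup_sum_right: "cup P p q f (\<Sum>i\<in>A. g i) = (\<Sum>i\<in>A. cup P p q f (g i))"
proof (induction A rule: infinite_finite_induct)
  case (insert i A)
  then show ?case by (simp only: sum.insert[OF insert.hyps] cup_add_right)
qed (simp_all only: sum.infinite sum.empty not_False_eq_True cup_zero_right)

lemma koszul_zero: "0 \<in> koszul p X"
  by (simp add: koszul_def linear_on_def)

lemma koszul_scale:
  assumes "f \<in> koszul p X" shows "(\<lambda>v. c * f v) \<in> koszul p X"
  using assms by (auto simp: koszul_def linear_on_def distrib_left mult.left_commute)

lemma koszul_add: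
  assumes "f \<in> koszul p X" "g \<in> koszul p X" shows "f + g \<in> koszul p X"
  using assms by (auto simp: koszul_def linear_on_def algebra_simps)

lemma koszul_sum: "(\<And>i. i \<in> A \<Longrightarrow> f i \<in> koszul p X) \<Longrightarrow> (\<Sum>i\<in>A. f i) \<in> koszul p X"
proof (induction A rule: infinite_finite_induct)
  case (insert i A)
  then show ?case unfolding sum.insert[OF insert.hyps] by (intro koszul_add) simp_all
qed (simp_all only: sum.infinite sum.empty not_False_eq_True koszul_zero)

lemma koszul_minus:
  assumes "f \<in> koszul p X" shows "- f \<in> koszul p X"
proof -
  have "- f = (\<lambda>v. (- 1) * f v)" by (simp add: fun_eq_iff)
  then show ?thesis using koszul_scale[OF assms, of "- 1"] by (simp only:)
qed

context restriction_species
begin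

lemma cup_unit_eq: "(cup_unit P :: ('b \<Rightarrow> 'k::comm_ring_1) \<Rightarrow> 'k) = linear_form P 0 (\<lambda>b. 1)"
  by (simp add: cup_unit_def linear_form_def fun_eq_iff)

lemma cup_unit_closed: "(cup_unit P :: ('b \<Rightarrow> 'k::comm_ring_1) \<Rightarrow> 'k) \<in> koszul 0 (linearize P)"
  unfolding cup_unit_eq by (rule linear_form_in_koszul) simp

lemma koszul_product_closed:
  fixes f g :: "nat \<Rightarrow> ('b \<Rightarrow> 'k::comm_ring_1) \<Rightarrow> 'k"
  assumes "f \<in> carrier (koszul_algebra P)" "g \<in> carrier (koszul_algebra P)"
  shows "f \<otimes>\<^bsub>koszul_algebra P\<^esub> g \<in> carrier (koszul_algebra P)"
proof -
  have f: "f p \<in> koszul p (linearize P)" and g: "g p \<in> koszul p (linearize P)" for p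
    using assms by (simp_all add: koszul_algebra_def)
  let ?h = "\<lambda>n. \<Sum>p\<le>n. cup P p (n - p) (f p) (g (n - p))"
  have "?h n \<in> koszul n (linearize P)" for n
  proof (rule koszul_sum)
    fix p assume "p \<in> {..n}"
    then show "cup P p (n - p) (f p) (g (n - p)) \<in> koszul n (linearize P)"
      using cup_closed[OF f[of p] g[of "n - p"]] by simp
  qed
  moreover have "finite {n. ?h n \<noteq> 0}"
  proof (rule finite_subset)
    show "{n. ?h n \<noteq> 0} \<subseteq> (\<lambda>(p, q). p + q) ` ({p. f p \<noteq> 0} \<times> {q. g q \<noteq> 0})"
    proof
      fix n assume "n \<in> {n. ?h n \<noteq> 0}"
      then obtain p where p: "p \<le> n" "cup P p (n - p) (f p) (g (n - p)) \<noteq> 0"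
        by (metis (mono_tags, lifting) atMost_iff mem_Collect_eq sum.neutral)
      then have "f p \<noteq> 0" "g (n - p) \<noteq> 0" using cup_zero_left cup_zero_right by metis+
      then show "n \<in> (\<lambda>(p, q). p + q) ` ({p. f p \<noteq> 0} \<times> {q. g q \<noteq> 0})"
        using p(1) by (auto intro!: image_eqI[of _ _ "(p, n - p)"])
    qed
    show "finite ((\<lambda>(p, q). p + q) ` ({p. f p \<noteq> 0} \<times> {q. g q \<noteq> 0}))"
      using assms by (simp add: koszul_algebra_def)
  qed
  ultimately show ?thesis by (simp add: koszul_algebra_def)
qed

lemma koszul_product_assoc:
  fixes f g h :: "nat \<Rightarrow> ('b \<Rightarrow> 'k::comm_ring_1) \<Rightarrow> 'k"
  assumes f: "\<And>p. f p \<in> koszul p (linearize P)" and g: "\<And>p. g p \<in> koszul p (linearize P)"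
    and h: "\<And>p. h p \<in> koszul p (linearize P)"
  shows "(\<Sum>m\<le>n. cup P m (n - m) (\<Sum>p\<le>m. cup P p (m - p) (f p) (g (m - p))) (h (n - m)))
    = (\<Sum>p\<le>n. cup P p (n - p) (f p) (\<Sum>q\<le>n - p. cup P q (n - p - q) (g q) (h (n - p - q))))"
proof -
  define t where "t = (\<lambda>p q r. cup P p (q + r) (f p) (cup P q r (g q) (h r)))"
  have "(\<Sum>m\<le>n. cup P m (n - m) (\<Sum>p\<le>m. cup P p (m - p) (f p) (g (m - p))) (h (n - m)))
      = (\<Sum>m\<le>n. \<Sum>p\<le>m. t p (m - p) (n - m))"
  proof (rule sum.cong[OF refl])
    fix m
    show "cup P m (n - m) (\<Sum>p\<le>m. cup P p (m - p) (f p) (g (m - p))) (h (n - m))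
        = (\<Sum>p\<le>m. t p (m - p) (n - m))"
      unfolding cup_sum_left
    proof (rule sum.cong[OF refl])
      fix p assume "p \<in> {..m}"
      then show "cup P m (n - m) (cup P p (m - p) (f p) (g (m - p))) (h (n - m)) = t p (m - p) (n - m)"
        using cup_assoc[OF f[of p] g[of "m - p"] h[of "n - m"]] by (simp add: t_def)
    qed
  qed
  also have "\<dots> = (\<Sum>p\<le>n. \<Sum>q\<le>n - p. t p q (n - p - q))" by (rule sum_triangle_swap)
  also have "\<dots> = (\<Sum>p\<le>n. cup P p (n - p) (f p) (\<Sum>q\<le>n - p. cup P q (n - p - q) (g q) (h (n - p - q))))"
    unfolding cup_sum_right by (intro sum.cong refl) (simp add: t_def)
  finally show ?thesis .
qed

text \<open>
  Commutativity is a hypothesis here because for a general species the product is commutative only up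
  to the sign \<open>(- 1) ^ (p * q)\<close>, whereas the algebras in question are commutative rings.
\<close>
lemma algebra_koszul_algebra:
  assumes commute: "\<And>p q f g. \<lbrakk>f \<in> koszul p (linearize P); g \<in> koszul q (linearize P)\<rbrakk>
    \<Longrightarrow> cup P p q f g = cup P q p g (f :: ('b \<Rightarrow> 'k::comm_ring_1) \<Rightarrow> 'k)"
  shows "algebra (scalar_ring :: 'k ring) (koszul_algebra P)"
proof -
  let ?K = "koszul_algebra P :: ('k, nat \<Rightarrow> ('b \<Rightarrow> 'k) \<Rightarrow> 'k) module"
  have mem: "f \<in> carrier ?K \<longleftrightarrow> (\<forall>p. f p \<in> koszul p (linearize P)) \<and> finite {p. f p \<noteq> 0}" for f
    by (simp add: koszul_algebra_def)
  have mult: "f \<otimes>\<^bsub>?K\<^esub> g = (\<lambda>n. \<Sum>p\<le>n. cup P p (n - p) (f p) (g (n - p)))"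
    and add: "f \<oplus>\<^bsub>?K\<^esub> g = f + g" and zero: "\<zero>\<^bsub>?K\<^esub> = 0"
    and smult: "c \<odot>\<^bsub>?K\<^esub> f = (\<lambda>p v. c * f p v)"
    and one: "\<one>\<^bsub>?K\<^esub> = (\<lambda>n. if n = 0 then cup_unit P else 0)" for f g c
    by (simp_all add: koszul_algebra_def)
  have ring: "(\<otimes>\<^bsub>scalar_ring\<^esub>) = ((*) :: 'k \<Rightarrow> _)" "(\<oplus>\<^bsub>scalar_ring\<^esub>) = ((+) :: 'k \<Rightarrow> _)"
    "\<one>\<^bsub>scalar_ring\<^esub> = (1 :: 'k)"
    by (simp_all add: scalar_ring_def)
  have add_closed: "f + g \<in> carrier ?K" if "f \<in> carrier ?K" "g \<in> carrier ?K" for f g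
  proof -
    have "{p. (f + g) p \<noteq> 0} \<subseteq> {p. f p \<noteq> 0} \<union> {p. g p \<noteq> 0}" by auto
    moreover have "f p + g p \<in> koszul p (linearize P)" for p
      using that unfolding mem by (intro koszul_add) blast+
    then have "(f + g) p \<in> koszul p (linearize P)" for p unfolding plus_fun_apply .
    ultimately show ?thesis using that by (auto simp: mem intro: finite_subset)
  qed
  have abelian: "abelian_group ?K"
  proof (rule abelian_groupI)
    fix f assume f: "f \<in> carrier ?K"
    have "{p. (- f) p \<noteq> 0} = {p. f p \<noteq> 0}" by auto
    moreover have "- f p \<in> koszul p (linearize P)" for p
      using f unfolding mem by (intro koszul_minus) blast
    then have "(- f) p \<in> koszul p (linearize P)" for p unfolding uminus_apply .
    ultimately have "- f \<in> carrier ?K" using f unfolding mem by (simp only: simp_thms)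
    then show "\<exists>g\<in>carrier ?K. g \<oplus>\<^bsub>?K\<^esub> f = \<zero>\<^bsub>?K\<^esub>"
      unfolding add zero by (rule bexI[rotated]) (rule left_minus)
  next
    show "\<zero>\<^bsub>?K\<^esub> \<in> carrier ?K" unfolding zero mem by (simp only: zero_fun_apply koszul_zero) simp
  qed (simp_all add: add zero add_closed ac_simps)
  have comm_monoid: "comm_monoid ?K"
  proof (rule comm_monoidI)
    show "\<one>\<^bsub>?K\<^esub> \<in> carrier ?K"
    proof -
      have "{p. (\<lambda>n. if n = 0 then cup_unit P else 0) p \<noteq> (0 :: ('b \<Rightarrow> 'k) \<Rightarrow> 'k)} \<subseteq> {0}" by auto
      then have "finite {p. (\<lambda>n. if n = 0 then cup_unit P else 0) p \<noteq> (0 :: ('b \<Rightarrow> 'k) \<Rightarrow> 'k)}"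
        by (rule finite_subset) simp
      then show ?thesis unfolding one mem using cup_unit_closed koszul_zero by auto
    qed
  next
    fix f g h assume "f \<in> carrier ?K" "g \<in> carrier ?K" "h \<in> carrier ?K"
    then show "f \<otimes>\<^bsub>?K\<^esub> g \<otimes>\<^bsub>?K\<^esub> h = f \<otimes>\<^bsub>?K\<^esub> (g \<otimes>\<^bsub>?K\<^esub> h)"
      unfolding mult mem by (intro ext[where 'a = nat] koszul_product_assoc) blast+
  next
    fix f assume f: "f \<in> carrier ?K"
    show "\<one>\<^bsub>?K\<^esub> \<otimes>\<^bsub>?K\<^esub> f = f"
      unfolding mult one
    proof
      fix n
      have "(\<Sum>p\<le>n. cup P p (n - p) (if p = 0 then cup_unit P else 0) (f (n - p)))
          = (\<Sum>p\<in>{0}. cup P p (n - p) (if p = 0 then cup_unit P else 0) (f (n - p)))"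
        by (rule sum.mono_neutral_right) (auto simp: cup_zero_left)
      also have "\<dots> = f n" using cup_unit_left[of "f n" n] f by (simp add: mem)
      finally show "(\<Sum>p\<le>n. cup P p (n - p) (if p = 0 then cup_unit P else 0) (f (n - p))) = f n" .
    qed
  next
    fix f g assume fg: "f \<in> carrier ?K" "g \<in> carrier ?K"
    show "f \<otimes>\<^bsub>?K\<^esub> g = g \<otimes>\<^bsub>?K\<^esub> f"
      unfolding mult
    proof
      fix n
      show "(\<Sum>p\<le>n. cup P p (n - p) (f p) (g (n - p))) = (\<Sum>p\<le>n. cup P p (n - p) (g p) (f (n - p)))"
      proof (rule sum.reindex_bij_witness[of _ "\<lambda>p. n - p" "\<lambda>p. n - p"])
        fix p assume p: "p \<in> {..n}"
        have "cup P (n - p) p (g (n - p)) (f p) = cup P p (n - p) (f p) (g (n - p))"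
          using fg by (intro commute) (simp_all add: mem)
        then show "cup P (n - p) (n - (n - p)) (g (n - p)) (f (n - (n - p))) = cup P p (n - p) (f p) (g (n - p))"
          using p by simp
      qed auto
    qed
  qed (rule koszul_product_closed)
  have cring: "cring ?K"
  proof (rule cringI[OF abelian comm_monoid])
    show "(f \<oplus>\<^bsub>?K\<^esub> g) \<otimes>\<^bsub>?K\<^esub> h = f \<otimes>\<^bsub>?K\<^esub> h \<oplus>\<^bsub>?K\<^esub> g \<otimes>\<^bsub>?K\<^esub> h" for f g h
      unfolding mult add by (rule ext) (simp only: plus_fun_apply cup_add_left sum.distrib)
  qed
  show ?thesis
  proof (rule algebraI[OF cring_scalar_ring cring])
    fix c :: 'k and f assume f: "f \<in> carrier ?K"
    have "(\<lambda>v. c * f p v) = 0" if "f p = 0" for p using that by (simp add: fun_eq_iff)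
    then have "{p. (\<lambda>v. c * f p v) \<noteq> 0} \<subseteq> {p. f p \<noteq> 0}" by blast
    then have "finite {p. (\<lambda>v. c * f p v) \<noteq> 0}"
      by (rule finite_subset) (use f in \<open>simp only: mem simp_thms\<close>)
    then show "c \<odot>\<^bsub>?K\<^esub> f \<in> carrier ?K"
      using f unfolding smult mem by (intro conjI allI koszul_scale) blast+
  next
    fix c :: 'k and f g
    show "(c \<odot>\<^bsub>?K\<^esub> f) \<otimes>\<^bsub>?K\<^esub> g = c \<odot>\<^bsub>?K\<^esub> (f \<otimes>\<^bsub>?K\<^esub> g)"
      unfolding mult smult
      by (intro ext) (simp only: cup_scale_left sum_fun_apply sum_distrib_left)
  qed (simp_all add: smult add ring fun_eq_iff algebra_simps)
qed

end

section \<open>Alternating forms on linear orders and on compositions\<close>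

lemma upt_in_str_Lin: "[1..<Suc n] \<in> str Lin {1..n}"
  by (auto simp: Lin_def permutations_of_set_def)

text \<open>
  The symmetric group acts transitively on linear orders, so the value at the increasing order
  determines an alternating form.
\<close>
lemma koszul_Lin_eqI:
  fixes f g :: "(nat list \<Rightarrow> 'k::comm_ring_1) \<Rightarrow> 'k"
  assumes "f \<in> koszul n LL" "g \<in> koszul n LL" "f (basis_vec [1..<Suc n]) = g (basis_vec [1..<Suc n])"
  shows "f = g"
proof (rule Lin.koszul_eqI[OF assms(1,2)])
  fix xs assume "xs \<in> str Lin {1..n}"
  then have xs: "set xs = {1..n}" "distinct xs" "length xs = n"
    by (auto simp: Lin_def permutations_of_set_def dest: distinct_card)
  define \<sigma> where "\<sigma> i = (if i \<in> {1..n} then xs ! (i - 1) else i)" for i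
  have map: "map \<sigma> [1..<Suc n] = xs"
    by (rule nth_equalityI) (simp_all add: xs \<sigma>_def del: upt_Suc)
  then have "\<sigma> ` {1..n} = {1..n}" using xs(1) by (metis set_map set_upt atLeastLessThanSuc_atLeastAtMost)
  then have "\<sigma> permutes {1..n}"
    by (intro bij_imp_permutes) (auto simp: bij_betw_def \<sigma>_def eq_card_imp_inj_on)
  then have at_xs: "k (basis_vec xs) = of_int (sign \<sigma>) * k (basis_vec [1..<Suc n])" if "k \<in> koszul n LL"
    for k :: "(nat list \<Rightarrow> 'k) \<Rightarrow> 'k"
    using Lin.koszul_relabel[OF that _ upt_in_str_Lin, of \<sigma>] map by (simp add: Lin_def del: upt_Suc)
  show "f (basis_vec xs) = g (basis_vec xs)"
    by (simp only: at_xs[OF assms(1)] at_xs[OF assms(2)] assms(3))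
qed

text \<open>
  This makes the factors in the product formula at the increasing order independent of the
  splitting.
\<close>
lemma standardize_increasing_order:
  assumes "S \<subseteq> {1..n}"
  shows "relabel Lin (std S) (restrict_str Lin S [1..<Suc n]) = [1..<Suc (card S)]"
proof -
  let ?xs = "filter (\<lambda>i. i \<in> S) [1..<Suc n]"
  have fin: "finite S" using assms by (rule finite_subset) simp
  have set: "set ?xs = S" using assms by auto
  have "sorted_wrt (<) ?xs" by (rule sorted_wrt_filter) (simp del: upt_Suc)
  then have "sorted_wrt (\<lambda>x y. std S x < std S y) ?xs"
    by (rule sorted_wrt_mono_rel[rotated])
      (use set std_strict_mono[OF fin] in \<open>auto dest: strict_mono_onD simp del: upt_Suc\<close>)
  then have "sorted_wrt (<) (map (std S) ?xs)" by (simp add: sorted_wrt_map del: upt_Suc)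
  moreover have "set (map (std S) ?xs) = set [1..<Suc (card S)]"
    using std_image[OF fin] set by (simp add: atLeastLessThanSuc_atLeastAtMost del: upt_Suc set_filter)
  moreover have "sorted_wrt (<) [1..<Suc (card S)]" by (simp del: upt_Suc)
  ultimately have "map (std S) ?xs = [1..<Suc (card S)]"
    by (intro sorted_distinct_set_unique) (simp_all add: strict_sorted_iff del: upt_Suc)
  then show ?thesis by (simp add: Lin_def del: upt_Suc)
qed

text \<open>
  At the increasing order the product of \<open>f\<close> and \<open>g\<close> is the product of their values times the sum
  \<open>?B p q\<close> of the signs \<open>(- 1) ^ sch S T\<close> (the binomial coefficient \<open>p + q choose p\<close> with the parameter
  \<open>q = - 1\<close>). The reversal \<open>\<rho>\<close> of \<open>{1..p + q}\<close> satisfies \<open>sch (\<rho> ` T) (\<rho> ` S) = sch S T\<close>, so this sum is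
  symmetric in \<open>p\<close> and \<open>q\<close>.
\<close>
lemma cup_Lin_commute:
  fixes f g :: "(nat list \<Rightarrow> 'k::comm_ring_1) \<Rightarrow> 'k"
  assumes f: "f \<in> koszul p LL" and g: "g \<in> koszul q LL"
  shows "cup Lin p q f g = cup Lin q p g f"
proof (rule koszul_Lin_eqI)
  show "cup Lin p q f g \<in> koszul (p + q) LL" by (rule Lin.cup_closed[OF f g])
  show "cup Lin q p g f \<in> koszul (p + q) LL" using Lin.cup_closed[OF g f] by (simp add: add.commute)
  let ?I = "{1..p + q}"
  let ?B = "\<lambda>p' q'. \<Sum>(S, T)\<in>splits p' q' ?I. (- 1 :: 'k) ^ sch S T"
  have at_id: "cup Lin p' q' k l (basis_vec [1..<Suc (p + q)])
      = ?B p' q' * (k (basis_vec [1..<Suc p']) * l (basis_vec [1..<Suc q']))"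
    if n: "p' + q' = p + q" for p' q' and k l :: "(nat list \<Rightarrow> 'k) \<Rightarrow> 'k"
  proof -
    have "cup Lin p' q' k l (basis_vec [1..<Suc (p + q)]) = shuffle_product Lin p' q' k l ?I [1..<Suc (p + q)]"
      using Lin.cup_basis_vec[of "[1..<Suc (p + q)]" p' q' k l] upt_in_str_Lin[of "p + q"] by (simp only: n)
    also have "\<dots> = (\<Sum>(S, T)\<in>splits p' q' ?I. (- 1) ^ sch S T
        * (k (basis_vec [1..<Suc p']) * l (basis_vec [1..<Suc q'])))"
      unfolding shuffle_product_def
    proof (rule sum.cong[OF refl], clarify)
      fix S T assume "(S, T) \<in> splits p' q' ?I"
      note ST = splitsD[OF this finite_atLeastAtMost]
      show "(- 1) ^ sch S T * extend_form Lin k S (restrict_str Lin S [1..<Suc (p + q)])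
          * extend_form Lin l T (restrict_str Lin T [1..<Suc (p + q)])
        = (- 1) ^ sch S T * (k (basis_vec [1..<Suc p']) * l (basis_vec [1..<Suc q']))"
        unfolding extend_form_def standardize_increasing_order[OF ST(5)]
          standardize_increasing_order[OF ST(6)] ST(3,4) by (rule mult.assoc)
    qed
    finally show ?thesis by (simp add: sum_distrib_right case_prod_unfold)
  qed
  have "?B p q = ?B q p"
  proof -
    define \<rho> where "\<rho> i = Suc (p + q) - i" for i
    have \<rho>\<rho>: "\<rho> (\<rho> i) = i" and \<rho>I: "\<rho> i \<in> ?I" if "i \<in> ?I" for i using that by (auto simp: \<rho>_def)
    have \<rho>_less: "\<rho> i < \<rho> j \<longleftrightarrow> j < i" if "i \<in> ?I" "j \<in> ?I" for i j using that by (auto simp: \<rho>_def)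
    have inj: "inj_on \<rho> ?I" by (rule inj_on_inverseI[of _ \<rho>]) (rule \<rho>\<rho>)
    have im: "\<rho> ` ?I = ?I" using \<rho>\<rho> \<rho>I by (auto simp: image_iff) (metis atLeastAtMost_iff)
    have \<rho>\<rho>_image: "\<rho> ` \<rho> ` S = S" if "S \<subseteq> ?I" for S
    proof -
      have "\<rho> (\<rho> i) = i" if "i \<in> S" for i using \<rho>\<rho> that \<open>S \<subseteq> ?I\<close> by blast
      then show ?thesis by (simp add: image_image)
    qed
    have splits: "(\<rho> ` T, \<rho> ` S) \<in> splits q' p' ?I" if "(S, T) \<in> splits p' q' ?I" for S T p' q'
    proof -
      note ST = splitsD[OF that finite_atLeastAtMost]
      have "\<rho> ` T \<union> \<rho> ` S = ?I" using ST(1) im by (metis image_Un sup_commute)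
      moreover have "\<rho> ` T \<inter> \<rho> ` S = {}" using inj_on_image_Int[OF inj ST(6,5)] ST(2) by (simp add: Int_commute)
      moreover have "card (\<rho> ` T) = q'" "card (\<rho> ` S) = p'"
        using ST(3,4) card_image[OF inj_on_subset[OF inj ST(5)]] card_image[OF inj_on_subset[OF inj ST(6)]]
        by simp_all
      ultimately show ?thesis by (simp add: splits_def)
    qed
    have sch: "sch (\<rho> ` T) (\<rho> ` S) = sch S T" if "S \<subseteq> ?I" "T \<subseteq> ?I" for S T
    proof -
      have "{(t, s) \<in> \<rho> ` T \<times> \<rho> ` S. t > s} = (\<lambda>(s, t). (\<rho> t, \<rho> s)) ` {(s, t) \<in> S \<times> T. s > t}"
        using that \<rho>_less by (force simp: subset_iff image_iff)
      moreover have "inj_on (\<lambda>(s, t). (\<rho> t, \<rho> s)) {(s, t) \<in> S \<times> T. s > t}"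
      proof (rule inj_on_inverseI[of _ "\<lambda>(t, s). (\<rho> s, \<rho> t)"])
        fix x assume "x \<in> {(s, t) \<in> S \<times> T. s > t}"
        then obtain s t where x: "x = (s, t)" "s \<in> ?I" "t \<in> ?I" using \<open>S \<subseteq> ?I\<close> \<open>T \<subseteq> ?I\<close> by blast
        then show "(\<lambda>(t, s). (\<rho> s, \<rho> t)) ((\<lambda>(s, t). (\<rho> t, \<rho> s)) x) = x"
          by (simp only: prod.case \<rho>\<rho>)
      qed
      ultimately show ?thesis by (simp add: sch_def card_image)
    qed
    show ?thesis
    proof (rule sum.reindex_bij_witness[of _ "\<lambda>(S, T). (\<rho> ` T, \<rho> ` S)" "\<lambda>(S, T). (\<rho> ` T, \<rho> ` S)"])
      fix x assume "x \<in> splits p q ?I"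
      then obtain S T where x: "x = (S, T)" "(S, T) \<in> splits p q ?I" by (cases x) auto
      note ST = splitsD[OF x(2) finite_atLeastAtMost]
      show "(\<lambda>(S, T). (\<rho> ` T, \<rho> ` S)) ((\<lambda>(S, T). (\<rho> ` T, \<rho> ` S)) x) = x"
        by (simp only: x(1) prod.case \<rho>\<rho>_image ST)
      show "(\<lambda>(S, T). (\<rho> ` T, \<rho> ` S)) x \<in> splits q p ?I"
        unfolding x(1) prod.case by (rule splits[OF x(2)])
      show "(\<lambda>(S, T). (- 1 :: 'k) ^ sch S T) ((\<lambda>(S, T). (\<rho> ` T, \<rho> ` S)) x) = (\<lambda>(S, T). (- 1) ^ sch S T) x"
        by (simp only: x(1) prod.case sch[OF ST(5,6)])
    next
      fix x assume "x \<in> splits q p ?I"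
      then obtain S T where x: "x = (S, T)" "(S, T) \<in> splits q p ?I" by (cases x) auto
      note ST = splitsD[OF x(2) finite_atLeastAtMost]
      show "(\<lambda>(S, T). (\<rho> ` T, \<rho> ` S)) ((\<lambda>(S, T). (\<rho> ` T, \<rho> ` S)) x) = x"
        by (simp only: x(1) prod.case \<rho>\<rho>_image ST)
      show "(\<lambda>(S, T). (\<rho> ` T, \<rho> ` S)) x \<in> splits p q ?I"
        unfolding x(1) prod.case by (rule splits[OF x(2)])
    qed
  qed
  then show "cup Lin p q f g (basis_vec [1..<Suc (p + q)]) = cup Lin q p g f (basis_vec [1..<Suc (p + q)])"
    unfolding at_id[OF refl] at_id[OF add.commute] by (simp only: mult_ac)
qed

abbreviation pull_form :: "nat \<Rightarrow> ((nat set list \<Rightarrow> 'k::comm_ring_1) \<Rightarrow> 'k) \<Rightarrow> (nat list \<Rightarrow> 'k) \<Rightarrow> 'k" where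
  "pull_form p \<equiv> koszul_pullback p LL L_to_C"

lemma pull_form_eq:
  fixes f :: "(nat set list \<Rightarrow> 'k::comm_ring_1) \<Rightarrow> 'k"
  assumes f: "f \<in> koszul p CC"
  shows "pull_form p f = linear_form Lin p (\<lambda>xs. f (basis_vec (singletons xs)))"
proof
  fix z :: "nat list \<Rightarrow> 'k"
  let ?I = "{1..p}"
  show "pull_form p f z = linear_form Lin p (\<lambda>xs. f (basis_vec (singletons xs))) z"
  proof (cases "z \<in> free_module (str Lin ?I)")
    case True
    have "linear_on (free_module (str Comp ?I)) fscale (*) f"
      using f by (simp add: koszul_def Comp.obj_linearize Comp.scal_linearize)
    then have "linear_on (free_module (str Lin ?I)) fscale (*) (\<lambda>z. f (L_to_C ?I z))"
      using L_to_C_linear[where 'k = 'k, of ?I] by (auto simp: linear_on_def)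
    then have "f (L_to_C ?I z) = (\<Sum>xs\<in>str Lin ?I. z xs * f (L_to_C ?I (basis_vec xs)))"
      using True by (intro linear_on_free_module_expand) (simp_all add: Lin.finite_str)
    also have "\<dots> = (\<Sum>xs\<in>str Lin ?I. z xs * f (basis_vec (singletons xs)))"
      by (intro sum.cong refl) (simp add: L_to_C_basis_vec)
    finally show ?thesis
      using True by (simp add: koszul_pullback_def linear_form_def Lin.obj_linearize)
  next
    case False
    then show ?thesis by (simp add: koszul_pullback_def linear_form_def Lin.obj_linearize)
  qed
qed

lemma pull_form_closed:
  assumes f: "f \<in> koszul p CC"
  shows "pull_form p f \<in> koszul p LL"
  unfolding pull_form_eq[OF f]
proof (rule Lin.linear_form_in_koszul)
  fix \<sigma> xs assume "\<sigma> permutes {1..p}" "xs \<in> str Lin {1..p}"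
  then show "f (basis_vec (singletons (relabel Lin \<sigma> xs))) = of_int (sign \<sigma>) * f (basis_vec (singletons xs))"
    unfolding singletons_relabel by (intro Comp.koszul_relabel[OF f]) (simp_all only: singletons_in_str_iff)
qed

lemma pull_form_basis_vec:
  "\<lbrakk>f \<in> koszul p CC; xs \<in> str Lin {1..p}\<rbrakk> \<Longrightarrow> pull_form p f (basis_vec xs) = f (basis_vec (singletons xs))"
  by (simp only: pull_form_eq Lin.linear_form_basis_vec)

lemma pull_form_cup:
  fixes f g :: "(nat set list \<Rightarrow> 'k::comm_ring_1) \<Rightarrow> 'k"
  assumes f: "f \<in> koszul p CC" and g: "g \<in> koszul q CC"
  shows "pull_form (p + q) (cup Comp p q f g) = cup Lin p q (pull_form p f) (pull_form q g)"
proof (rule Lin.koszul_eqI)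
  show "pull_form (p + q) (cup Comp p q f g) \<in> koszul (p + q) LL"
    by (rule pull_form_closed[OF Comp.cup_closed[OF f g]])
  show "cup Lin p q (pull_form p f) (pull_form q g) \<in> koszul (p + q) LL"
    by (rule Lin.cup_closed[OF pull_form_closed[OF f] pull_form_closed[OF g]])
  fix xs assume xs: "xs \<in> str Lin {1..p + q}"
  have ext: "extend_form Lin (pull_form r k) S (restrict_str Lin S xs)
      = extend_form Comp k S (restrict_str Comp S (singletons xs))"
    if "k \<in> koszul r CC" "S \<subseteq> {1..p + q}" "card S = r" for r S and k :: "(nat set list \<Rightarrow> 'k) \<Rightarrow> 'k"
  proof -
    have fin: "finite S" using that(2) by (rule finite_subset) simp
    have "restrict_str Lin S xs \<in> str Lin S" using that xs by (intro Lin.restrict_closed) simp_all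
    then have "relabel Lin (std S) (restrict_str Lin S xs) \<in> str Lin {1..r}"
      using Lin.relabel_closed[OF fin inj_on_std[OF fin]] std_image[OF fin] that(3) by metis
    then show ?thesis
      by (simp only: extend_form_def pull_form_basis_vec[OF that(1)] singletons_relabel singletons_restrict)
  qed
  have "shuffle_product Lin p q (pull_form p f) (pull_form q g) {1..p + q} xs
      = shuffle_product Comp p q f g {1..p + q} (singletons xs)"
    unfolding shuffle_product_def
  proof (rule sum.cong[OF refl], clarify)
    fix S T assume "(S, T) \<in> splits p q {1..p + q}"
    note ST = splitsD[OF this finite_atLeastAtMost]
    show "(- 1) ^ sch S T * extend_form Lin (pull_form p f) S (restrict_str Lin S xs) *
        extend_form Lin (pull_form q g) T (restrict_str Lin T xs) =
      (- 1) ^ sch S T * extend_form Comp f S (restrict_str Comp S (singletons xs)) *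
        extend_form Comp g T (restrict_str Comp T (singletons xs))"
      by (simp only: ext[OF f ST(5,3)] ext[OF g ST(6,4)])
  qed
  moreover have "singletons xs \<in> str Comp {1..p + q}" using xs by (simp only: singletons_in_str_iff)
  ultimately show "pull_form (p + q) (cup Comp p q f g) (basis_vec xs)
      = cup Lin p q (pull_form p f) (pull_form q g) (basis_vec xs)"
    using xs by (simp only: pull_form_basis_vec[OF Comp.cup_closed[OF f g]] Lin.cup_basis_vec Comp.cup_basis_vec)
qed

lemma whole_block_simplex:
  "G \<in> str Comp {1..p} \<Longrightarrow> ([{1..p}], G) \<in> simplices Comp 1"
  by (simp add: simplices_iff)

text \<open>
  For two elements of one block the transposition fixes \<open>G\<close> but has sign \<open>- 1\<close>.
\<close>
lemma koszul_Comp_vanishes: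
  fixes f :: "(nat set list \<Rightarrow> 'k::comm_ring_1) \<Rightarrow> 'k"
  assumes torsion_free: "\<And>x :: 'k. x + x = 0 \<Longrightarrow> x = 0"
    and f: "f \<in> koszul p CC" and G: "G \<in> str Comp {1..p}" "G \<notin> range singletons"
  shows "f (basis_vec G) = 0"
proof -
  let ?B = "big_block G"
  note B = big_block[OF whole_block_simplex[OF G(1)] G(2)]
  obtain x y where xy: "x \<in> ?B" "y \<in> ?B" "x \<noteq> y"
    using B(2) by (metis card_2_iff' obtain_subset_with_card_n subsetD)
  let ?\<tau> = "Transposition.transpose x y"
  have "?\<tau> permutes {1..p}" using xy B(3) by (intro permutes_swap_id) auto
  then have "f (basis_vec (relabel Comp ?\<tau> G)) = of_int (sign ?\<tau>) * f (basis_vec G)"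
    using G(1) by (rule Comp.koszul_relabel[OF f])
  then have "f (basis_vec G) = - f (basis_vec G)"
    using relabel_transpose_in_block[OF G(1) B(1) xy(1,2)] xy(3) by (simp add: sign_swap_id)
  then have "f (basis_vec G) + f (basis_vec G) = 0" by (metis add.right_inverse)
  then show ?thesis by (rule torsion_free)
qed

lemma pull_form_inj:
  fixes f g :: "(nat set list \<Rightarrow> 'k::comm_ring_1) \<Rightarrow> 'k"
  assumes torsion_free: "\<And>x :: 'k. x + x = 0 \<Longrightarrow> x = 0"
    and f: "f \<in> koszul p CC" and g: "g \<in> koszul p CC" and eq: "pull_form p f = pull_form p g"
  shows "f = g"
proof (rule Comp.koszul_eqI[OF f g])
  fix G assume G: "G \<in> str Comp {1..p}"
  show "f (basis_vec G) = g (basis_vec G)"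
  proof (cases "G \<in> range singletons")
    case True
    then obtain xs where xs: "G = singletons xs" by auto
    then have "xs \<in> str Lin {1..p}" using G by (simp only: singletons_in_str_iff)
    then show ?thesis unfolding xs by (metis eq f g pull_form_basis_vec)
  next
    case False
    then show ?thesis
      using koszul_Comp_vanishes[OF torsion_free f G] koszul_Comp_vanishes[OF torsion_free g G] by simp
  qed
qed

text \<open>
  Extension by zero again; it is alternating because relabelling preserves the property of having
  singleton blocks only.
\<close>
lemma pull_form_surj:
  fixes h :: "(nat list \<Rightarrow> 'k::comm_ring_1) \<Rightarrow> 'k"
  assumes h: "h \<in> koszul p LL"
  obtains f where "f \<in> koszul p CC" "pull_form p f = h"
proof
  define c where "c G = (if G \<in> range singletons then h (basis_vec (map the_elem G)) else 0)" for G
  have c: "c (singletons xs) = h (basis_vec xs)" for xs by (simp add: c_def)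
  show f: "linear_form Comp p c \<in> koszul p CC"
  proof (rule Comp.linear_form_in_koszul)
    fix \<sigma> G assume *: "\<sigma> permutes {1..p}" "G \<in> str Comp {1..p}"
    have iff: "relabel Comp \<sigma> G \<in> range singletons \<longleftrightarrow> G \<in> range singletons"
      using *(1) by (intro relabel_in_range_singletons_iff[OF whole_block_simplex[OF *(2)]])
        (simp add: permutes_inj_on)
    show "c (relabel Comp \<sigma> G) = of_int (sign \<sigma>) * c G"
    proof (cases "G \<in> range singletons")
      case True
      then obtain xs where xs: "G = singletons xs" by auto
      then have "xs \<in> str Lin {1..p}" using * by (simp only: singletons_in_str_iff)
      then show ?thesis
        unfolding xs singletons_relabel[symmetric] c by (rule Lin.koszul_relabel[OF h *(1)])
    next
      case False
      then show ?thesis using iff by (simp add: c_def)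
    qed
  qed
  show "pull_form p (linear_form Comp p c) = h"
  proof (rule Lin.koszul_eqI[OF pull_form_closed[OF f] h])
    fix xs assume xs: "xs \<in> str Lin {1..p}"
    then have "singletons xs \<in> str Comp {1..p}" by (simp only: singletons_in_str_iff)
    then show "pull_form p (linear_form Comp p c) (basis_vec xs) = h (basis_vec xs)"
      by (simp only: pull_form_basis_vec[OF f xs] Comp.linear_form_basis_vec c)
  qed
qed

lemma pull_form_unit: "pull_form 0 (cup_unit Comp) = (cup_unit Lin :: (nat list \<Rightarrow> 'k::comm_ring_1) \<Rightarrow> 'k)"
proof (rule Lin.koszul_eqI[OF pull_form_closed[OF Comp.cup_unit_closed] Lin.cup_unit_closed])
  fix xs assume xs: "xs \<in> str Lin {1..0}"
  then have "singletons xs \<in> str Comp {1..0}" by (simp only: singletons_in_str_iff)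
  then show "pull_form 0 (cup_unit Comp) (basis_vec xs) = (cup_unit Lin (basis_vec xs) :: 'k)"
    unfolding pull_form_basis_vec[OF Comp.cup_unit_closed xs] unfolding Comp.cup_unit_eq Lin.cup_unit_eq
    by (simp only: Comp.linear_form_basis_vec Lin.linear_form_basis_vec[OF xs])
qed

lemma pull_form_add: "pull_form p (f + g) = pull_form p f + pull_form p g"
  by (simp add: koszul_pullback_def fun_eq_iff)

lemma pull_form_zero: "pull_form p 0 = 0"
  by (simp add: koszul_pullback_def fun_eq_iff)

lemma pull_form_sum: "pull_form p (\<Sum>i\<in>A. f i) = (\<Sum>i\<in>A. pull_form p (f i))"
proof (induction A rule: infinite_finite_induct)
  case (insert i A)
  then show ?case by (simp only: sum.insert[OF insert.hyps] pull_form_add)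
qed (simp_all only: sum.infinite sum.empty not_False_eq_True pull_form_zero)

lemma linear_iso_pull_form:
  assumes torsion_free: "\<And>x :: 'k::comm_ring_1. x + x = 0 \<Longrightarrow> x = 0"
  shows "linear_iso (koszul p (CC :: ('k, nat set list \<Rightarrow> 'k) bicomodule)) (\<lambda>c f z. c * f z)
    (koszul p (LL :: ('k, nat list \<Rightarrow> 'k) bicomodule)) (\<lambda>c f z. c * f z) (pull_form p)"
proof -
  have "bij_betw (pull_form p) (koszul p (CC :: ('k, nat set list \<Rightarrow> 'k) bicomodule)) (koszul p LL)"
  proof (rule bij_betw_imageI)
    show "inj_on (pull_form p) (koszul p (CC :: ('k, nat set list \<Rightarrow> 'k) bicomodule))"
      by (rule inj_onI) (rule pull_form_inj[OF torsion_free])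
    show "pull_form p ` koszul p (CC :: ('k, nat set list \<Rightarrow> 'k) bicomodule) = koszul p LL"
    proof
      show "pull_form p ` koszul p (CC :: ('k, nat set list \<Rightarrow> 'k) bicomodule) \<subseteq> koszul p LL"
        by (rule image_subsetI) (rule pull_form_closed)
      show "koszul p LL \<subseteq> pull_form p ` koszul p (CC :: ('k, nat set list \<Rightarrow> 'k) bicomodule)"
      proof
        fix h :: "(nat list \<Rightarrow> 'k) \<Rightarrow> 'k" assume "h \<in> koszul p LL"
        then obtain f where "f \<in> koszul p CC" "pull_form p f = h" by (rule pull_form_surj)
        then show "h \<in> pull_form p ` koszul p CC" by blast
      qed
    qed
  qed
  moreover have "linear_on (koszul p (CC :: ('k, nat set list \<Rightarrow> 'k) bicomodule)) (\<lambda>c f z. c * f z)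
      (\<lambda>c f z. c * f z) (pull_form p)"
    by (auto simp: linear_on_def koszul_pullback_def fun_eq_iff)
  ultimately show ?thesis by (simp only: linear_iso_def)
qed

text \<open>
  Restriction to linear orders is injective and multiplicative, so commutativity is inherited.
\<close>
lemma cup_Comp_commute:
  fixes f g :: "(nat set list \<Rightarrow> 'k::comm_ring_1) \<Rightarrow> 'k"
  assumes torsion_free: "\<And>x :: 'k. x + x = 0 \<Longrightarrow> x = 0"
    and f: "f \<in> koszul p CC" and g: "g \<in> koszul q CC"
  shows "cup Comp p q f g = cup Comp q p g f"
proof (rule pull_form_inj[OF torsion_free])
  show "cup Comp p q f g \<in> koszul (p + q) CC" by (rule Comp.cup_closed[OF f g])
  show "cup Comp q p g f \<in> koszul (p + q) CC" using Comp.cup_closed[OF g f] by (simp add: add.commute)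
  show "pull_form (p + q) (cup Comp p q f g) = pull_form (p + q) (cup Comp q p g f)"
    using pull_form_cup[OF f g] pull_form_cup[OF g f]
      cup_Lin_commute[OF pull_form_closed[OF f] pull_form_closed[OF g]]
    by (simp add: add.commute)
qed

text \<open>
  Injectivity in each degree also ensures that a preimage of a finitely supported family is finitely
  supported.
\<close>
lemma koszul_map_ring_iso:
  assumes torsion_free: "\<And>x :: 'k::comm_ring_1. x + x = 0 \<Longrightarrow> x = 0"
  shows "(koszul_map LL L_to_C :: (nat \<Rightarrow> (nat set list \<Rightarrow> 'k) \<Rightarrow> 'k) \<Rightarrow> _)
    \<in> ring_iso (koszul_algebra Comp) (koszul_algebra Lin)"
proof -
  let ?C = "koszul_algebra Comp :: ('k, nat \<Rightarrow> (nat set list \<Rightarrow> 'k) \<Rightarrow> 'k) module"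
  let ?L = "koszul_algebra Lin :: ('k, nat \<Rightarrow> (nat list \<Rightarrow> 'k) \<Rightarrow> 'k) module"
  let ?\<phi> = "koszul_map LL L_to_C :: (nat \<Rightarrow> (nat set list \<Rightarrow> 'k) \<Rightarrow> 'k) \<Rightarrow> _"
  have \<phi>: "?\<phi> f = (\<lambda>p. pull_form p (f p))" for f by (simp add: koszul_map_def)
  have memC: "f \<in> carrier ?C \<longleftrightarrow> (\<forall>p. f p \<in> koszul p CC) \<and> finite {p. f p \<noteq> 0}" for f
    by (simp add: koszul_algebra_def)
  have memL: "f \<in> carrier ?L \<longleftrightarrow> (\<forall>p. f p \<in> koszul p LL) \<and> finite {p. f p \<noteq> 0}" for f
    by (simp add: koszul_algebra_def)
  have closed: "?\<phi> f \<in> carrier ?L" if "f \<in> carrier ?C" for f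
  proof -
    have "pull_form p (f p) = 0" if "f p = 0" for p by (simp only: that pull_form_zero)
    then have support: "{p. pull_form p (f p) \<noteq> 0} \<subseteq> {p. f p \<noteq> 0}" by blast
    have f: "f p \<in> koszul p CC" "finite {p. f p \<noteq> 0}" for p
      using that unfolding memC by blast+
    have "finite {p. pull_form p (f p) \<noteq> 0}" by (rule finite_subset[OF support f(2)])
    then show ?thesis unfolding memL \<phi> using pull_form_closed[OF f(1)] by (intro conjI allI)
  qed
  have "?\<phi> \<in> ring_hom ?C ?L"
  proof (rule ring_hom_memI)
    fix f g assume "f \<in> carrier ?C" "g \<in> carrier ?C"
    then have fg: "f p \<in> koszul p CC" "g p \<in> koszul p CC" for p by (simp_all only: memC)
    have "pull_form n (cup Comp p (n - p) (f p) (g (n - p)))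
        = cup Lin p (n - p) (pull_form p (f p)) (pull_form (n - p) (g (n - p)))" if "p \<le> n" for n p
      using pull_form_cup[OF fg(1)[of p] fg(2)[of "n - p"]] that by simp
    then have "pull_form n (\<Sum>p\<le>n. cup Comp p (n - p) (f p) (g (n - p)))
        = (\<Sum>p\<le>n. cup Lin p (n - p) (pull_form p (f p)) (pull_form (n - p) (g (n - p))))" for n
      unfolding pull_form_sum by (intro sum.cong refl) simp
    then show "?\<phi> (f \<otimes>\<^bsub>?C\<^esub> g) = ?\<phi> f \<otimes>\<^bsub>?L\<^esub> ?\<phi> g"
      unfolding \<phi> by (simp add: koszul_algebra_def)
    show "?\<phi> (f \<oplus>\<^bsub>?C\<^esub> g) = ?\<phi> f \<oplus>\<^bsub>?L\<^esub> ?\<phi> g"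
      unfolding \<phi> by (rule ext) (simp only: koszul_algebra_def ring.simps module.simps plus_fun_apply pull_form_add)
  next
    show "?\<phi> \<one>\<^bsub>?C\<^esub> = \<one>\<^bsub>?L\<^esub>"
      unfolding \<phi> by (rule ext) (simp add: koszul_algebra_def pull_form_unit pull_form_zero)
  qed (rule closed)
  moreover have "bij_betw ?\<phi> (carrier ?C) (carrier ?L)"
  proof (rule bij_betw_imageI)
    show "inj_on ?\<phi> (carrier ?C)"
    proof (rule inj_onI)
      fix f g assume fg: "f \<in> carrier ?C" "g \<in> carrier ?C" "?\<phi> f = ?\<phi> g"
      have "f p = g p" for p
      proof (rule pull_form_inj[OF torsion_free])
        show "f p \<in> koszul p CC" "g p \<in> koszul p CC" using fg(1,2) by (simp_all only: memC)
        show "pull_form p (f p) = pull_form p (g p)" using fun_cong[OF fg(3), of p] by (simp only: \<phi>)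
      qed
      then show "f = g" by (rule ext)
    qed
    have "h \<in> ?\<phi> ` carrier ?C" if h: "h \<in> carrier ?L" for h
    proof -
      have "\<exists>f\<in>koszul p CC. pull_form p f = h p" for p
      proof -
        have "h p \<in> koszul p LL" using h unfolding memL by blast
        then obtain k where "k \<in> koszul p CC" "pull_form p k = h p" by (rule pull_form_surj)
        then show ?thesis by blast
      qed
      then obtain f where f: "\<And>p. f p \<in> koszul p CC" "\<And>p. pull_form p (f p) = h p" by metis
      have "f p = 0" if hp: "h p = 0" for p
      proof (rule pull_form_inj[OF torsion_free f(1) koszul_zero])
        have "pull_form p (f p) = 0" using f(2)[of p] hp by (rule trans)
        then show "pull_form p (f p) = pull_form p 0" by (rule trans[OF _ pull_form_zero[symmetric]])
      qed
      then have "{p. f p \<noteq> 0} \<subseteq> {p. h p \<noteq> 0}" by blast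
      moreover have "finite {p. h p \<noteq> 0}" using h unfolding memL by blast
      ultimately have "finite {p. f p \<noteq> 0}" by (rule finite_subset)
      then have "f \<in> carrier ?C" unfolding memC using f(1) by blast
      moreover have "?\<phi> f = h" unfolding \<phi> f(2) ..
      ultimately show ?thesis by blast
    qed
    then show "?\<phi> ` carrier ?C = carrier ?L" using closed by blast
  qed
  ultimately show ?thesis by (simp add: ring_iso_def)
qed

section \<open>The comparison of linear orders and compositions\<close>

theorem proposition3p8:
  assumes "CHAR('k::comm_ring_1) \<noteq> 2"
  shows
    "(\<forall>n. linear_iso
            (cohomology n (CC :: ('k, nat set list \<Rightarrow> 'k) bicomodule)) (class_scale n CC)
            (cohomology n (LL :: ('k, nat list \<Rightarrow> 'k) bicomodule)) (class_scale n LL)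
            (cohomology_map n LL L_to_C)) \<and>
     ((\<forall>x::'k. x + x = 0 \<longrightarrow> x = 0) \<longrightarrow>
        algebra (scalar_ring :: 'k ring) (koszul_algebra Comp) \<and>
        algebra (scalar_ring :: 'k ring) (koszul_algebra Lin) \<and>
        graded_commutative Comp TYPE('k) \<and>
        graded_commutative Lin TYPE('k) \<and>
        (koszul_map LL L_to_C :: (nat \<Rightarrow> (nat set list \<Rightarrow> 'k) \<Rightarrow> 'k) \<Rightarrow> _)
          \<in> ring_iso (koszul_algebra Comp) (koszul_algebra Lin) \<and>
        (\<forall>p. linear_iso
               (koszul p (CC :: ('k, nat set list \<Rightarrow> 'k) bicomodule)) (\<lambda>c f z. c * f z)
               (koszul p (LL :: ('k, nat list \<Rightarrow> 'k) bicomodule)) (\<lambda>c f z. c * f z)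
               (koszul_pullback p LL L_to_C)))"
proof (intro conjI impI)
  show "\<forall>n. linear_iso
      (cohomology n (CC :: ('k, nat set list \<Rightarrow> 'k) bicomodule)) (class_scale n CC)
      (cohomology n (LL :: ('k, nat list \<Rightarrow> 'k) bicomodule)) (class_scale n LL)
      (cohomology_map n LL L_to_C)"
    by (rule allI) (rule cohomology_map_iso)
next
  assume "\<forall>x::'k. x + x = 0 \<longrightarrow> x = 0"
  then have torsion_free: "\<And>x :: 'k. x + x = 0 \<Longrightarrow> x = 0" by blast
  show "algebra (scalar_ring :: 'k ring) (koszul_algebra Comp)"
    by (rule Comp.algebra_koszul_algebra) (rule cup_Comp_commute[OF torsion_free])
  show "algebra (scalar_ring :: 'k ring) (koszul_algebra Lin)"
    by (rule Lin.algebra_koszul_algebra) (rule cup_Lin_commute)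
  show "graded_commutative Comp TYPE('k)"
    unfolding graded_commutative_def by (intro ballI allI) (rule Comp.cup_graded_commute)
  show "graded_commutative Lin TYPE('k)"
    unfolding graded_commutative_def by (intro ballI allI) (rule Lin.cup_graded_commute)
  show "(koszul_map LL L_to_C :: (nat \<Rightarrow> (nat set list \<Rightarrow> 'k) \<Rightarrow> 'k) \<Rightarrow> _)
      \<in> ring_iso (koszul_algebra Comp) (koszul_algebra Lin)"
    by (rule koszul_map_ring_iso[OF torsion_free])
  show "\<forall>p. linear_iso
      (koszul p (CC :: ('k, nat set list \<Rightarrow> 'k) bicomodule)) (\<lambda>c f z. c * f z)
      (koszul p (LL :: ('k, nat list \<Rightarrow> 'k) bicomodule)) (\<lambda>c f z. c * f z)
      (koszul_pullback p LL L_to_C)"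
    by (rule allI) (rule linear_iso_pull_form[OF torsion_free])
qed

end
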